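(* Assume $f_j'(u)+1\ne0$ for all $u$ and all $j$, and let $\ell\ge2$. For $P\in\mathcal M_F$ and a normalized basis $\mathcal B=\{U_0,\dots,U_k,V_0,\dots,V_k,S_1,\dots,S_k\}$ of $(T_P\mathcal M_F,g_F|_P,R_P)$ set $$\gamma_\ell=\sum_{j=1}^k\nabla^\ell R(U_0,U_j,U_j,U_0;U_j,\dots,U_j)\cdot\bigl(\nabla R(U_0,U_j,U_j,U_0;U_j)\bigr)^{\ell-2}$$ (with the convention $x^0=1$). Then: (1) $\gamma_\ell$ is independent of the normalized basis chosen, and is an $\ell$-model invariant: if $F'$ is another $k$-tuple satisfying the same hypotheses (same signs $\varepsilon_i$), $P\in\mathcal M_F$, $Q\in\mathcal M_{F'}$, and $\Phi:T_P\mathcal M_F\to T_Q\mathcal M_{F'}$ is a linear isometry with $\Phi^*(\nabla^iR)_Q=(\nabla^iR)_P$ for $0\le i\le\ell$, then $\gamma_\ell^F(P)=\gamma_\ell^{F'}(Q)$. (2) $\gamma_2=\sum_{j=1}^k\dfrac{\varepsilon_j}{(f_j'+1)^2}\Bigl(4(f_j')^2+2f_j'+6f_jf_j''-\dfrac{f_j^2f_j'''}{f_j'+1}\Bigr)$, where $f_j$ and its derivatives are evaluated at $u_j$. (3) If $\mathcal M_F$ is $\ell$-curvature homogeneous, then $\gamma_p$ is constant on $\mathcal M_F$ for $2\le p\le\ell$. (4) If $\mathcal M_F$ is locally homogeneous, then $\gamma_\ell$ is constant for all $\ell\ge2$.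
   Context: Fix an integer $k\ge 1$ and signs $\varepsilon_1,\dots,\varepsilon_k\in\{\pm1\}$. Let $f_1,\dots,f_k:\mathbb R\to\mathbb R$ be smooth, $F=(f_1,\dots,f_k)$. On $\mathbb R^{3k+2}$ with coordinates $(u_0,\dots,u_k,v_0,\dots,v_k,s_1,\dots,s_k)$ let $g_F$ be the symmetric metric whose only nonzero components on coordinate vector fields are (up to symmetry), for $1\le i\le k$ and $0\le i',j\le k$: $g_F(\partial_{u_0},\partial_{u_i})=2f_i(u_i)s_i$, $g_F(\partial_{u_i},\partial_{u_i})=-2u_0s_i$, $g_F(\partial_{u_{i'}},\partial_{v_j})=\delta_{i'j}$, $g_F(\partial_{s_i},\partial_{s_i})=\varepsilon_i$; $\mathcal M_F=(\mathbb R^{3k+2},g_F)$. $\nabla$ is the Levi-Civita connection, $R(X,Y,Z,W)=g_F(\nabla_X\nabla_YZ-\nabla_Y\nabla_XZ-\nabla_{[X,Y]}Z,W)$, $\nabla^0R=R$, and $\nabla^\ell R(X_1,\dots,X_4;Y_1,\dots,Y_\ell)=(\nabla_{Y_\ell}\nabla^{\ell-1}R)(X_1,\dots,X_4;Y_1,\dots,Y_{\ell-1})$. A normalized basis of $(T_P\mathcal M_F,g_F|_P,R_P)$ is a basis $\{U_0,\dots,U_k,V_0,\dots,V_k,S_1,\dots,S_k\}$ on which the only nonzero values of $g_F|_P$ on pairs of basis vectors are $g(U_i,V_i)=1$ ($0\le i\le k$) and $g(S_i,S_i)=\varepsilon_i$ ($1\le i\le k$), and the only nonzero values of $R_P$ on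 4-tuples of basis vectors are those obtained from $R(U_0,U_i,U_i,S_i)=1$ ($1\le i\le k$) via the curvature symmetries $R(x,y,z,w)=-R(y,x,z,w)=R(z,w,x,y)$. A pseudo-Riemannian manifold $(M,g)$ is $\ell$-curvature homogeneous if for all $P,Q\in M$ there is a linear isometry $\Phi:T_PM\to T_QM$ with $\Phi^*(\nabla^iR)_Q=(\nabla^iR)_P$ for $i=0,\dots,\ell$; it is locally homogeneous if for all $P,Q$ there is an isometry between neighborhoods of $P$ and $Q$ sending $P$ to $Q$. *)

theory Defs
  imports "HOL-Analysis.Analysis"
begin

text \<open>Points and tangent vectors of R^n are represented as functions nat => real
  vanishing at indices >= n. Coordinates of M_F (n = 3k+2):
  u_i at index i (0 <= i <= k), v_i at index k+1+i (0 <= i <= k),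
  s_i at index 2k+1+i (1 <= i <= k).\<close>

type_synonym pt = "nat \<Rightarrow> real"

definition space :: "nat \<Rightarrow> pt set" where
  "space n = {x. \<forall>i\<ge>n. x i = 0}"

definition pd :: "nat \<Rightarrow> (pt \<Rightarrow> real) \<Rightarrow> pt \<Rightarrow> real" where
  "pd a h x = deriv (\<lambda>t. h (x(a := t))) (x a)"

definition ginv :: "nat \<Rightarrow> (pt \<Rightarrow> nat \<Rightarrow> nat \<Rightarrow> real) \<Rightarrow> pt \<Rightarrow> nat \<Rightarrow> nat \<Rightarrow> real" where
  "ginv n g x = (THE M. (\<forall>i<n. \<forall>j<n. (\<Sum>l<n. g x i l * M l j) = (if i = j then 1 else 0))
                     \<and> (\<forall>i j. \<not> (i < n \<and> j < n) \<longrightarrow> M i j = 0))"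

definition chr :: "nat \<Rightarrow> (pt \<Rightarrow> nat \<Rightarrow> nat \<Rightarrow> real) \<Rightarrow> pt \<Rightarrow> nat \<Rightarrow> nat \<Rightarrow> nat \<Rightarrow> real" where
  "chr n g x m a b = (\<Sum>l<n. ginv n g x m l *
      (pd a (\<lambda>y. g y b l) x + pd b (\<lambda>y. g y a l) x - pd l (\<lambda>y. g y a b) x) / 2)"

text \<open>R(d_a,d_b,d_c,d_d) = g(nabla_a nabla_b d_c - nabla_b nabla_a d_c, d_d).\<close>
definition Riem :: "nat \<Rightarrow> (pt \<Rightarrow> nat \<Rightarrow> nat \<Rightarrow> real) \<Rightarrow> pt \<Rightarrow> nat \<Rightarrow> nat \<Rightarrow> nat \<Rightarrow> nat \<Rightarrow> real" where
  "Riem n g x a b c d = (\<Sum>f<n.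
      (pd a (\<lambda>y. chr n g y f b c) x - pd b (\<lambda>y. chr n g y f a c) x
       + (\<Sum>e<n. chr n g x e b c * chr n g x f a e - chr n g x e a c * chr n g x f b e))
      * g x f d)"

text \<open>Components of nabla^l R; the last index is the latest differentiation direction:
  nabla^l R(X1..X4;Y1..Yl) = (nabla_{Yl} nabla^{l-1}R)(X1..X4;Y1..Y(l-1)).\<close>
fun nablaR :: "nat \<Rightarrow> (pt \<Rightarrow> nat \<Rightarrow> nat \<Rightarrow> real) \<Rightarrow> nat \<Rightarrow> pt \<Rightarrow> nat list \<Rightarrow> real" where
  "nablaR n g 0 x is = (case is of [a, b, c, d] \<Rightarrow> Riem n g x a b c d | _ \<Rightarrow> 0)"
| "nablaR n g (Suc l) x is =
     (let js = butlast is; c = last is in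
        pd c (\<lambda>y. nablaR n g l y js) x
        - (\<Sum>r<length js. \<Sum>e<n. chr n g x e c (js ! r) * nablaR n g l x (js[r := e])))"

fun teval :: "nat \<Rightarrow> (nat list \<Rightarrow> real) \<Rightarrow> pt list \<Rightarrow> real" where
  "teval n T [] = T []"
| "teval n T (v # vs) = (\<Sum>i<n. v i * teval n (\<lambda>is. T (i # is)) vs)"

definition gv :: "nat \<Rightarrow> (pt \<Rightarrow> nat \<Rightarrow> nat \<Rightarrow> real) \<Rightarrow> pt \<Rightarrow> pt \<Rightarrow> pt \<Rightarrow> real" where
  "gv n g x v w = (\<Sum>a<n. \<Sum>b<n. v a * w b * g x a b)"

definition mapv :: "nat \<Rightarrow> (nat \<Rightarrow> nat \<Rightarrow> real) \<Rightarrow> pt \<Rightarrow> pt" where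
  "mapv n A v = (\<lambda>i. if i < n then (\<Sum>j<n. A i j * v j) else 0)"

definition model_iso :: "nat \<Rightarrow> (pt \<Rightarrow> nat \<Rightarrow> nat \<Rightarrow> real) \<Rightarrow> pt \<Rightarrow> (pt \<Rightarrow> nat \<Rightarrow> nat \<Rightarrow> real) \<Rightarrow> pt
     \<Rightarrow> nat \<Rightarrow> (nat \<Rightarrow> nat \<Rightarrow> real) \<Rightarrow> bool" where
  "model_iso n g1 x g2 y l A \<longleftrightarrow>
     (\<forall>v\<in>space n. \<forall>w\<in>space n. gv n g2 y (mapv n A v) (mapv n A w) = gv n g1 x v w)
   \<and> (\<forall>i\<le>l. \<forall>vs. set vs \<subseteq> space n \<and> length vs = 4 + i \<longrightarrow>
        teval n (nablaR n g2 i y) (map (mapv n A) vs) = teval n (nablaR n g1 i x) vs)"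

definition curv_hom :: "nat \<Rightarrow> (pt \<Rightarrow> nat \<Rightarrow> nat \<Rightarrow> real) \<Rightarrow> nat \<Rightarrow> bool" where
  "curv_hom n g l \<longleftrightarrow> (\<forall>x\<in>space n. \<forall>y\<in>space n. \<exists>A. model_iso n g x g y l A)"

definition open_in_space :: "nat \<Rightarrow> pt set \<Rightarrow> bool" where
  "open_in_space n W \<longleftrightarrow> W \<subseteq> space n \<and>
     (\<forall>x\<in>W. \<exists>e>0. \<forall>y\<in>space n. (\<forall>i<n. \<bar>y i - x i\<bar> < e) \<longrightarrow> y \<in> W)"

definition cont_on_space :: "nat \<Rightarrow> pt set \<Rightarrow> (pt \<Rightarrow> real) \<Rightarrow> bool" where
  "cont_on_space n W h \<longleftrightarrow> (\<forall>x\<in>W. \<forall>e>0. \<exists>d>0. \<forall>y\<in>W.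
      (\<forall>i<n. \<bar>y i - x i\<bar> < d) \<longrightarrow> \<bar>h y - h x\<bar> < e)"

fun ipd :: "nat list \<Rightarrow> (pt \<Rightarrow> real) \<Rightarrow> pt \<Rightarrow> real" where
  "ipd [] h = h"
| "ipd (a # as) h = pd a (ipd as h)"

definition smooth_fn :: "nat \<Rightarrow> pt set \<Rightarrow> (pt \<Rightarrow> real) \<Rightarrow> bool" where
  "smooth_fn n W h \<longleftrightarrow> (\<forall>as. set as \<subseteq> {..<n} \<longrightarrow>
      cont_on_space n W (ipd as h) \<and>
      (\<forall>x\<in>W. \<forall>a<n. (\<lambda>t. ipd as h (x(a := t))) differentiable (at (x a))))"

definition smooth_map :: "nat \<Rightarrow> pt set \<Rightarrow> (pt \<Rightarrow> pt) \<Rightarrow> bool" where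
  "smooth_map n W \<phi> \<longleftrightarrow> (\<forall>c<n. smooth_fn n W (\<lambda>x. \<phi> x c))"

definition local_isometry_at :: "nat \<Rightarrow> (pt \<Rightarrow> nat \<Rightarrow> nat \<Rightarrow> real) \<Rightarrow> pt \<Rightarrow> pt \<Rightarrow> bool" where
  "local_isometry_at n g x y \<longleftrightarrow> (\<exists>W1 W2 \<phi> \<psi>.
     open_in_space n W1 \<and> open_in_space n W2 \<and> x \<in> W1 \<and> \<phi> x = y \<and>
     \<phi> ` W1 \<subseteq> W2 \<and> \<psi> ` W2 \<subseteq> W1 \<and>
     (\<forall>z\<in>W1. \<psi> (\<phi> z) = z) \<and> (\<forall>z\<in>W2. \<phi> (\<psi> z) = z) \<and>
     smooth_map n W1 \<phi> \<and> smooth_map n W2 \<psi> \<and>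
     (\<forall>z\<in>W1. \<forall>a<n. \<forall>b<n.
        (\<Sum>c<n. \<Sum>d<n. pd a (\<lambda>w. \<phi> w c) z * pd b (\<lambda>w. \<phi> w d) z * g (\<phi> z) c d) = g z a b))"

definition loc_hom :: "nat \<Rightarrow> (pt \<Rightarrow> nat \<Rightarrow> nat \<Rightarrow> real) \<Rightarrow> bool" where
  "loc_hom n g \<longleftrightarrow> (\<forall>x\<in>space n. \<forall>y\<in>space n. local_isometry_at n g x y)"

definition smooth_real :: "(real \<Rightarrow> real) \<Rightarrow> bool" where
  "smooth_real h \<longleftrightarrow> (\<forall>m x. ((deriv ^^ m) h) differentiable (at x))"

definition gF :: "nat \<Rightarrow> (nat \<Rightarrow> real) \<Rightarrow> (nat \<Rightarrow> real \<Rightarrow> real) \<Rightarrow> pt \<Rightarrow> nat \<Rightarrow> nat \<Rightarrow> real" where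
  "gF k eps f x a b =
    (if a = 0 \<and> 1 \<le> b \<and> b \<le> k then 2 * f b (x b) * x (2*k+1+b)
     else if b = 0 \<and> 1 \<le> a \<and> a \<le> k then 2 * f a (x a) * x (2*k+1+a)
     else if a = b \<and> 1 \<le> a \<and> a \<le> k then -2 * x 0 * x (2*k+1+a)
     else if a \<le> k \<and> b = k+1+a then 1
     else if b \<le> k \<and> a = k+1+b then 1
     else if a = b \<and> 2*k+2 \<le> a \<and> a \<le> 3*k+1 then eps (a - (2*k+1))
     else 0)"

datatype lbl = LU nat | LV nat | LS nat

definition lbls :: "nat \<Rightarrow> lbl set" where
  "lbls k = LU ` {0..k} \<union> LV ` {0..k} \<union> LS ` {1..k}"

definition g_norm :: "(nat \<Rightarrow> real) \<Rightarrow> lbl \<Rightarrow> lbl \<Rightarrow> real" where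
  "g_norm eps a b = (case (a, b) of
      (LU i, LV j) \<Rightarrow> (if i = j then 1 else 0)
    | (LV i, LU j) \<Rightarrow> (if i = j then 1 else 0)
    | (LS i, LS j) \<Rightarrow> (if i = j then eps i else 0)
    | _ \<Rightarrow> 0)"

definition R_gen :: "lbl \<Rightarrow> lbl \<Rightarrow> lbl \<Rightarrow> lbl \<Rightarrow> real" where
  "R_gen a b c d = (if \<exists>i\<ge>1. a = LU 0 \<and> b = LU i \<and> c = LU i \<and> d = LS i then 1 else 0)"

text \<open>Values generated from R(U0,Ui,Ui,Si)=1 by R(x,y,z,w) = -R(y,x,z,w) = R(z,w,x,y).\<close>
definition R_norm :: "lbl \<Rightarrow> lbl \<Rightarrow> lbl \<Rightarrow> lbl \<Rightarrow> real" where
  "R_norm a b c d = R_gen a b c d - R_gen b a c d - R_gen a b d c + R_gen b a d c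
                  + R_gen c d a b - R_gen d c a b - R_gen c d b a + R_gen d c b a"

definition normalized_basis :: "nat \<Rightarrow> (nat \<Rightarrow> real) \<Rightarrow> (nat \<Rightarrow> real \<Rightarrow> real) \<Rightarrow> pt
     \<Rightarrow> (lbl \<Rightarrow> pt) \<Rightarrow> bool" where
  "normalized_basis k eps f x B \<longleftrightarrow>
     (\<forall>l\<in>lbls k. B l \<in> space (3*k+2))
   \<and> (\<forall>c. (\<forall>i. (\<Sum>l\<in>lbls k. c l * B l i) = 0) \<longrightarrow> (\<forall>l\<in>lbls k. c l = 0))
   \<and> (\<forall>a\<in>lbls k. \<forall>b\<in>lbls k. gv (3*k+2) (gF k eps f) x (B a) (B b) = g_norm eps a b)
   \<and> (\<forall>a\<in>lbls k. \<forall>b\<in>lbls k. \<forall>c\<in>lbls k. \<forall>d\<in>lbls k.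
        teval (3*k+2) (nablaR (3*k+2) (gF k eps f) 0 x) [B a, B b, B c, B d] = R_norm a b c d)"

definition gammaF :: "nat \<Rightarrow> (nat \<Rightarrow> real) \<Rightarrow> (nat \<Rightarrow> real \<Rightarrow> real) \<Rightarrow> nat \<Rightarrow> pt \<Rightarrow> (lbl \<Rightarrow> pt) \<Rightarrow> real" where
  "gammaF k eps f l x B = (\<Sum>j=1..k.
     teval (3*k+2) (nablaR (3*k+2) (gF k eps f) l x)
        ([B (LU 0), B (LU j), B (LU j), B (LU 0)] @ replicate l (B (LU j)))
   * (teval (3*k+2) (nablaR (3*k+2) (gF k eps f) 1 x)
        [B (LU 0), B (LU j), B (LU j), B (LU 0), B (LU j)]) ^ (l - 2))"

definition admissible :: "nat \<Rightarrow> (nat \<Rightarrow> real) \<Rightarrow> (nat \<Rightarrow> real \<Rightarrow> real) \<Rightarrow> bool" where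
  "admissible k eps f \<longleftrightarrow> (\<forall>i\<in>{1..k}. eps i = 1 \<or> eps i = -1) \<and>
     (\<forall>j\<in>{1..k}. smooth_real (f j) \<and> (\<forall>u. deriv (f j) u + 1 \<noteq> 0))"

end

theory Submission
  imports Defs "Jordan_Normal_Form.Determinant"
begin

text \<open>
  Write \<open>\<omega>\<^sub>i = du\<^sub>0 \<and> du\<^sub>i\<close> and \<open>\<tau>\<^sub>i = du\<^sub>i \<and> ds\<^sub>i\<close>. The forms \<open>du\<^sub>i\<close> are parallel, and
  \<open>\<nabla>\<tau>\<^sub>i = - \<epsilon>\<^sub>i f\<^sub>i \<omega>\<^sub>i \<otimes> du\<^sub>i\<close>. Hence
  \<open>\<nabla>\<^sup>l R = \<Sum>\<^sub>i (B\<^sub>i\<^sub>l (\<omega>\<^sub>i \<tau>\<^sub>i + \<tau>\<^sub>i \<omega>\<^sub>i) - A\<^sub>i\<^sub>l \<omega>\<^sub>i \<omega>\<^sub>i) \<otimes> du\<^sub>i\<^sup>l\<close>, where the coefficients are functions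
  of \<open>u\<^sub>i\<close> with \<open>B\<^sub>i\<^sub>0 = 1 + f\<^sub>i'\<close>, \<open>A\<^sub>i\<^sub>0 = \<epsilon>\<^sub>i f\<^sub>i\<^sup>2\<close>, \<open>B\<^sub>i\<^sub>,\<^sub>l\<^sub>+\<^sub>1 = B\<^sub>i\<^sub>l'\<close> and
  \<open>A\<^sub>i\<^sub>,\<^sub>l\<^sub>+\<^sub>1 = A\<^sub>i\<^sub>l' + 2 \<epsilon>\<^sub>i f\<^sub>i B\<^sub>i\<^sub>l\<close>.

  In a normalized basis the vectors \<open>U\<^sub>j\<close> have, up to a permutation of the indices, only one
  nonzero component among \<open>u\<^sub>1, \<dots>, u\<^sub>k\<close>; the normalization fixes \<open>(U\<^sub>0)\<^sub>0 (U\<^sub>j)\<^sub>i\<^sup>2\<close> up to sign and,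
  through \<open>R(U\<^sub>0, U\<^sub>j, U\<^sub>j, U\<^sub>0) = 0\<close>, the ratio of the \<open>s\<^sub>i\<close>- and \<open>u\<^sub>0\<close>-components of \<open>U\<^sub>0\<close>. The powers
  in \<open>\<gamma>\<^sub>l\<close> are chosen so that all remaining freedom cancels, which leaves a function of the point
  alone. A linear model isomorphism carries normalized bases to normalized bases, and the differential of
  a local isometry is a model isomorphism of every order because it intertwines the Christoffel symbols.
\<close>

section \<open>Preliminaries\<close>

text \<open>The finite-dimensional fact behind the completeness relation of a basis and the
  invertibility of a Jacobian below; the entry functions are wrapped as matrices to obtain
  it.\<close>

lemma left_inverse_imp_right_inverse:
  fixes P Q :: "nat \<Rightarrow> nat \<Rightarrow> real"
  assumes PQ: "\<And>i j. i < n \<Longrightarrow> j < n \<Longrightarrow> (\<Sum>l<n. P i l * Q l j) = (if i = j then 1 else 0)"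
    and ij: "i < n" "j < n"
  shows "(\<Sum>l<n. Q i l * P l j) = (if i = j then 1 else 0)"
proof -
  let ?P = "mat n n (\<lambda>(i, j). P i j)" and ?Q = "mat n n (\<lambda>(i, j). Q i j)"
  have "?P * ?Q = 1\<^sub>m n"
    using PQ by (intro eq_matI) (auto simp: scalar_prod_def lessThan_atLeast0 row_def col_def)
  then have "?Q * ?P = 1\<^sub>m n"
    by (rule mat_mult_left_right_inverse[rotated 2]) auto
  then have "(?Q * ?P) $$ (i, j) = 1\<^sub>m n $$ (i, j)" by simp
  then show ?thesis
    using ij by (simp add: scalar_prod_def lessThan_atLeast0 row_def col_def)
qed

text \<open>
  Total differentiability, stated as the chain rule along curves; this avoids a norm on the space of points.
\<close>

definition has_total_deriv :: "nat \<Rightarrow> (pt \<Rightarrow> real) \<Rightarrow> (nat \<Rightarrow> real) \<Rightarrow> pt \<Rightarrow> bool" where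
  "has_total_deriv n h D x \<longleftrightarrow> (\<forall>c c' t.
     c t = x \<and> (\<forall>i<n. ((\<lambda>s. c s i) has_real_derivative c' i) (at t)) \<longrightarrow>
     ((\<lambda>s. h (c s)) has_real_derivative (\<Sum>i<n. D i * c' i)) (at t))"

lemma has_total_derivD:
  assumes "has_total_deriv n h D x" "c t = x"
    and "\<And>i. i < n \<Longrightarrow> ((\<lambda>s. c s i) has_real_derivative c' i) (at t)"
  shows "((\<lambda>s. h (c s)) has_real_derivative (\<Sum>i<n. D i * c' i)) (at t)"
  using assms unfolding has_total_deriv_def by blast

lemma has_total_deriv_line:
  assumes "has_total_deriv n h D x" "a < n"
  shows "((\<lambda>t. h (x(a := t))) has_real_derivative D a) (at (x a))"
proof -
  have "((\<lambda>t. h (x(a := t))) has_real_derivative (\<Sum>i<n. D i * (if i = a then 1 else 0))) (at (x a))"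
    by (rule has_total_derivD[OF assms(1), where c = "\<lambda>t. x(a := t)"]) (auto intro!: derivative_eq_intros)
  then show ?thesis using assms(2) by (simp add: if_distrib cong: if_cong)
qed

lemma has_total_deriv_pd: "has_total_deriv n h D x \<Longrightarrow> a < n \<Longrightarrow> pd a h x = D a"
  unfolding pd_def by (intro DERIV_imp_deriv has_total_deriv_line)

lemma has_total_deriv_cong:
  assumes "has_total_deriv n h D x" "\<And>i. i < n \<Longrightarrow> D i = D' i"
  shows "has_total_deriv n h D' x"
proof -
  have "(\<Sum>i<n. D i * c' i) = (\<Sum>i<n. D' i * c' i)" for c'
    using assms(2) by (intro sum.cong) auto
  then show ?thesis using assms(1) unfolding has_total_deriv_def by simp
qed

text \<open>The first \<open>n\<close> coefficients are forced to be the partial derivatives, so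
  differentiability can be passed on without carrying explicit coefficients.\<close>

lemma has_total_deriv_pd_self: "has_total_deriv n h D x \<Longrightarrow> has_total_deriv n h (\<lambda>i. pd i h x) x"
  by (rule has_total_deriv_cong[of n h D]) (simp_all add: has_total_deriv_pd)

lemma has_total_deriv_const: "has_total_deriv n (\<lambda>y. r) (\<lambda>i. 0) x"
  unfolding has_total_deriv_def by simp

lemma has_total_deriv_coord: "a < n \<Longrightarrow> has_total_deriv n (\<lambda>y. y a) (\<lambda>i. if i = a then 1 else 0) x"
  unfolding has_total_deriv_def by (auto simp: if_distribR if_distrib cong: if_cong)

lemma has_total_deriv_add:
  "has_total_deriv n h D x \<Longrightarrow> has_total_deriv n h' D' x \<Longrightarrow> has_total_deriv n (\<lambda>y. h y + h' y) (\<lambda>i. D i + D' i) x"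
  unfolding has_total_deriv_def by (auto simp: algebra_simps sum.distrib intro!: derivative_eq_intros)

lemma has_total_deriv_mult:
  assumes "has_total_deriv n h D x" "has_total_deriv n h' D' x"
  shows "has_total_deriv n (\<lambda>y. h y * h' y) (\<lambda>i. D i * h' x + h x * D' i) x"
  unfolding has_total_deriv_def
proof (intro allI impI, elim conjE)
  fix c :: "real \<Rightarrow> pt" and c' t
  assume c: "c t = x" "\<forall>i<n. ((\<lambda>s. c s i) has_real_derivative c' i) (at t)"
  note 1 = has_total_derivD[of n h D x c t c'] and 2 = has_total_derivD[of n h' D' x c t c']
  show "((\<lambda>s. h (c s) * h' (c s)) has_real_derivative
          (\<Sum>i<n. (D i * h' x + h x * D' i) * c' i)) (at t)"
    using c assms
    by (auto intro!: DERIV_cong[OF DERIV_mult[OF 1 2]]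
        simp: sum_distrib_left sum_distrib_right algebra_simps sum.distrib)
qed

lemma has_total_deriv_sum:
  assumes "\<And>j. j \<in> I \<Longrightarrow> has_total_deriv n (h j) (D j) x"
  shows "has_total_deriv n (\<lambda>y. \<Sum>j\<in>I. h j y) (\<lambda>i. \<Sum>j\<in>I. D j i) x"
  using assms
  by (induction I rule: infinite_finite_induct) (auto intro: has_total_deriv_const has_total_deriv_add)

lemma has_total_deriv_compose_coord:
  assumes "a < n" "(F has_real_derivative F') (at (x a))"
  shows "has_total_deriv n (\<lambda>y. F (y a)) (\<lambda>i. if i = a then F' else 0) x"
  unfolding has_total_deriv_def
proof (intro allI impI, elim conjE)
  fix c :: "real \<Rightarrow> pt" and c' t
  assume c: "c t = x" "\<forall>i<n. ((\<lambda>s. c s i) has_real_derivative c' i) (at t)"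
  have "((\<lambda>s. F (c s a)) has_real_derivative F' * c' a) (at t)"
    by (rule DERIV_chain2[of F]) (use c assms in auto)
  then show "((\<lambda>s. F (c s a)) has_real_derivative
          (\<Sum>i<n. (if i = a then F' else 0) * c' i)) (at t)"
    using assms(1) by (simp add: if_distribR if_distrib cong: if_cong)
qed

section \<open>Splitting indices into the \<open>u\<close>, \<open>v\<close> and \<open>s\<close>
  blocks\<close>

lemma sum_split3:
  fixes h :: "nat \<Rightarrow> 'a::comm_monoid_add"
  shows "(\<Sum>l<3*k+2. h l) = (\<Sum>i\<le>k. h i) + (\<Sum>i\<le>k. h (k+1+i)) + (\<Sum>i\<in>{1..k}. h (2*k+1+i))"
proof -
  have "(\<Sum>l<3*k+2. h l) = sum h {0..<3*k+2}" by (simp only: atLeast0LessThan)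
  also have "\<dots> = sum h {0..<k+1} + sum h {k+1..<3*k+2}"
    by (rule sum.atLeastLessThan_concat[symmetric]) auto
  also have "sum h {k+1..<3*k+2} = sum h {k+1..<2*k+2} + sum h {2*k+2..<3*k+2}"
    by (rule sum.atLeastLessThan_concat[symmetric]) auto
  also have "sum h {0..<k+1} = (\<Sum>i\<le>k. h i)"
    by (rule sum.cong) auto
  also have "sum h {k+1..<2*k+2} = (\<Sum>i\<le>k. h (k+1+i))"
    by (rule sum.reindex_bij_witness[of _ "\<lambda>i. k+1+i" "\<lambda>i. i-(k+1)"]) auto
  also have "sum h {2*k+2..<3*k+2} = (\<Sum>i\<in>{1..k}. h (2*k+1+i))"
    by (rule sum.reindex_bij_witness[of _ "\<lambda>i. 2*k+1+i" "\<lambda>i. i-(2*k+1)"]) auto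
  finally show ?thesis unfolding add.assoc .
qed

lemma index_cases:
  fixes a k :: nat
  assumes "a < 3*k+2"
  obtains (U) "a \<le> k" | (V) i where "i \<le> k" "a = k+1+i"
    | (S) i where "i \<in> {1..k}" "a = 2*k+1+i"
proof (cases "a \<le> k")
  case True then show ?thesis using U by blast
next
  case False
  show ?thesis
  proof (cases "a \<le> 2*k+1")
    case True then show ?thesis using V[of "a-(k+1)"] \<open>\<not> a \<le> k\<close> by simp
  next
    case False
    then show ?thesis using assms by (intro S[of "a-(2*k+1)"]) auto
  qed
qed

section \<open>The Levi-Civita connection\<close>

text \<open>Factors are moved inside conditionals so that sums against Kronecker deltas
  collapse.\<close>

lemma if_zero_mult:
  fixes a c :: real
  shows "(if P then a else 0) * c = (if P then a * c else 0)"
    "c * (if P then a else 0) = (if P then c * a else 0)"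
  by auto

locale gF_manifold =
  fixes k :: nat and eps :: "nat \<Rightarrow> real" and f :: "nat \<Rightarrow> real \<Rightarrow> real"
  assumes k1: "k \<ge> 1" and adm: "admissible k eps f"
begin

abbreviation "g \<equiv> gF k eps f"

text \<open>Kept opaque, together with \<open>vi\<close> and \<open>si\<close>, so that
  simplification compares block indices by \<open>index_lt\<close> and \<open>index_neq\<close>
  instead of unfolding arithmetic in \<open>k\<close>.\<close>

definition n :: nat where "n = 3*k+2"
definition vi :: "nat \<Rightarrow> nat" where "vi i = k+1+i"
definition si :: "nat \<Rightarrow> nat" where "si i = 2*k+1+i"

lemma index_lt [simp]:
  "i \<le> k \<Longrightarrow> i < n" "i \<le> k \<Longrightarrow> vi i < n" "i \<le> k \<Longrightarrow> si i < n" "0 < n"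
  by (auto simp: n_def vi_def si_def)

lemma index_neq [simp]:
  "vi i = vi j \<longleftrightarrow> i = j" "si i = si j \<longleftrightarrow> i = j"
  "i \<le> k \<Longrightarrow> 1 \<le> j \<Longrightarrow> vi i \<noteq> si j" "i \<le> k \<Longrightarrow> 1 \<le> j \<Longrightarrow> si j \<noteq> vi i"
  "i \<le> k \<Longrightarrow> i \<noteq> vi j" "i \<le> k \<Longrightarrow> vi j \<noteq> i" "i \<le> k \<Longrightarrow> i \<noteq> si j" "i \<le> k \<Longrightarrow> si j \<noteq> i"
  "0 < vi j" "0 < si j" "\<not> vi j \<le> k" "\<not> si j \<le> k"
  by (auto simp: vi_def si_def)

lemma sum_blocks:
  "(\<Sum>l<n. h l) = (\<Sum>i\<le>k. h i) + (\<Sum>i\<le>k. h (vi i)) + (\<Sum>i\<in>{1..k}. h (si i))"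
  unfolding n_def vi_def si_def by (rule sum_split3)

lemma n_cases:
  assumes "a < n"
  obtains (U) "a \<le> k" | (V) i where "i \<le> k" "a = vi i" | (S) i where "i \<in> {1..k}" "a = si i"
  using index_cases[of a k] assms unfolding n_def vi_def si_def by metis

lemma eps_sq [simp]: "i \<in> {1..k} \<Longrightarrow> eps i * eps i = 1"
  using adm unfolding admissible_def by (auto dest!: bspec)

lemma f_deriv: "i \<in> {1..k} \<Longrightarrow> ((deriv ^^ m) (f i) has_real_derivative (deriv ^^ Suc m) (f i) u) (at u)"
  using adm unfolding admissible_def smooth_real_def
  by (auto simp: DERIV_deriv_iff_real_differentiable)

lemma f_deriv1: "i \<in> {1..k} \<Longrightarrow> (f i has_real_derivative deriv (f i) u) (at u)"
  using f_deriv[of i 0 u] by simp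

lemma f_deriv2: "i \<in> {1..k} \<Longrightarrow> (deriv (f i) has_real_derivative deriv (deriv (f i)) u) (at u)"
  using f_deriv[of i 1 u] by simp

lemma c_nz: "i \<in> {1..k} \<Longrightarrow> 1 + deriv (f i) u \<noteq> 0"
  using adm unfolding admissible_def by (auto simp: add.commute)

lemma g_sym: "g x a b = g x b a"
  unfolding gF_def by auto

section \<open>The metric and its inverse in block form\<close>

definition guu where
  "guu x i j = (if i = 0 \<and> 1 \<le> j then 2 * f j (x j) * x (si j)
     else if j = 0 \<and> 1 \<le> i then 2 * f i (x i) * x (si i)
     else if i = j \<and> 1 \<le> i then -2 * x 0 * x (si i) else 0)"

lemma g_blocks:
  "i \<le> k \<Longrightarrow> j \<le> k \<Longrightarrow> g x i j = guu x i j"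
  "i \<le> k \<Longrightarrow> j \<le> k \<Longrightarrow> g x i (vi j) = (if i = j then 1 else 0)"
  "i \<le> k \<Longrightarrow> j \<le> k \<Longrightarrow> g x (vi i) j = (if i = j then 1 else 0)"
  "i \<le> k \<Longrightarrow> j \<in> {1..k} \<Longrightarrow> g x i (si j) = 0"
  "i \<in> {1..k} \<Longrightarrow> j \<le> k \<Longrightarrow> g x (si i) j = 0"
  "i \<le> k \<Longrightarrow> j \<le> k \<Longrightarrow> g x (vi i) (vi j) = 0"
  "i \<le> k \<Longrightarrow> j \<in> {1..k} \<Longrightarrow> g x (vi i) (si j) = 0"
  "i \<in> {1..k} \<Longrightarrow> j \<le> k \<Longrightarrow> g x (si i) (vi j) = 0"
  "i \<in> {1..k} \<Longrightarrow> j \<in> {1..k} \<Longrightarrow> g x (si i) (si j) = (if i = j then eps i else 0)"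
  by (auto simp: gF_def guu_def vi_def si_def)

text \<open>In the block order \<open>u\<close>, \<open>v\<close>, \<open>s\<close> the metric is
  [[G, I, 0], [I, 0, 0], [0, 0, E]] with G the block \<open>guu\<close>. Since E squares to the
  identity, the inverse is [[0, I, 0], [I, -G, 0], [0, 0, E]].\<close>

definition gi where
  "gi x a b = (if a \<le> k \<and> b = vi a then 1 else if b \<le> k \<and> a = vi b then 1
     else if k < a \<and> a \<le> 2*k+1 \<and> k < b \<and> b \<le> 2*k+1 then - guu x (a-(k+1)) (b-(k+1))
     else if a = b \<and> 2*k+2 \<le> a \<and> a \<le> 3*k+1 then eps (a - (2*k+1)) else 0)"

lemma gi_blocks:
  "i \<le> k \<Longrightarrow> j \<le> k \<Longrightarrow> gi x i j = 0"
  "i \<le> k \<Longrightarrow> j \<le> k \<Longrightarrow> gi x i (vi j) = (if i = j then 1 else 0)"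
  "i \<le> k \<Longrightarrow> j \<le> k \<Longrightarrow> gi x (vi i) j = (if i = j then 1 else 0)"
  "i \<le> k \<Longrightarrow> j \<in> {1..k} \<Longrightarrow> gi x i (si j) = 0"
  "i \<in> {1..k} \<Longrightarrow> j \<le> k \<Longrightarrow> gi x (si i) j = 0"
  "i \<le> k \<Longrightarrow> j \<le> k \<Longrightarrow> gi x (vi i) (vi j) = - guu x i j"
  "i \<le> k \<Longrightarrow> j \<in> {1..k} \<Longrightarrow> gi x (vi i) (si j) = 0"
  "i \<in> {1..k} \<Longrightarrow> j \<le> k \<Longrightarrow> gi x (si i) (vi j) = 0"
  "i \<in> {1..k} \<Longrightarrow> j \<in> {1..k} \<Longrightarrow> gi x (si i) (si j) = (if i = j then eps i else 0)"
  by (auto simp: gi_def vi_def si_def)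

lemma gi_sym: "gi x a b = gi x b a"
  unfolding gi_def guu_def by auto

lemma g_gi:
  assumes "a < n" "b < n"
  shows "(\<Sum>l<n. g x a l * gi x l b) = (if a = b then 1 else 0)"
proof -
  note s = sum_blocks g_blocks gi_blocks if_zero_mult sum_negf
  show ?thesis
    using assms(1)
  proof (cases rule: n_cases)
    case U
    show ?thesis using assms(2)
      by (cases rule: n_cases) (use U in \<open>simp_all add: s \<close>)
  next
    case (V i)
    show ?thesis using assms(2)
      by (cases rule: n_cases) (use V in \<open>simp_all add: s \<close>)
  next
    case (S i)
    show ?thesis using assms(2)
      by (cases rule: n_cases) (use S in \<open>simp_all add: s \<close>)
  qed
qed

lemma gi_g:
  assumes "a < n" "b < n"
  shows "(\<Sum>l<n. gi x a l * g x l b) = (if a = b then 1 else 0)"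
  using g_gi[OF assms(2,1), of x] by (simp add: gi_sym[of x a] g_sym[of x _ b] mult.commute eq_commute[of a])

text \<open>Uniqueness inside the index range is the computation M = (gi g) M = gi (g M) = gi;
  outside it both matrices are zero by convention.\<close>

lemma ginv_eq: "ginv n g x = gi x"
  unfolding ginv_def
proof (rule the_equality, intro conjI allI impI)
  show "\<And>i j. i < n \<Longrightarrow> j < n \<Longrightarrow> (\<Sum>l<n. g x i l * gi x l j) = (if i = j then 1 else 0)"
    by (rule g_gi)
  show gi0: "\<And>i j. \<not> (i < n \<and> j < n) \<Longrightarrow> gi x i j = 0"
    by (auto simp: gi_def n_def vi_def si_def)
  fix M assume M: "(\<forall>i<n. \<forall>j<n. (\<Sum>l<n. g x i l * M l j) = (if i = j then 1 else 0)) \<and>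
    (\<forall>i j. \<not> (i < n \<and> j < n) \<longrightarrow> M i j = 0)"
  show "M = gi x"
  proof (intro ext)
    fix i j
    show "M i j = gi x i j"
    proof (cases "i < n \<and> j < n")
      case True
      have "M i j = (\<Sum>l<n. (if i = l then 1 else 0) * M l j)"
        using True by (simp add: if_zero_mult)
      also have "\<dots> = (\<Sum>l<n. (\<Sum>m<n. gi x i m * g x m l) * M l j)"
        using True by (intro sum.cong refl) (simp add: gi_g)
      also have "\<dots> = (\<Sum>l<n. \<Sum>m<n. gi x i m * (g x m l * M l j))"
        by (simp add: sum_distrib_right mult.assoc)
      also have "\<dots> = (\<Sum>m<n. gi x i m * (\<Sum>l<n. g x m l * M l j))"
        by (subst sum.swap) (simp add: sum_distrib_left)
      also have "\<dots> = (\<Sum>m<n. gi x i m * (if m = j then 1 else 0))"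
        using True M by (intro sum.cong refl) simp
      also have "\<dots> = gi x i j" using True by (simp add: if_zero_mult)
      finally show ?thesis .
    next
      case False then show ?thesis using M gi0 by metis
    qed
  qed
qed

section \<open>First derivatives of the metric\<close>

definition dg where
  "dg x c a b = (if a = 0 \<and> 1 \<le> b \<and> b \<le> k then
       (if c = b then 2 * deriv (f b) (x b) * x (si b) else if c = si b then 2 * f b (x b) else 0)
     else if b = 0 \<and> 1 \<le> a \<and> a \<le> k then
       (if c = a then 2 * deriv (f a) (x a) * x (si a) else if c = si a then 2 * f a (x a) else 0)
     else if a = b \<and> 1 \<le> a \<and> a \<le> k then
       (if c = 0 then -2 * x (si a) else if c = si a then -2 * x 0 else 0) else 0)"

lemma has_total_deriv_fs:
  "i \<in> {1..k} \<Longrightarrow> has_total_deriv n (\<lambda>y. 2 * f i (y i) * y (si i))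
     (\<lambda>c. if c = i then 2 * deriv (f i) (x i) * x (si i) else if c = si i then 2 * f i (x i) else 0) x"
  by (rule has_total_deriv_cong, rule has_total_deriv_mult[OF has_total_deriv_mult[OF has_total_deriv_const
          has_total_deriv_compose_coord[OF _ f_deriv1]] has_total_deriv_coord]) auto

lemma has_total_deriv_us:
  "i \<in> {1..k} \<Longrightarrow> has_total_deriv n (\<lambda>y. -2 * y 0 * y (si i))
     (\<lambda>c. if c = 0 then -2 * x (si i) else if c = si i then -2 * x 0 else 0) x"
  by (rule has_total_deriv_cong, rule has_total_deriv_mult[OF has_total_deriv_mult[OF has_total_deriv_const has_total_deriv_coord] has_total_deriv_coord]) auto

lemma has_total_deriv_g: "has_total_deriv n (\<lambda>y. g y a b) (\<lambda>c. dg x c a b) x"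
proof -
  consider "a = 0 \<and> 1 \<le> b \<and> b \<le> k" | "b = 0 \<and> 1 \<le> a \<and> a \<le> k" | "a = b \<and> 1 \<le> a \<and> a \<le> k"
    | "\<not> (a = 0 \<and> 1 \<le> b \<and> b \<le> k)" "\<not> (b = 0 \<and> 1 \<le> a \<and> a \<le> k)" "\<not> (a = b \<and> 1 \<le> a \<and> a \<le> k)"
    by blast
  then show ?thesis
  proof cases
    case 1
    then show ?thesis using has_total_deriv_fs[of b x] by (simp add: gF_def dg_def si_def cong: if_cong)
  next
    case 2
    then show ?thesis using has_total_deriv_fs[of a x] by (simp add: gF_def dg_def si_def cong: if_cong)
  next
    case 3
    then show ?thesis using has_total_deriv_us[of a x] by (simp add: gF_def dg_def si_def cong: if_cong)
  next
    case 4
    \<comment> \<open>The remaining components are 0, 1 or a sign and do not depend on the point, so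
      the value at \<open>x\<close> serves as the constant.\<close>
    have "(\<lambda>y. g y a b) = (\<lambda>y. g x a b)" "(\<lambda>c. dg x c a b) = (\<lambda>c. 0)"
      unfolding gF_def dg_def by (simp_all only: 4 if_False)
    then show ?thesis using has_total_deriv_const by metis
  qed
qed

lemma pd_g: "c < n \<Longrightarrow> pd c (\<lambda>y. g y a b) x = dg x c a b"
  by (rule has_total_deriv_pd[OF has_total_deriv_g])

section \<open>Christoffel symbols of the first and second kind\<close>

definition chr1 where "chr1 x a b l = (dg x a b l + dg x b a l - dg x l a b) / 2"

text \<open>In \<open>chr1\<close> the index \<open>l\<close> is the direction of one term and the
  last index of the other two, so the derivatives are tabulated by block twice, once for each
  position.\<close>

lemma dg_0: "dg x 0 a b = (if a = b \<and> 1 \<le> a \<and> a \<le> k then -2 * x (si a) else 0)"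
  by (auto simp: dg_def)

lemma dg_i: "i \<in> {1..k} \<Longrightarrow> dg x i a b =
    (if a = 0 \<and> b = i \<or> a = i \<and> b = 0 then 2 * deriv (f i) (x i) * x (si i) else 0)"
  by (auto simp: dg_def)

lemma dg_v: "i \<le> k \<Longrightarrow> dg x (vi i) a b = 0"
  by (auto simp: dg_def)

lemma dg_s: "i \<in> {1..k} \<Longrightarrow> dg x (si i) a b =
    (if a = 0 \<and> b = i \<or> a = i \<and> b = 0 then 2 * f i (x i)
     else if a = i \<and> b = i then -2 * x 0 else 0)"
  by (auto simp: dg_def)

lemma dg_b0: "dg x c a 0 = (if 1 \<le> a \<and> a \<le> k then
       (if c = a then 2 * deriv (f a) (x a) * x (si a) else if c = si a then 2 * f a (x a) else 0)
     else 0)"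
  by (auto simp: dg_def)

lemma dg_bi: "i \<in> {1..k} \<Longrightarrow> dg x c a i = (if a = 0 then
       (if c = i then 2 * deriv (f i) (x i) * x (si i) else if c = si i then 2 * f i (x i) else 0)
     else if a = i then (if c = 0 then -2 * x (si i) else if c = si i then -2 * x 0 else 0)
     else 0)"
  by (auto simp: dg_def)

lemma dg_bv: "i \<le> k \<Longrightarrow> dg x c a (vi i) = 0"
  by (auto simp: dg_def)

lemma dg_bs: "i \<in> {1..k} \<Longrightarrow> dg x c a (si i) = 0"
  by (auto simp: dg_def)

text \<open>No metric component depends on a \<open>v\<close>-coordinate, and the components
  carrying a \<open>v\<close>-index are constant, so all three terms vanish.\<close>

lemma chr1_v: "i \<le> k \<Longrightarrow> chr1 x a b (vi i) = 0"
  by (simp add: chr1_def dg_v dg_bv)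

lemma chr1_u0: "chr1 x a b 0 =
   (if 1 \<le> a \<and> a \<le> k \<and> b = a then (2 * deriv (f a) (x a) + 1) * x (si a)
    else if 1 \<le> a \<and> a \<le> k \<and> b = si a then f a (x a)
    else if 1 \<le> b \<and> b \<le> k \<and> a = si b then f b (x b) else 0)"
  unfolding chr1_def dg_0 dg_b0 by (auto simp: algebra_simps)

lemma chr1_u: "i \<in> {1..k} \<Longrightarrow> chr1 x a b i =
   (if a = 0 \<and> b = i \<or> a = i \<and> b = 0 then - x (si i)
    else if a = 0 \<and> b = si i \<or> a = si i \<and> b = 0 then f i (x i)
    else if a = i \<and> b = si i \<or> a = si i \<and> b = i then - x 0 else 0)"
  unfolding chr1_def by (auto simp: dg_i dg_bi)

lemma chr1_s: "i \<in> {1..k} \<Longrightarrow> chr1 x a b (si i) =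
   (if a = 0 \<and> b = i \<or> a = i \<and> b = 0 then - f i (x i)
    else if a = i \<and> b = i then x 0 else 0)"
  unfolding chr1_def by (simp add: dg_s dg_bs)

lemma chr_chr1:
  assumes "a < n" "b < n"
  shows "chr n g x m a b = (\<Sum>l<n. gi x m l * chr1 x a b l)"
  unfolding chr_def ginv_eq chr1_def using assms
  by (intro sum.cong refl) (simp add: pd_g)

text \<open>Raising with \<open>gi\<close> and lowering with the metric cancel. In this lowered form
  the connection is compared across an isometry.\<close>

lemma chr_lower:
  assumes "a < n" "b < n" "e < n"
  shows "(\<Sum>m<n. chr n g x m a b * g x m e) = chr1 x a b e"
proof -
  have "(\<Sum>m<n. chr n g x m a b * g x m e) = (\<Sum>m<n. \<Sum>l<n. chr1 x a b l * (gi x l m * g x m e))"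
    using assms by (intro sum.cong refl)
      (auto simp: chr_chr1 sum_distrib_right sum_distrib_left gi_sym[of x m for m] mult_ac intro!: sum.cong)
  also have "\<dots> = (\<Sum>l<n. chr1 x a b l * (\<Sum>m<n. gi x l m * g x m e))"
    by (subst sum.swap) (simp add: sum_distrib_left)
  also have "\<dots> = (\<Sum>l<n. chr1 x a b l * (if l = e then 1 else 0))"
    using assms by (intro sum.cong refl) (simp add: gi_g)
  finally show ?thesis using assms by (simp add: if_zero_mult)
qed

text \<open>A \<open>u\<close>-row of the inverse metric meets only \<open>v\<close>-columns, where
  \<open>chr1\<close> vanishes. In invariant terms, the forms du_0, ..., du_k are parallel.\<close>

lemma chr_u: "a < n \<Longrightarrow> b < n \<Longrightarrow> i \<le> k \<Longrightarrow> chr n g x i a b = 0"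
  unfolding chr_chr1 sum_blocks by (simp add: gi_blocks chr1_v)

lemma chr_v: "a < n \<Longrightarrow> b < n \<Longrightarrow> i \<le> k \<Longrightarrow> chr n g x (vi i) a b = chr1 x a b i"
  unfolding chr_chr1 sum_blocks by (simp add: gi_blocks chr1_v if_zero_mult)

lemma chr_s: "a < n \<Longrightarrow> b < n \<Longrightarrow> i \<in> {1..k} \<Longrightarrow> chr n g x (si i) a b = eps i * chr1 x a b (si i)"
  unfolding chr_chr1 sum_blocks by (simp add: gi_blocks if_zero_mult)

end

section \<open>Covariant derivatives of the curvature\<close>

lemma has_total_deriv_if:
  "(P \<Longrightarrow> has_total_deriv n h D x) \<Longrightarrow> (\<not> P \<Longrightarrow> has_total_deriv n h' D' x) \<Longrightarrow>
   has_total_deriv n (\<lambda>y. if P then h y else h' y) (\<lambda>c. if P then D c else D' c) x"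
  by (cases P) simp_all

lemma has_total_deriv_cmult: "has_total_deriv n h D x \<Longrightarrow> has_total_deriv n (\<lambda>y. r * h y) (\<lambda>c. r * D c) x"
  by (rule has_total_deriv_cong[OF has_total_deriv_mult[OF has_total_deriv_const]]) auto

lemma has_total_deriv_minus: "has_total_deriv n h D x \<Longrightarrow> has_total_deriv n (\<lambda>y. - h y) (\<lambda>c. - D c) x"
  using has_total_deriv_cmult[of n h D x "-1"] by simp

text \<open>The algebra of differential polynomials in \<open>F\<close>; it is closed under differentiation.\<close>

inductive diff_poly :: "(real \<Rightarrow> real) \<Rightarrow> (real \<Rightarrow> real) \<Rightarrow> bool" for F where
  base: "diff_poly F ((deriv ^^ m) F)"
| const: "diff_poly F (\<lambda>u. r)"
| add: "diff_poly F h \<Longrightarrow> diff_poly F h' \<Longrightarrow> diff_poly F (\<lambda>u. h u + h' u)"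
| mult: "diff_poly F h \<Longrightarrow> diff_poly F h' \<Longrightarrow> diff_poly F (\<lambda>u. h u * h' u)"

text \<open>Induction first produces some derivative function inside the algebra; uniqueness of
  derivatives then identifies it with \<open>deriv h\<close>.\<close>

lemma diff_poly_deriv:
  assumes "diff_poly F h" "smooth_real F"
  shows "diff_poly F (deriv h) \<and> (\<forall>u. (h has_real_derivative deriv h u) (at u))"
proof -
  have "\<exists>h'. diff_poly F h' \<and> (\<forall>u. (h has_real_derivative h' u) (at u))"
    using assms(1)
  proof (induction)
    case (base m)
    have "\<forall>u. ((deriv ^^ m) F has_real_derivative (deriv ^^ Suc m) F u) (at u)"
      using assms(2) unfolding smooth_real_def by (auto simp: DERIV_deriv_iff_real_differentiable)
    then show ?case using diff_poly.base by blast
  next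
    case (const r)
    then show ?case using diff_poly.const[of F 0] by auto
  next
    case (add h1 h2)
    then obtain d1 d2 where "diff_poly F d1" "diff_poly F d2" "\<And>u. (h1 has_real_derivative d1 u) (at u)"
      "\<And>u. (h2 has_real_derivative d2 u) (at u)" by blast
    then show ?case
      by (intro exI[of _ "\<lambda>u. d1 u + d2 u"]) (auto intro: diff_poly.add derivative_intros)
  next
    case (mult h1 h2)
    then obtain d1 d2 where "diff_poly F d1" "diff_poly F d2" "\<And>u. (h1 has_real_derivative d1 u) (at u)"
      "\<And>u. (h2 has_real_derivative d2 u) (at u)" by blast
    then show ?case using mult.hyps
      by (intro exI[of _ "\<lambda>u. d1 u * h2 u + d2 u * h1 u"]) (auto intro: diff_poly.add diff_poly.mult DERIV_mult)
  qed
  then obtain h' where h': "diff_poly F h'" "\<And>u. (h has_real_derivative h' u) (at u)" by blast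
  moreover from h'(2) have "deriv h = h'" by (intro ext DERIV_imp_deriv)
  ultimately show ?thesis by simp
qed

context gF_manifold begin

section \<open>Differentiability of the connection coefficients\<close>

lemma has_total_deriv_chr1_0: "has_total_deriv n (\<lambda>y. chr1 y a b 0) (\<lambda>c.
    if 1 \<le> a \<and> a \<le> k \<and> b = a then
      (if c = a then 2 * deriv (deriv (f a)) (x a) * x (si a)
       else if c = si a then 2 * deriv (f a) (x a) + 1 else 0)
    else if 1 \<le> a \<and> a \<le> k \<and> b = si a then (if c = a then deriv (f a) (x a) else 0)
    else if 1 \<le> b \<and> b \<le> k \<and> a = si b then (if c = b then deriv (f b) (x b) else 0) else 0) x"
  unfolding chr1_u0
proof (intro has_total_deriv_if has_total_deriv_const)
  assume "1 \<le> a \<and> a \<le> k \<and> b = a"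
  then show "has_total_deriv n (\<lambda>y. (2 * deriv (f a) (y a) + 1) * y (si a))
     (\<lambda>c. if c = a then 2 * deriv (deriv (f a)) (x a) * x (si a)
          else if c = si a then 2 * deriv (f a) (x a) + 1 else 0) x"
    by (intro has_total_deriv_cong[OF has_total_deriv_mult[OF has_total_deriv_add[OF has_total_deriv_cmult[OF
          has_total_deriv_compose_coord[OF _ f_deriv2]] has_total_deriv_const] has_total_deriv_coord]]) auto
qed (auto intro!: has_total_deriv_compose_coord f_deriv1)

lemma has_total_deriv_chr1_i: "i \<in> {1..k} \<Longrightarrow> has_total_deriv n (\<lambda>y. chr1 y a b i) (\<lambda>c.
    if a = 0 \<and> b = i \<or> a = i \<and> b = 0 then - (if c = si i then 1 else 0)
    else if a = 0 \<and> b = si i \<or> a = si i \<and> b = 0 then (if c = i then deriv (f i) (x i) else 0)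
    else if a = i \<and> b = si i \<or> a = si i \<and> b = i then - (if c = 0 then 1 else 0) else 0) x"
  by (subst chr1_u, assumption)
     (intro has_total_deriv_if has_total_deriv_const has_total_deriv_minus has_total_deriv_coord has_total_deriv_compose_coord f_deriv1, auto)

lemma has_total_deriv_chr1_s: "i \<in> {1..k} \<Longrightarrow> has_total_deriv n (\<lambda>y. chr1 y a b (si i)) (\<lambda>c.
    if a = 0 \<and> b = i \<or> a = i \<and> b = 0 then - (if c = i then deriv (f i) (x i) else 0)
    else if a = i \<and> b = i then (if c = 0 then 1 else 0) else 0) x"
  by (subst chr1_s, assumption)
     (intro has_total_deriv_if has_total_deriv_const has_total_deriv_minus has_total_deriv_coord has_total_deriv_compose_coord f_deriv1, auto)

lemma has_total_deriv_chr:
  assumes "m < n" "a < n" "b < n"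
  shows "has_total_deriv n (\<lambda>y. chr n g y m a b) (\<lambda>c. pd c (\<lambda>y. chr n g y m a b) x) x"
  using assms(1)
proof (cases rule: n_cases)
  case U
  then show ?thesis using has_total_deriv_pd_self[OF has_total_deriv_const[of n 0 x]] assms by (simp add: chr_u)
next
  case (V i)
  then have "(\<lambda>y. chr n g y m a b) = (\<lambda>y. chr1 y a b i)" using assms by (simp add: chr_v)
  then show ?thesis
    using V has_total_deriv_pd_self[OF has_total_deriv_chr1_i[of i a b x]] has_total_deriv_pd_self[OF has_total_deriv_chr1_0[of a b x]]
    by (cases "i = 0") auto
next
  case (S i)
  then have "(\<lambda>y. chr n g y m a b) = (\<lambda>y. eps i * chr1 y a b (si i))" using assms by (simp add: chr_s)
  then show ?thesis
    using S has_total_deriv_pd_self[OF has_total_deriv_cmult[OF has_total_deriv_chr1_s[of i a b x]]] by auto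
qed

text \<open>Components of the forms \<open>\<omega>\<^sub>i\<close> and \<open>\<tau>\<^sub>i\<close>.\<close>

definition om :: "nat \<Rightarrow> nat \<Rightarrow> nat \<Rightarrow> real" where
  "om i a b = (if a = 0 \<and> b = i then 1 else if a = i \<and> b = 0 then - 1 else 0)"

definition ta :: "nat \<Rightarrow> nat \<Rightarrow> nat \<Rightarrow> real" where
  "ta i a b = (if a = i \<and> b = si i then 1 else if a = si i \<and> b = i then - 1 else 0)"

text \<open>Component \<open>m\<close> of R(d_a, d_b) d_c. Lowering \<open>m\<close> is postponed
  because the three blocks of upper indices behave differently.\<close>

definition Rup where
  "Rup x m a b c = pd a (\<lambda>y. chr n g y m b c) x - pd b (\<lambda>y. chr n g y m a c) x
       + (\<Sum>e<n. chr n g x e b c * chr n g x m a e - chr n g x e a c * chr n g x m b e)"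

lemma Riem_Rup: "Riem n g x a b c d = (\<Sum>m<n. Rup x m a b c * g x m d)"
  unfolding Riem_def Rup_def ..

text \<open>The symbol with upper index \<open>e\<close> vanishes for \<open>e\<close> in the
  \<open>u\<close> block, and the one with lower index \<open>e\<close> vanishes for
  \<open>e\<close> in the \<open>v\<close> block, so only the \<open>s\<close> block
  contributes.\<close>

lemma chr_quadratic:
  assumes "a < n" "b < n" "c < n" "m < n"
  shows "(\<Sum>e<n. chr n g x e b c * chr n g x m a e) =
     (\<Sum>j\<in>{1..k}. eps j * chr1 x b c (si j) * chr n g x m a (si j))"
proof -
  have "chr n g x m a (vi i) = 0" if "i \<le> k" for i
    using assms(4)
  proof (cases rule: n_cases)
    case (V j)
    then show ?thesis using assms that
      by (cases "j = 0") (auto simp: chr_v chr1_u0 chr1_u)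
  next
    case (S j)
    then show ?thesis using assms that by (auto simp: chr_s chr1_s)
  qed (use assms that in \<open>auto simp: chr_u\<close>)
  then show ?thesis unfolding sum_blocks using assms by (simp add: chr_u chr_s)
qed

lemma Rup_u: "i \<le> k \<Longrightarrow> a < n \<Longrightarrow> b < n \<Longrightarrow> c < n \<Longrightarrow> Rup x i a b c = 0"
  unfolding Rup_def by (simp add: chr_u has_total_deriv_pd[OF has_total_deriv_const[of n 0]])

lemma Rup_s:
  assumes "i \<in> {1..k}" "a < n" "b < n" "c < n"
  shows "Rup x (si i) a b c = eps i * ((1 + deriv (f i) (x i)) * om i a b * (if c = i then 1 else 0))"
proof -
  \<comment> \<open>An \<open>s\<close>-component of the connection needs two lower
    \<open>u\<close>-indices, but here one lower index is an \<open>s\<close>-index. The curvature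
    in these components comes from derivatives alone.\<close>
  have q: "(\<Sum>e<n. chr n g x e b c * chr n g x (si i) a e) = 0" if "a < n" "b < n" for a b
    using that assms by (subst chr_quadratic) (auto simp: chr_s chr1_s)
  show ?thesis
    unfolding Rup_def sum_subtractf q[OF assms(2,3)] q[OF assms(3,2)]
    using assms by (simp add: chr_s has_total_deriv_pd[OF has_total_deriv_cmult[OF has_total_deriv_chr1_s]] om_def)
      (auto simp: algebra_simps)
qed

lemma Rup_v:
  assumes "i \<in> {1..k}" "a < n" "b < n" "c < n"
  shows "Rup x (vi i) a b c = (if c = 0 then - (eps i * (f i (x i))\<^sup>2 * om i a b)
      + (1 + deriv (f i) (x i)) * ta i a b
      else if c = si i then - ((1 + deriv (f i) (x i)) * om i a b) else 0)"
proof -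
  \<comment> \<open>Only \<open>j = i\<close> survives: for \<open>i \<ge> 1\<close> the symbol with
    upper index \<open>vi i\<close> and lower index \<open>si j\<close> can be nonzero only
    there.\<close>
  have q: "(\<Sum>e<n. chr n g x e b c * chr n g x (vi i) a e) =
     eps i * chr1 x b c (si i) * (if a = 0 then f i (x i) else if a = i then - x 0 else 0)"
    if "a < n" "b < n" for a b
  proof -
    have "(\<Sum>e<n. chr n g x e b c * chr n g x (vi i) a e) =
       (\<Sum>j\<in>{1..k}. if j = i then eps i * chr1 x b c (si i) *
          (if a = 0 then f i (x i) else if a = i then - x 0 else 0) else 0)"
      using that assms
      by (intro trans[OF chr_quadratic] sum.cong) (auto simp: chr_v chr1_u)
    then show ?thesis using assms by simp
  qed
  show ?thesis
    unfolding Rup_def sum_subtractf q[OF assms(2,3)] q[OF assms(3,2)]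
    using assms by (simp add: chr_v has_total_deriv_pd[OF has_total_deriv_chr1_i] om_def ta_def chr1_s)
      (auto simp: algebra_simps power2_eq_square)
qed

lemma Rup_v0:
  assumes "a < n" "b < n" "c < n"
  shows "Rup x (vi 0) a b c = (if c \<in> {1..k} then eps c * (f c (x c))\<^sup>2 * om c a b
      - (1 + deriv (f c) (x c)) * ta c a b else 0)"
proof -
  \<comment> \<open>For the upper index \<open>vi 0\<close> it is the direction \<open>a\<close>
    that selects the summand.\<close>
  have q: "(\<Sum>e<n. chr n g x e b c * chr n g x (vi 0) a e) =
     (if a \<in> {1..k} then eps a * chr1 x b c (si a) * f a (x a) else 0)"
    if "a < n" "b < n" for a b
  proof -
    have "(\<Sum>e<n. chr n g x e b c * chr n g x (vi 0) a e) =
       (\<Sum>j\<in>{1..k}. if j = a then eps a * chr1 x b c (si a) * f a (x a) else 0)"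
      using that assms 
      by (intro trans[OF chr_quadratic] sum.cong) (auto simp: chr_v chr1_u0)
    then show ?thesis by simp
  qed
  note R = Rup_def sum_subtractf q[OF assms(1,2)] q[OF assms(2,1)]
  show ?thesis
    using assms(3)
  proof (cases rule: n_cases)
    case U
    then show ?thesis unfolding R using assms by (simp add: chr_v has_total_deriv_pd[OF has_total_deriv_chr1_0] om_def ta_def chr1_s)
      (auto simp: algebra_simps power2_eq_square)
  next
    case (V i)
    then show ?thesis unfolding R using assms by (simp add: chr_v has_total_deriv_pd[OF has_total_deriv_chr1_0] om_def ta_def chr1_s)
      (auto simp: algebra_simps power2_eq_square)
  next
    case (S i)
    then show ?thesis unfolding R using assms by (simp add: chr_v has_total_deriv_pd[OF has_total_deriv_chr1_0] om_def ta_def chr1_s)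
      (auto simp: algebra_simps power2_eq_square)
  qed
qed

section \<open>Closed form of the covariant derivatives of the curvature\<close>

definition Bc :: "nat \<Rightarrow> nat \<Rightarrow> real \<Rightarrow> real" where
  "Bc i l u = (if l = 0 then 1 else 0) + (deriv ^^ Suc l) (f i) u"

text \<open>The second summand of the recursion is contributed by the covariant derivative of tau_i.
  The first uses the total operator \<open>deriv\<close>; \<open>Ac_deriv\<close> shows that it is a
  true derivative at every stage.\<close>

primrec Ac :: "nat \<Rightarrow> nat \<Rightarrow> real \<Rightarrow> real" where
  "Ac i 0 = (\<lambda>u. eps i * (f i u)\<^sup>2)"
| "Ac i (Suc l) = (\<lambda>u. deriv (Ac i l) u + 2 * eps i * f i u * Bc i l u)"

lemma Bc_deriv: "i \<in> {1..k} \<Longrightarrow> (Bc i l has_real_derivative Bc i (Suc l) u) (at u)"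
  unfolding Bc_def[abs_def] using f_deriv[of i "Suc l" u]
  by (auto intro!: derivative_eq_intros simp del: funpow.simps)

text \<open>Each stage of the recursion stays in an algebra of differentiable functions, so the next
  application of \<open>deriv\<close> is legitimate.\<close>

lemma diff_poly_Ac: "i \<in> {1..k} \<Longrightarrow> diff_poly (f i) (Ac i l)"
proof (induction l)
  case 0
  show ?case
    using diff_poly.mult[OF diff_poly.const[of "f i" "eps i"] diff_poly.mult[OF diff_poly.base[of "f i" 0] diff_poly.base[of "f i" 0]]]
    by (simp add: power2_eq_square)
next
  case (Suc l)
  have sm: "smooth_real (f i)" using adm Suc.prems unfolding admissible_def by blast
  have "diff_poly (f i) (deriv (Ac i l))" using diff_poly_deriv[OF _ sm] Suc by blast
  moreover have "diff_poly (f i) (Bc i l)"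
    unfolding Bc_def[abs_def] by (intro diff_poly.intros)
  ultimately show ?case
    using diff_poly.base[of "f i" 0] by (simp add: diff_poly.intros)
qed

lemma Ac_deriv: "i \<in> {1..k} \<Longrightarrow> (Ac i l has_real_derivative deriv (Ac i l) u) (at u)"
  using diff_poly_deriv[OF diff_poly_Ac[of i l]] adm unfolding admissible_def by blast

text \<open>The \<open>i\<close>-th summand of nabla^l R without the factor du_i^l.\<close>

definition Fc where
  "Fc i l u a b c d = Bc i l u * (om i a b * ta i c d + ta i a b * om i c d)
     - Ac i l u * (om i a b * om i c d)"

lemma om_antisym: "i \<noteq> 0 \<Longrightarrow> om i b a = - om i a b"
  by (auto simp: om_def)

lemma ta_antisym: "i \<in> {1..k} \<Longrightarrow> ta i b a = - ta i a b"
  by (auto simp: ta_def)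

text \<open>Lowering to a \<open>u\<close>-index reads off the \<open>v\<close>-component, lowering
  to a \<open>v\<close>-index reads off the vanishing \<open>u\<close>-component, and lowering to an
  \<open>s\<close>-index multiplies by a sign that cancels the one in \<open>Rup_s\<close>.\<close>

lemma Riem_eq:
  assumes "a < n" "b < n" "c < n" "d < n"
  shows "Riem n g x a b c d = (\<Sum>i\<in>{1..k}. Fc i 0 (x i) a b c d)"
  using assms(4)
proof (cases rule: n_cases)
  case U
  have *: "Riem n g x a b c d = Rup x (vi d) a b c"
    unfolding Riem_Rup sum_blocks using U assms
    by (simp add: Rup_u g_blocks if_zero_mult)
  show ?thesis
  proof (cases "d = 0")
    case True
    have "(\<Sum>i\<in>{1..k}. Fc i 0 (x i) a b c d) = (\<Sum>i\<in>{1..k}. if i = c then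
        eps c * (f c (x c))\<^sup>2 * om c a b - (1 + deriv (f c) (x c)) * ta c a b else 0)"
      using True by (intro sum.cong) (auto simp: Fc_def Bc_def om_def[of _ c] ta_def[of _ c])
    then show ?thesis using * True assms by (simp add: Rup_v0)
  next
    case False
    have "(\<Sum>i\<in>{1..k}. Fc i 0 (x i) a b c d) = (\<Sum>i\<in>{1..k}. if i = d then
       (if c = 0 then - (eps d * (f d (x d))\<^sup>2 * om d a b)
      + (1 + deriv (f d) (x d)) * ta d a b
      else if c = si d then - ((1 + deriv (f d) (x d)) * om d a b) else 0) else 0)"
      using False U by (intro sum.cong) (auto simp: Fc_def Bc_def om_def[of _ c] ta_def[of _ c])
    then show ?thesis using * False U assms by (simp add: Rup_v)
  qed
next
  case (V j)
  have "Fc i 0 (x i) a b c d = 0" if "i \<in> {1..k}" for i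
    using V that by (auto simp: Fc_def om_def[of _ c] ta_def[of _ c])
  then show ?thesis
    unfolding Riem_Rup sum_blocks using V assms by (simp add: Rup_u g_blocks if_zero_mult)
next
  case (S j)
  have "(\<Sum>i\<in>{1..k}. Fc i 0 (x i) a b c d) = (\<Sum>i\<in>{1..k}. if i = j then
       (1 + deriv (f j) (x j)) * om j a b * (if c = j then 1 else 0) else 0)"
    using S by (intro sum.cong) (auto simp: Fc_def Bc_def om_def[of _ c] ta_def[of _ c])
  then show ?thesis
    unfolding Riem_Rup sum_blocks using S assms
    by (simp add: Rup_u g_blocks if_zero_mult Rup_s mult.assoc[symmetric] eps_sq)
qed

text \<open>All indices of omega_i lie in the \<open>u\<close> block, where the symbols with that
  upper index vanish: omega_i is parallel.\<close>

lemma om_chr: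
  assumes "i \<in> {1..k}" "m < n" "a < n"
  shows "(\<Sum>e<n. chr n g x e m a * om i e b) = 0"
  using assms by (intro sum.neutral) (auto simp: om_def chr_u)

text \<open>Only the factor ds_i of tau_i meets a nonvanishing symbol.\<close>

lemma ta_chr:
  assumes "i \<in> {1..k}" "m < n" "a < n"
  shows "(\<Sum>e<n. chr n g x e m a * ta i e b) = - (if b = i then chr n g x (si i) m a else 0)"
proof -
  have "(\<Sum>e<n. chr n g x e m a * ta i e b) =
      (\<Sum>e<n. if e = si i then - (if b = i then chr n g x (si i) m a else 0) else 0)"
    using assms by (intro sum.cong) (auto simp: ta_def chr_u)
  then show ?thesis using assms by simp
qed

text \<open>The connection terms of all four slots. As omega_i is parallel, they come from tau_i
  alone and turn the mixed products into a multiple of omega_i omega_i.\<close>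

lemma Fc_chr:
  assumes "i \<in> {1..k}" "m < n" "a < n" "b < n" "c < n" "d < n"
  shows "(\<Sum>e<n. chr n g x e m a * Fc i l u e b c d) + (\<Sum>e<n. chr n g x e m b * Fc i l u a e c d)
     + (\<Sum>e<n. chr n g x e m c * Fc i l u a b e d) + (\<Sum>e<n. chr n g x e m d * Fc i l u a b c e)
     = (if m = i then 2 * eps i * f i (x i) * Bc i l u * (om i a b * om i c d) else 0)"
proof -
  \<comment> \<open>The connection terms of tau_i in direction \<open>m\<close>. The components of
    tau_i being constant, this is minus its covariant derivative.\<close>
  define X where "X a b = (if a = i then chr n g x (si i) m b else 0)
     - (if b = i then chr n g x (si i) m a else 0)" for a b
  have X: "X a b = (if m = i then eps i * f i (x i) * om i a b else 0)" if "a < n" "b < n" for a b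
    using that assms(1,2) by (auto simp: X_def chr_s chr1_s om_def)
  have 1: "(\<Sum>e<n. chr n g x e m a * Fc i l u e b c d) =
      - (if b = i then chr n g x (si i) m a else 0) * Bc i l u * om i c d"
    if "a < n" "b < n" "c < n" "d < n" for a b c d
  proof -
    have "(\<Sum>e<n. chr n g x e m a * Fc i l u e b c d) =
       (\<Sum>e<n. chr n g x e m a * om i e b) * (Bc i l u * ta i c d - Ac i l u * om i c d)
       + (\<Sum>e<n. chr n g x e m a * ta i e b) * (Bc i l u * om i c d)"
      unfolding Fc_def sum_distrib_right sum.distrib[symmetric]
      by (intro sum.cong) (auto simp: algebra_simps)
    then show ?thesis using om_chr[OF assms(1,2) that(1)] ta_chr[OF assms(1,2) that(1)] by simp
  qed
  have i: "i \<noteq> 0" using assms by auto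
  \<comment> \<open>Antisymmetry and pair symmetry reduce the other three slots to the
    first.\<close>
  have sw: "Fc i l u a b c d = - Fc i l u b a c d" "Fc i l u a b c d = Fc i l u c d a b" for a b c d
    unfolding Fc_def om_antisym[OF i, of b a] ta_antisym[OF assms(1), of b a]
    by (simp_all add: algebra_simps)
  have 2: "(\<Sum>e<n. chr n g x e m b * Fc i l u a e c d) =
      (if a = i then chr n g x (si i) m b else 0) * Bc i l u * om i c d"
    if "a < n" "b < n" "c < n" "d < n" for a b c d
    using 1[OF that(2,1,3,4)] by (subst sw(1)) (simp add: sum_negf)
  have "(\<Sum>e<n. chr n g x e m c * Fc i l u a b e d) =
      - (if d = i then chr n g x (si i) m c else 0) * Bc i l u * om i a b"
    using 1[OF assms(5,6,3,4)] by (subst sw(2)) simp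
  moreover have "(\<Sum>e<n. chr n g x e m d * Fc i l u a b c e) =
      (if c = i then chr n g x (si i) m d else 0) * Bc i l u * om i a b"
    using 2[OF assms(5,6,3,4)] by (subst sw(2)) simp
  ultimately have "(\<Sum>e<n. chr n g x e m a * Fc i l u e b c d) + (\<Sum>e<n. chr n g x e m b * Fc i l u a e c d)
     + (\<Sum>e<n. chr n g x e m c * Fc i l u a b e d) + (\<Sum>e<n. chr n g x e m d * Fc i l u a b c e)
     = Bc i l u * (X a b * om i c d + X c d * om i a b)"
    unfolding X_def 1[OF assms(3-6)] 2[OF assms(3-6)] by (simp add: algebra_simps)
  then show ?thesis using X assms by simp
qed

lemma has_total_deriv_Fc:
  assumes "i \<in> {1..k}"
  shows "has_total_deriv n (\<lambda>y. Fc i l (y i) a b c d) (\<lambda>m. if m = i then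
     Bc i (Suc l) (x i) * (om i a b * ta i c d + ta i a b * om i c d)
     - deriv (Ac i l) (x i) * (om i a b * om i c d) else 0) x"
  using assms unfolding Fc_def
  by (intro has_total_deriv_compose_coord) (auto intro!: derivative_eq_intros Bc_deriv Ac_deriv)

text \<open>By induction on \<open>l\<close>. The partial derivative differentiates the
  coefficients, the four tensor slots give the extra term in the recursion for \<open>Ac\<close>,
  and the differentiation slots contribute nothing because each du_i is parallel.\<close>

lemma nablaR_eq:
  assumes "length js = l" "set js \<subseteq> {..<n}" "a < n" "b < n" "c < n" "d < n"
  shows "nablaR n g l x ([a, b, c, d] @ js) =
    (\<Sum>i\<in>{1..k}. Fc i l (x i) a b c d * (if \<forall>j\<in>set js. j = i then 1 else 0))"
  using assms
proof (induction l arbitrary: js x a b c d)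
  case 0
  then show ?case by (simp add: Riem_eq)
next
  case (Suc l)
  obtain js' m where js: "js = js' @ [m]" using Suc.prems(1) by (cases js rule: rev_cases) auto
  have l: "length js' = l" and sub: "set js' \<subseteq> {..<n}" and m: "m < n"
    using Suc.prems js by auto
  note abcd = Suc.prems(3-6)
  define L where "L = [a, b, c, d] @ js'"
  define w where "w i = (if \<forall>j\<in>set js'. j = i then 1 else 0 :: real)" for i
  have IH: "nablaR n g l y ([a, b, c, d] @ js') = (\<Sum>i\<in>{1..k}. Fc i l (y i) a b c d * w i)"
    if "a < n" "b < n" "c < n" "d < n" for y a b c d
    unfolding w_def by (rule Suc.IH[OF l sub that])
  have td: "has_total_deriv n (\<lambda>y. nablaR n g l y L) (\<lambda>m. \<Sum>i\<in>{1..k}. (if m = i then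
     Bc i (Suc l) (x i) * (om i a b * ta i c d + ta i a b * om i c d)
     - deriv (Ac i l) (x i) * (om i a b * om i c d) else 0) * w i) x"
    unfolding L_def IH[OF abcd]
    by (intro has_total_deriv_sum has_total_deriv_cong[OF has_total_deriv_mult[OF has_total_deriv_Fc has_total_deriv_const]]) auto
  let ?S = "\<lambda>r. \<Sum>e<n. chr n g x e m (L ! r) * nablaR n g l x (L[r := e])"
  \<comment> \<open>In a differentiation slot, \<open>e \<le> k\<close> makes the Christoffel symbol
    vanish, and \<open>e > k\<close> makes the weight vanish because \<open>e\<close> then equals no
    \<open>i\<close> in \<open>{1..k}\<close>.\<close>
  have tail: "?S r = 0" if "r \<in> {4..<4+l}" for r
  proof (rule sum.neutral, rule ballI)
    fix e assume e: "e \<in> {..<n}"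
    define q where "q = r - 4"
    then have q: "r = Suc (Suc (Suc (Suc q)))" "q < l" using that by auto
    have "js' ! q \<in> {..<n}" using sub l q(2) by (intro subsetD[OF sub] nth_mem) simp
    then have Lr: "L ! r < n" using q by (simp add: L_def)
    show "chr n g x e m (L ! r) * nablaR n g l x (L[r := e]) = 0"
    proof (cases "e \<le> k")
      case True then show ?thesis using m Lr by (simp add: chr_u)
    next
      case False
      have "nablaR n g l x (L[r := e]) = nablaR n g l x ([a, b, c, d] @ js'[q := e])"
        by (simp add: L_def q)
      also have "\<dots> = (\<Sum>i\<in>{1..k}. Fc i l (x i) a b c d *
          (if \<forall>j\<in>set (js'[q := e]). j = i then 1 else 0))"
        using l sub abcd e by (intro Suc.IH) (auto dest!: subsetD[OF set_update_subset_insert])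
      also have "\<dots> = 0"
        using set_update_memI[of q js' e] q l False by (intro sum.neutral) auto
      finally show ?thesis by simp
    qed
  qed
  have len: "length L = 4 + l" using l by (simp add: L_def)
  have "(\<Sum>r<length L. ?S r) = (\<Sum>r<4. ?S r) + (\<Sum>r\<in>{4..<4+l}. ?S r)"
    unfolding len lessThan_atLeast0 by (rule sum.atLeastLessThan_concat[symmetric]) auto
  also have "\<dots> = ?S 0 + ?S 1 + ?S 2 + ?S 3"
    by (simp add: tail eval_nat_numeral)
  also have "\<dots> = (\<Sum>i\<in>{1..k}. ((\<Sum>e<n. chr n g x e m a * Fc i l (x i) e b c d)
     + (\<Sum>e<n. chr n g x e m b * Fc i l (x i) a e c d)
     + (\<Sum>e<n. chr n g x e m c * Fc i l (x i) a b e d)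
     + (\<Sum>e<n. chr n g x e m d * Fc i l (x i) a b c e)) * w i)"
  proof -
    have sw: "(\<Sum>e<n. h e * (\<Sum>i\<in>{1..k}. F i e * w i)) = (\<Sum>i\<in>{1..k}. (\<Sum>e<n. h e * F i e) * w i)" for h F
      by (subst sum_distrib_left, subst sum.swap) (simp add: sum_distrib_right mult.assoc)
    have "?S 0 = (\<Sum>e<n. chr n g x e m a * (\<Sum>i\<in>{1..k}. Fc i l (x i) e b c d * w i))"
      "?S 1 = (\<Sum>e<n. chr n g x e m b * (\<Sum>i\<in>{1..k}. Fc i l (x i) a e c d * w i))"
      "?S 2 = (\<Sum>e<n. chr n g x e m c * (\<Sum>i\<in>{1..k}. Fc i l (x i) a b e d * w i))"
      "?S 3 = (\<Sum>e<n. chr n g x e m d * (\<Sum>i\<in>{1..k}. Fc i l (x i) a b c e * w i))"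
      using IH abcd by (auto simp: L_def eval_nat_numeral intro!: sum.cong)
    then show ?thesis unfolding sw by (simp add: sum.distrib distrib_right)
  qed
  also have "\<dots> = (\<Sum>i\<in>{1..k}. (if m = i then 2 * eps i * f i (x i) * Bc i l (x i) * (om i a b * om i c d) else 0) * w i)"
    by (intro sum.cong refl) (simp only: Fc_chr m abcd)
  finally have S: "(\<Sum>r<length L. ?S r) = \<dots>" .
  have "nablaR n g (Suc l) x ([a, b, c, d] @ js) = pd m (\<lambda>y. nablaR n g l y L) x - (\<Sum>r<length L. ?S r)"
    by (simp add: js L_def Let_def butlast_append)
  also have "\<dots> = (\<Sum>i\<in>{1..k}. Fc i (Suc l) (x i) a b c d * (if \<forall>j\<in>set js. j = i then 1 else 0))"
    unfolding has_total_deriv_pd[OF td m] S sum_subtractf[symmetric]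
    by (intro sum.cong refl) (auto simp: js w_def Fc_def algebra_simps)
  finally show ?case .
qed

end

section \<open>Evaluation of the covariant derivatives on vectors\<close>

lemma teval_cong:
  assumes "\<And>is. length is = length vs \<Longrightarrow> set is \<subseteq> {..<n} \<Longrightarrow> T is = T' is"
  shows "teval n T vs = teval n T' vs"
  using assms
proof (induction vs arbitrary: T T')
  case (Cons v vs)
  have "teval n (\<lambda>is. T (i # is)) vs = teval n (\<lambda>is. T' (i # is)) vs" if "i < n" for i
    by (rule Cons.IH) (use Cons.prems that in auto)
  then show ?case by simp
qed simp

lemma quad_sum_product:
  fixes v w y z :: "nat \<Rightarrow> real"
  shows "(\<Sum>a<n. v a * (\<Sum>b<n. w b * (\<Sum>c<n. y c * (\<Sum>d<n. z d * (p a b * q c d))))) =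
     (\<Sum>a<n. v a * (\<Sum>b<n. w b * p a b)) * (\<Sum>c<n. y c * (\<Sum>d<n. z d * q c d))"
proof -
  have 1: "(\<Sum>d<n. z d * (r * h d)) = r * (\<Sum>d<n. z d * h d)" for r z and h :: "nat \<Rightarrow> real"
    by (simp add: sum_distrib_left mult.left_commute)
  have 2: "(\<Sum>d<n. z d * (h d * r)) = (\<Sum>d<n. z d * h d) * r" for r z and h :: "nat \<Rightarrow> real"
    by (simp add: sum_distrib_right mult.assoc)
  show ?thesis unfolding 1 unfolding 2 ..
qed

lemma sum_mult_swap:
  fixes v :: "'a \<Rightarrow> real"
  shows "(\<Sum>a\<in>A. v a * (\<Sum>i\<in>I. h a i * r i)) = (\<Sum>i\<in>I. (\<Sum>a\<in>A. v a * h a i) * r i)"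
proof -
  have "(\<Sum>a\<in>A. v a * (\<Sum>i\<in>I. h a i * r i)) = (\<Sum>a\<in>A. \<Sum>i\<in>I. v a * h a i * r i)"
    by (simp add: sum_distrib_left mult.assoc)
  also have "\<dots> = (\<Sum>i\<in>I. \<Sum>a\<in>A. v a * h a i * r i)" by (rule sum.swap)
  finally show ?thesis by (simp add: sum_distrib_right)
qed

context gF_manifold begin

text \<open>The weight is the component of a power of du_i. Peeling off one argument absorbs its
  delta into the coefficient, hence the generality in \<open>C\<close>.\<close>

lemma teval_diagonal:
  "teval n (\<lambda>is. \<Sum>i\<in>{1..k}. C i * (if \<forall>j\<in>set is. j = i then 1 else 0)) ws
     = (\<Sum>i\<in>{1..k}. C i * (\<Prod>w\<leftarrow>ws. w i))"
proof (induction ws arbitrary: C)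
  case (Cons w ws)
  have eq: "(\<lambda>is. \<Sum>i\<in>{1..k}. C i * (if \<forall>j\<in>set (j # is). j = i then 1 else 0)) =
    (\<lambda>is. \<Sum>i\<in>{1..k}. (if j = i then C i else 0) * (if \<forall>j\<in>set is. j = i then 1 else 0))" for j
    by (intro ext sum.cong) auto
  have "teval n (\<lambda>is. \<Sum>i\<in>{1..k}. C i * (if \<forall>j\<in>set is. j = i then 1 else 0)) (w # ws) =
    (\<Sum>j<n. w j * teval n (\<lambda>is. \<Sum>i\<in>{1..k}. (if j = i then C i else 0) *
       (if \<forall>j\<in>set is. j = i then 1 else 0)) ws)"
    unfolding teval.simps eq ..
  also have "\<dots> = (\<Sum>i\<in>{1..k}. \<Sum>j<n. if j = i then w i * (C i * (\<Prod>w\<leftarrow>ws. w i)) else 0)"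
    unfolding Cons.IH sum_distrib_left by (subst sum.swap, intro sum.cong refl) auto
  also have "\<dots> = (\<Sum>i\<in>{1..k}. w i * (C i * (\<Prod>w\<leftarrow>ws. w i)))"
    by (intro sum.cong refl) (auto simp: sum.delta)
  finally show ?case by (simp add: mult_ac)
qed simp

definition omv :: "nat \<Rightarrow> pt \<Rightarrow> pt \<Rightarrow> real" where "omv i v w = v 0 * w i - v i * w 0"
definition tav :: "nat \<Rightarrow> pt \<Rightarrow> pt \<Rightarrow> real" where "tav i v w = v i * w (si i) - v (si i) * w i"

definition FV where
  "FV i l u v w y z = Bc i l u * (omv i v w * tav i y z + tav i v w * omv i y z)
     - Ac i l u * (omv i v w * omv i y z)"

lemma delta_pair_sum:
  fixes v w :: "nat \<Rightarrow> real"
  assumes "p < n" "q < n"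
  shows "(\<Sum>a<n. v a * (\<Sum>b<n. w b * (if a = p \<and> b = q then 1 else 0))) = v p * w q"
proof -
  have "(\<Sum>b<n. w b * (if a = p \<and> b = q then 1 else 0)) = (if a = p then w q else 0)" for a
    using assms by (auto simp: if_zero_mult)
  then show ?thesis using assms by (simp add: if_zero_mult)
qed

lemma om_sum: "i \<in> {1..k} \<Longrightarrow> (\<Sum>a<n. v a * (\<Sum>b<n. w b * om i a b)) = omv i v w"
proof -
  assume i: "i \<in> {1..k}"
  have "om i a b = (if a = 0 \<and> b = i then 1 else 0) - (if a = i \<and> b = 0 then 1 else 0)" for a b
    using i by (auto simp: om_def)
  then show ?thesis using i
    by (simp add: right_diff_distrib sum_subtractf delta_pair_sum omv_def)
qed

lemma ta_sum: "i \<in> {1..k} \<Longrightarrow> (\<Sum>a<n. v a * (\<Sum>b<n. w b * ta i a b)) = tav i v w"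
proof -
  assume i: "i \<in> {1..k}"
  have "ta i a b = (if a = i \<and> b = si i then 1 else 0) - (if a = si i \<and> b = i then 1 else 0)" for a b
    using i by (auto simp: ta_def)
  then show ?thesis using i
    by (simp add: right_diff_distrib sum_subtractf delta_pair_sum tav_def)
qed

lemma FV_sum:
  assumes "i \<in> {1..k}"
  shows "(\<Sum>a<n. v a * (\<Sum>b<n. w b * (\<Sum>c<n. y c * (\<Sum>d<n. z d * Fc i l u a b c d)))) = FV i l u v w y z"
proof -
  have Fc: "Fc i l u a b c d = Bc i l u * (om i a b * ta i c d) + Bc i l u * (ta i a b * om i c d)
     - Ac i l u * (om i a b * om i c d)" for a b c d
    by (simp add: Fc_def algebra_simps)
  have lin: "(\<Sum>d<n. z d * (r * h1 d + r * h2 d - s * h3 d)) =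
     r * (\<Sum>d<n. z d * h1 d) + r * (\<Sum>d<n. z d * h2 d) - s * (\<Sum>d<n. z d * h3 d)"
    for r s :: real and z h1 h2 h3 :: "nat \<Rightarrow> real"
    by (simp add: sum_distrib_left sum.distrib sum_subtractf algebra_simps)
  have "(\<Sum>a<n. v a * (\<Sum>b<n. w b * (\<Sum>c<n. y c * (\<Sum>d<n. z d * Fc i l u a b c d)))) =
     Bc i l u * (\<Sum>a<n. v a * (\<Sum>b<n. w b * (\<Sum>c<n. y c * (\<Sum>d<n. z d * (om i a b * ta i c d)))))
     + Bc i l u * (\<Sum>a<n. v a * (\<Sum>b<n. w b * (\<Sum>c<n. y c * (\<Sum>d<n. z d * (ta i a b * om i c d)))))
     - Ac i l u * (\<Sum>a<n. v a * (\<Sum>b<n. w b * (\<Sum>c<n. y c * (\<Sum>d<n. z d * (om i a b * om i c d)))))"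
    unfolding Fc lin ..
  then show ?thesis
    unfolding quad_sum_product om_sum[OF assms] ta_sum[OF assms] by (simp add: FV_def algebra_simps)
qed

lemma teval_nablaR:
  assumes "length ws = l"
  shows "teval n (nablaR n g l x) ([v, w, y, z] @ ws) =
    (\<Sum>i\<in>{1..k}. FV i l (x i) v w y z * (\<Prod>w\<leftarrow>ws. w i))"
proof -
  have "teval n (nablaR n g l x) ([v, w, y, z] @ ws) =
     (\<Sum>a<n. v a * (\<Sum>b<n. w b * (\<Sum>c<n. y c * (\<Sum>d<n. z d *
       teval n (\<lambda>is. nablaR n g l x ([a, b, c, d] @ is)) ws))))"
    by simp
  also have "\<dots> = (\<Sum>a<n. v a * (\<Sum>b<n. w b * (\<Sum>c<n. y c * (\<Sum>d<n. z d *
       (\<Sum>i\<in>{1..k}. Fc i l (x i) a b c d * (\<Prod>w\<leftarrow>ws. w i))))))"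
  proof -
    have "teval n (\<lambda>is. nablaR n g l x ([a, b, c, d] @ is)) ws =
        (\<Sum>i\<in>{1..k}. Fc i l (x i) a b c d * (\<Prod>w\<leftarrow>ws. w i))"
      if "a < n" "b < n" "c < n" "d < n" for a b c d
      unfolding teval_diagonal[symmetric] by (rule teval_cong, rule nablaR_eq) (use assms that in auto)
    then show ?thesis by (simp del: append.simps)
  qed
  also have "\<dots> = (\<Sum>i\<in>{1..k}. (\<Sum>a<n. v a * (\<Sum>b<n. w b * (\<Sum>c<n. y c * (\<Sum>d<n. z d *
       Fc i l (x i) a b c d)))) * (\<Prod>w\<leftarrow>ws. w i))"
    unfolding sum_mult_swap ..
  also have "\<dots> = (\<Sum>i\<in>{1..k}. FV i l (x i) v w y z * (\<Prod>w\<leftarrow>ws. w i))"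
    by (intro sum.cong refl) (simp only: FV_sum)
  finally show ?thesis .
qed

definition RV where "RV x v w y z = teval n (nablaR n g 0 x) [v, w, y, z]"

lemma RV_eq: "RV x v w y z = (\<Sum>i\<in>{1..k}. FV i 0 (x i) v w y z)"
  unfolding RV_def using teval_nablaR[of "[]" 0 x v w y z] by (simp del: teval.simps nablaR.simps)

lemma RV_lin: "RV x v w y z = (\<Sum>j<n. v j * RV x (\<lambda>i. if i = j then 1 else 0) w y z)"
proof -
  define lam where "lam j = teval n (\<lambda>is. nablaR n g 0 x (j # is)) [w, y, z]" for j
  have "RV x v w y z = (\<Sum>j<n. v j * lam j)" for v by (simp add: RV_def lam_def del: nablaR.simps)
  moreover have "(\<Sum>i<n. (if i = j then 1 else 0) * lam i) = lam j" if "j < n" for j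
    using that by (simp add: if_zero_mult)
  ultimately show ?thesis by simp
qed

text \<open>The values on coordinate vectors are later compared with their expansion in a normalized
  basis; this comparison determines the shape of the basis.\<close>

lemma RV_unit_v: "b \<le> k \<Longrightarrow> RV x (\<lambda>i. if i = vi b then 1 else 0) w y z = 0"
  unfolding RV_eq by (intro sum.neutral) (auto simp: FV_def omv_def tav_def)

lemma RV_unit_s:
  assumes "b \<in> {1..k}"
  shows "RV x (\<lambda>i. if i = si b then 1 else 0) w y z = - ((1 + deriv (f b) (x b)) * w b * omv b y z)"
proof -
  have "RV x (\<lambda>i. if i = si b then 1 else 0) w y z =
     (\<Sum>i\<in>{1..k}. if i = b then - ((1 + deriv (f b) (x b)) * w b * omv b y z) else 0)"
    unfolding RV_eq using assms
    by (intro sum.cong) (auto simp: FV_def omv_def tav_def Bc_def)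
  then show ?thesis using assms by simp
qed

end

section \<open>Normalized bases\<close>

locale gF_normalized_basis = gF_manifold +
  fixes x :: pt and B :: "lbl \<Rightarrow> pt"
  assumes nb: "normalized_basis k eps f x B"
begin

abbreviation "U i \<equiv> B (LU i)"
abbreviation "V i \<equiv> B (LV i)"
abbreviation "S i \<equiv> B (LS i)"

lemma in_lbls [simp]:
  "i \<le> k \<Longrightarrow> LU i \<in> lbls k" "i \<le> k \<Longrightarrow> LV i \<in> lbls k" "i \<in> {1..k} \<Longrightarrow> LS i \<in> lbls k"
  by (auto simp: lbls_def)

lemma gv_B: "a \<in> lbls k \<Longrightarrow> b \<in> lbls k \<Longrightarrow> gv n g x (B a) (B b) = g_norm eps a b"
  using nb unfolding normalized_basis_def n_def by blast

lemma RV_B: "a \<in> lbls k \<Longrightarrow> b \<in> lbls k \<Longrightarrow> c \<in> lbls k \<Longrightarrow> d \<in> lbls k \<Longrightarrow>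
    RV x (B a) (B b) (B c) (B d) = R_norm a b c d"
  using nb unfolding normalized_basis_def RV_def n_def by blast

text \<open>Enumerating the labels in coordinate order turns the basis and its dual into square
  matrices indexed below \<open>n\<close>.\<close>

definition lab :: "nat \<Rightarrow> lbl" where
  "lab m = (if m \<le> k then LU m else if m \<le> 2*k+1 then LV (m-(k+1)) else LS (m-(2*k+1)))"

lemma lab_simps [simp]:
  "i \<le> k \<Longrightarrow> lab i = LU i" "i \<le> k \<Longrightarrow> lab (vi i) = LV i" "i \<in> {1..k} \<Longrightarrow> lab (si i) = LS i"
  by (auto simp: lab_def vi_def si_def)

text \<open>The dual basis with respect to the metric, read off from the normalized Gram
  matrix.\<close>

definition dual :: "lbl \<Rightarrow> pt" where
  "dual l = (case l of LU i \<Rightarrow> V i | LV i \<Rightarrow> U i | LS i \<Rightarrow> (\<lambda>j. eps i * S i j))"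

lemma gv_scale: "gv n g x v (\<lambda>j. r * w j) = r * gv n g x v w"
  by (simp add: gv_def sum_distrib_left mult_ac)

lemma gv_dual:
  assumes "m < n" "m' < n"
  shows "gv n g x (B (lab m)) (dual (lab m')) = (if m = m' then 1 else 0)"
  using assms(1)
proof (cases rule: n_cases)
  case U
  show ?thesis using assms(2)
    by (cases rule: n_cases) (use U in \<open>auto simp: dual_def gv_B gv_scale g_norm_def\<close>)
next
  case (V i)
  show ?thesis using assms(2)
    by (cases rule: n_cases) (use V in \<open>auto simp: dual_def gv_B gv_scale g_norm_def\<close>)
next
  case (S i)
  show ?thesis using assms(2)
    by (cases rule: n_cases) (use S in \<open>auto simp: dual_def gv_B gv_scale g_norm_def\<close>)
qed

definition lower :: "nat \<Rightarrow> pt \<Rightarrow> real" where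
  "lower i v = (\<Sum>j<n. g x i j * v j)"

lemma lower_v: "b \<le> k \<Longrightarrow> lower (vi b) v = v b"
  unfolding lower_def sum_blocks by (simp add: g_blocks if_zero_mult)

lemma lower_s: "b \<in> {1..k} \<Longrightarrow> lower (si b) v = eps b * v (si b)"
  unfolding lower_def sum_blocks by (simp add: g_blocks if_zero_mult)

lemma lower_scale: "lower i (\<lambda>j. r * v j) = r * lower i v"
  by (simp add: lower_def sum_distrib_left mult_ac)

lemma gv_lower: "gv n g x v w = (\<Sum>i<n. v i * lower i w)"
  by (simp add: gv_def lower_def sum_distrib_left mult_ac)

text \<open>Duality says that the matrix of the basis times the lowered dual matrix is the identity;
  commuting the two factors resolves the identity in coordinates.\<close>

lemma completeness:
  assumes "i < n" "j < n"
  shows "(\<Sum>m<n. lower i (dual (lab m)) * B (lab m) j) = (if i = j then 1 else 0)"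
proof (rule left_inverse_imp_right_inverse[OF _ assms])
  fix m m' assume "m < n" "m' < n"
  then show "(\<Sum>i<n. B (lab m) i * lower i (dual (lab m'))) = (if m = m' then 1 else 0)"
    using gv_dual gv_lower by simp
qed

lemma completeness_blocks:
  assumes "i < n" "j < n"
  shows "(\<Sum>a\<le>k. lower i (V a) * U a j) + (\<Sum>a\<le>k. lower i (U a) * V a j)
    + (\<Sum>a\<in>{1..k}. eps a * lower i (S a) * S a j) = (if i = j then 1 else 0)"
  unfolding completeness[OF assms, symmetric] sum_blocks
  by (simp add: dual_def lower_scale)

text \<open>Resolution of the identity inserted in the first slot, by linearity. Each choice of
  \<open>i\<close> and of the other three arguments yields an equation for the basis.\<close>

lemma RV_expand:
  assumes "i < n"
  shows "RV x (\<lambda>j. if j = i then 1 else 0) w y z =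
    (\<Sum>a\<le>k. lower i (V a) * RV x (U a) w y z) + (\<Sum>a\<le>k. lower i (U a) * RV x (V a) w y z)
    + (\<Sum>a\<in>{1..k}. eps a * lower i (S a) * RV x (S a) w y z)"
proof -
  define R where "R j = RV x (\<lambda>i. if i = j then 1 else 0) w y z" for j
  have R: "RV x v w y z = (\<Sum>j<n. v j * R j)" for v unfolding R_def by (rule RV_lin)
  have "R i = (\<Sum>j<n. (if i = j then 1 else 0) * R j)" using assms by (simp add: if_zero_mult)
  also have "\<dots> = (\<Sum>j<n. (\<Sum>m<n. lower i (dual (lab m)) * B (lab m) j) * R j)"
    using assms by (intro sum.cong refl) (simp add: completeness)
  also have "\<dots> = (\<Sum>m<n. lower i (dual (lab m)) * RV x (B (lab m)) w y z)"
    unfolding R sum_mult_swap ..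
  also have "\<dots> = (\<Sum>a\<le>k. lower i (V a) * RV x (U a) w y z) + (\<Sum>a\<le>k. lower i (U a) * RV x (V a) w y z)
    + (\<Sum>a\<in>{1..k}. eps a * lower i (S a) * RV x (S a) w y z)"
    unfolding sum_blocks by (simp add: dual_def lower_scale)
  finally show ?thesis unfolding R_def .
qed

section \<open>Component equations for a normalized basis\<close>

lemma R_norm_V: "R_norm (LV a) b c d = 0"
  by (simp add: R_norm_def R_gen_def)

lemma R_norm_UUS: "i \<in> {1..k} \<Longrightarrow> R_norm l (LU i) (LU i) (LS i) = (if l = LU 0 then 1 else 0)"
  by (auto simp: R_norm_def R_gen_def)

lemma R_norm_U0US: "i \<in> {1..k} \<Longrightarrow> R_norm l (LU 0) (LU i) (LS i) = (if l = LU i then -1 else 0)"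
  by (auto simp: R_norm_def R_gen_def)

lemma R_norm_UUUU: "R_norm (LU a) (LU b) (LU c) (LU d) = 0"
  by (simp add: R_norm_def R_gen_def)

lemma R_norm_SUUU: "d \<in> {1..k} \<Longrightarrow> i \<in> {1..k} \<Longrightarrow> R_norm (LS d) (LU c) (LU 0) (LU i) =
    (if c = i \<and> d = i then -1 else 0)"
  by (auto simp: R_norm_def R_gen_def)

lemma eps_nz: "i \<in> {1..k} \<Longrightarrow> eps i \<noteq> 0"
  by (metis eps_sq mult_zero_left zero_neq_one)

text \<open>Insert the coordinate vector of v_b in R( . , U_i, U_0, U_i): the curvature kills it,
  while the expansion retains only the term of \<open>S i\<close>.\<close>

lemma S_u:
  assumes "b \<le> k" "i \<in> {1..k}"
  shows "S i b = 0"
proof -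
  have "0 = (\<Sum>a\<in>{1..k}. eps a * S a b * (if a = i then -1 else 0))"
    using RV_expand[of "vi b" "U i" "U 0" "U i"] assms
    by (simp add: RV_unit_v lower_v RV_B R_norm_SUUU R_norm_UUUU R_norm_V)
  then show ?thesis using assms eps_nz by (simp add: if_zero_mult)
qed

text \<open>Insert the coordinate vector of s_b in R( . , U_1, U_1, S_1). The value contains
  omega_b(U_1, S_1), which is zero because \<open>S 1\<close> has no \<open>u\<close>-components;
  the expansion leaves only \<open>V 0\<close>.\<close>

lemma V_s0:
  assumes "b \<in> {1..k}"
  shows "V 0 (si b) = 0"
proof -
  have "omv b (U 1) (S 1) = 0" using assms k1 S_u[of 0 1] S_u[of b 1] by (simp add: omv_def)
  then show ?thesis
    using RV_expand[of "si b" "U 1" "U 1" "S 1"] k1 assms eps_nz[of b]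
    by (simp add: RV_unit_s lower_s RV_B R_norm_UUS R_norm_V if_zero_mult)
qed

text \<open>The same insertion in R( . , U_0, U_i, S_i), where the expansion leaves only
  \<open>V i\<close>.\<close>

lemma V_si:
  assumes "b \<in> {1..k}" "i \<in> {1..k}"
  shows "V i (si b) = 0"
proof -
  have "omv b (U i) (S i) = 0" using assms k1 S_u[of 0 i] S_u[of b i] by (simp add: omv_def)
  then show ?thesis
    using RV_expand[of "si b" "U 0" "U i" "S i"] k1 assms eps_nz[of b]
    by (simp add: RV_unit_s lower_s RV_B R_norm_U0US R_norm_V if_zero_mult)
qed

lemma V_s: "a \<le> k \<Longrightarrow> b \<in> {1..k} \<Longrightarrow> V a (si b) = 0"
  using V_s0[of b] V_si[of b a] by (cases "a = 0") auto

text \<open>Resolution of the identity at two \<open>s\<close>-indices; the terms pairing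
  \<open>U\<close> with \<open>V\<close> drop out because no \<open>V\<close> has
  \<open>s\<close>-components.\<close>

lemma S_orthonormal:
  assumes "b \<in> {1..k}" "b' \<in> {1..k}"
  shows "eps b * (\<Sum>a\<in>{1..k}. eps a * S a (si b) * S a (si b')) = (if b = b' then 1 else 0)"
  using completeness_blocks[of "si b" "si b'"] assms
  by (simp add: lower_s V_s sum_distrib_left mult_ac)

text \<open>Insert the coordinate vector of s_b in R( . , U_c, U_0, U_d). The case
  \<open>c = 0\<close> is included and later shows that \<open>U 0\<close> has no components along
  u_1, ..., u_k.\<close>

lemma U_component_relation:
  assumes "b \<in> {1..k}" "d \<in> {1..k}" "c \<le> k"
  shows "(1 + deriv (f b) (x b)) * U c b * omv b (U 0) (U d)
     = (if c = d then eps b * eps d * S d (si b) else 0)"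
proof -
  have "- ((1 + deriv (f b) (x b)) * U c b * omv b (U 0) (U d)) =
    (\<Sum>a\<in>{1..k}. eps a * (eps b * S a (si b)) * (if c = d \<and> a = d then -1 else 0))"
    using RV_expand[of "si b" "U c" "U 0" "U d"] assms
    by (simp add: RV_unit_s lower_s RV_B R_norm_SUUU R_norm_UUUU R_norm_V)
  also have "\<dots> = (\<Sum>a\<in>{1..k}. if a = d then - (if c = d then eps b * eps d * S d (si b) else 0) else 0)"
    by (intro sum.cong) auto
  finally show ?thesis using assms by simp
qed

lemma S_nonzero: "b \<in> {1..k} \<Longrightarrow> \<exists>d\<in>{1..k}. S d (si b) \<noteq> 0"
proof (rule ccontr)
  assume b: "b \<in> {1..k}" and "\<not> (\<exists>d\<in>{1..k}. S d (si b) \<noteq> 0)"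
  then have "(\<Sum>a\<in>{1..k}. eps a * S a (si b) * S a (si b)) = 0" by simp
  then show False using S_orthonormal[OF b b] by simp
qed

text \<open>
  For fixed \<open>b\<close> and \<open>d\<close>, the left side of \<open>U_component_relation\<close> is a multiple of \<open>U c b\<close> by a factor independent
  of \<open>c\<close>, while the right side is supported at \<open>c = d\<close>. So exactly one \<open>d\<close> has \<open>S d (si b) \<noteq> 0\<close>.
\<close>

definition perm :: "nat \<Rightarrow> nat" where
  "perm b = (SOME d. d \<in> {1..k} \<and> S d (si b) \<noteq> 0)"

lemma perm_props:
  assumes "b \<in> {1..k}"
  shows "perm b \<in> {1..k}" "S (perm b) (si b) \<noteq> 0"
  using someI_ex[of "\<lambda>d. d \<in> {1..k} \<and> S d (si b) \<noteq> 0"] S_nonzero[OF assms]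
  unfolding perm_def by blast+

lemma U_perm:
  assumes "b \<in> {1..k}" "c \<le> k" "c \<noteq> perm b"
  shows "U c b = 0"
proof -
  note d = perm_props[OF assms(1)]
  have "omv b (U 0) (U (perm b)) \<noteq> 0"
    using U_component_relation[OF assms(1) d(1), of "perm b"] d eps_nz[OF assms(1)] eps_nz[OF d(1)] by auto
  then show ?thesis
    using U_component_relation[OF assms(1) d(1) assms(2)] assms(3) c_nz[OF assms(1)] by auto
qed

lemma U0_i: "b \<in> {1..k} \<Longrightarrow> U 0 b = 0"
  using U_perm[of b 0] perm_props(1)[of b] by auto

text \<open>The diagonal case \<open>c = d\<close> of the relation, now that
  \<open>U d b = 0\<close> is known.\<close>

lemma S_perm:
  assumes "b \<in> {1..k}" "d \<in> {1..k}" "d \<noteq> perm b"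
  shows "S d (si b) = 0"
  using U_component_relation[OF assms(1,2), of d] U_perm[of b d] assms eps_nz by auto

text \<open>Two rows of the \<open>s\<close>-block supported in the same column would have a nonzero
  product, against orthogonality.\<close>

lemma perm_inj: "inj_on perm {1..k}"
proof (rule inj_onI, rule ccontr)
  fix b b' assume b: "b \<in> {1..k}" "b' \<in> {1..k}" and eq: "perm b = perm b'" and ne: "b \<noteq> b'"
  have "(\<Sum>a\<in>{1..k}. eps a * S a (si b) * S a (si b')) =
     (\<Sum>a\<in>{1..k}. if a = perm b then eps a * S a (si b) * S a (si b') else 0)"
    using b by (intro sum.cong) (auto simp: S_perm)
  also have "\<dots> = eps (perm b) * S (perm b) (si b) * S (perm b) (si b')"
    using perm_props[OF b(1)] by simp
  finally show False
    using S_orthonormal[OF b] ne perm_props[OF b(1)] perm_props[OF b(2)] eq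
      eps_nz[OF b(1)] eps_nz[of "perm b"] by auto
qed

lemma perm_bij: "bij_betw perm {1..k} {1..k}"
  unfolding bij_betw_def using perm_inj perm_props(1)
  by (simp add: endo_inj_surj image_subset_iff)

text \<open>The relation at \<open>c = d = perm b\<close> expresses the quantity as a sign times an
  entry of the \<open>s\<close>-block. That entry is the only one in its row, so orthonormality
  makes its square 1.\<close>

lemma normalization:
  assumes "b \<in> {1..k}"
  shows "((1 + deriv (f b) (x b)) * (U 0 0 * (U (perm b) b)\<^sup>2))\<^sup>2 = 1"
proof -
  note d = perm_props[OF assms]
  let ?d = "perm b" and ?q = "S (perm b) (si b)"
  have 1: "(1 + deriv (f b) (x b)) * (U 0 0 * (U ?d b)\<^sup>2) = eps b * eps ?d * ?q"
    using U_component_relation[OF assms d(1), of ?d] d(1) U0_i[OF assms] by (simp add: omv_def power2_eq_square mult_ac)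
  have "(\<Sum>a\<in>{1..k}. eps a * S a (si b) * S a (si b)) =
     (\<Sum>a\<in>{1..k}. if a = ?d then eps a * S a (si b) * S a (si b) else 0)"
    using assms by (intro sum.cong) (auto simp: S_perm)
  also have "\<dots> = eps ?d * ?q * ?q" using d by simp
  finally have 2: "eps b * eps ?d * ?q\<^sup>2 = 1"
    using S_orthonormal[OF assms assms] by (simp add: power2_eq_square mult.assoc)
  have 3: "(eps b * eps ?d)\<^sup>2 = 1"
    using eps_sq[OF assms] eps_sq[OF d(1)] by (simp add: power2_eq_square mult_ac)
  then have "eps b * eps ?d = 1 \<or> eps b * eps ?d = - 1" by (simp add: power2_eq_1_iff)
  then have "?q\<^sup>2 = 1"
  proof
    \<comment> \<open>Opposite signs are impossible, since a real square would be negative.\<close>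
    assume "eps b * eps ?d = - 1"
    then have "- ?q\<^sup>2 = 1" using 2 by simp
    moreover have "0 \<le> ?q\<^sup>2" by simp
    ultimately show ?thesis by linarith
  qed (use 2 in simp)
  then show ?thesis using 1 3 by (simp add: power_mult_distrib)
qed

text \<open>Only the summand \<open>i = b\<close> survives. The unknown \<open>s\<close>-component
  of \<open>U 0\<close> enters through tau_b and is eliminated by R(U_0, U_j, U_j, U_0) = 0 for j =
  \<open>perm b\<close>.\<close>

lemma teval_gamma:
  assumes "b \<in> {1..k}"
  shows "teval n (nablaR n g l x)
       ([U 0, U (perm b), U (perm b), U 0] @ replicate l (U (perm b))) =
     (U 0 0)\<^sup>2 * (U (perm b) b)\<^sup>2 * (U (perm b) b) ^ l
       * (Ac b l (x b) - eps b * (f b (x b))\<^sup>2 * Bc b l (x b) / (1 + deriv (f b) (x b)))"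
proof -
  let ?d = "perm b"
  note d = perm_props[OF assms]
  define \<alpha> where "\<alpha> = U 0 (si b)"
  have ev: "teval n (nablaR n g l x) ([U 0, U ?d, U ?d, U 0] @ replicate l (U ?d)) =
     (2 * U 0 0 * \<alpha> * (U ?d b)\<^sup>2 * Bc b l (x b) + (U 0 0)\<^sup>2 * (U ?d b)\<^sup>2 * Ac b l (x b)) * U ?d b ^ l" for l
  proof -
    have "teval n (nablaR n g l x) ([U 0, U ?d, U ?d, U 0] @ replicate l (U ?d)) =
      (\<Sum>i\<in>{1..k}. FV i l (x i) (U 0) (U ?d) (U ?d) (U 0) * (U ?d i) ^ l)"
      by (subst teval_nablaR) (simp_all add: prod_list_replicate)
    also have "\<dots> = (\<Sum>i\<in>{1..k}. if i = b then
       FV b l (x b) (U 0) (U ?d) (U ?d) (U 0) * (U ?d b) ^ l else 0)"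
    proof (intro sum.cong refl)
      fix i assume i: "i \<in> {1..k}"
      \<comment> \<open>By injectivity of \<open>perm\<close>, the index \<open>perm b\<close>
        differs from \<open>perm i\<close>.\<close>
      have "U ?d i = 0" if "i \<noteq> b"
        using that i assms d inj_onD[OF perm_inj, of b i] by (intro U_perm) auto
      then show "FV i l (x i) (U 0) (U ?d) (U ?d) (U 0) * (U ?d i) ^ l = (if i = b then
         FV b l (x b) (U 0) (U ?d) (U ?d) (U 0) * (U ?d b) ^ l else 0)"
        using U0_i[OF i] by (auto simp: FV_def omv_def tav_def)
    qed
    also have "\<dots> = FV b l (x b) (U 0) (U ?d) (U ?d) (U 0) * (U ?d b) ^ l" using assms by simp
    finally show ?thesis
      using U0_i[OF assms] by (simp add: FV_def omv_def tav_def \<alpha>_def algebra_simps power2_eq_square)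
  qed
  have c: "1 + deriv (f b) (x b) \<noteq> 0" using c_nz[OF assms] .
  \<comment> \<open>The evaluation at \<open>l = 0\<close> becomes a linear equation for
    \<open>\<alpha>\<close> once the nonzero factor \<open>U 0 0 * (U ?d b)\<^sup>2\<close> is
    divided out.\<close>
  have "RV x (U 0) (U ?d) (U ?d) (U 0) = 0" using d by (simp add: RV_B R_norm_UUUU)
  then have "2 * U 0 0 * \<alpha> * (U ?d b)\<^sup>2 * Bc b 0 (x b) + (U 0 0)\<^sup>2 * (U ?d b)\<^sup>2 * Ac b 0 (x b) = 0"
    using ev[of 0] unfolding RV_def by (simp del: teval.simps nablaR.simps)
  then have "(U 0 0 * (U ?d b)\<^sup>2) * (2 * \<alpha> * (1 + deriv (f b) (x b)) + U 0 0 * (eps b * (f b (x b))\<^sup>2)) = 0"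
    by (simp add: Bc_def algebra_simps power2_eq_square)
  moreover have "U 0 0 * (U ?d b)\<^sup>2 \<noteq> 0" using normalization[OF assms] by auto
  ultimately have "2 * \<alpha> * (1 + deriv (f b) (x b)) + U 0 0 * (eps b * (f b (x b))\<^sup>2) = 0" by simp
  then have "2 * \<alpha> = - U 0 0 * (eps b * (f b (x b))\<^sup>2 / (1 + deriv (f b) (x b)))"
    using c by (simp add: field_simps)
  then have "(2 * \<alpha>) * (U 0 0 * (U ?d b)\<^sup>2 * Bc b l (x b)) =
      - (U 0 0)\<^sup>2 * (U ?d b)\<^sup>2 * (eps b * (f b (x b))\<^sup>2 * Bc b l (x b) / (1 + deriv (f b) (x b)))"
    by (simp add: power2_eq_square)
  then have "2 * U 0 0 * \<alpha> * (U ?d b)\<^sup>2 * Bc b l (x b) =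
      - ((U 0 0)\<^sup>2 * (U ?d b)\<^sup>2 * (eps b * (f b (x b))\<^sup>2 * Bc b l (x b) / (1 + deriv (f b) (x b))))"
    by (simp add: mult_ac)
  then show ?thesis unfolding ev by (simp add: right_diff_distrib left_diff_distrib mult_ac)
qed

section \<open>The formula for gamma as a function of the point\<close>

definition Zc where
  "Zc b l = Ac b l (x b) - eps b * (f b (x b))\<^sup>2 * Bc b l (x b) / (1 + deriv (f b) (x b))"

text \<open>With a = \<open>U 0 0\<close> and \<beta> = \<open>U (perm b) b\<close>, each summand
  carries a to the power 2 + 2(l-2) and \<beta> to the power (l+2) + 3(l-2). Together this is the
  (l-1)-th power of (a \<beta>^2)^2, which the normalization fixes.\<close>

lemma gamma_formula:
  assumes "l \<ge> 2"
  shows "gammaF k eps f l x B =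
    (\<Sum>b\<in>{1..k}. (1 / (1 + deriv (f b) (x b))\<^sup>2) ^ (l - 1) * (Zc b l * Zc b 1 ^ (l - 2)))"
proof -
  let ?t = "\<lambda>j. teval n (nablaR n g l x) ([U 0, U j, U j, U 0] @ replicate l (U j))
   * (teval n (nablaR n g 1 x) [U 0, U j, U j, U 0, U j]) ^ (l - 2)"
  have "gammaF k eps f l x B = (\<Sum>j\<in>{1..k}. ?t j)"
    unfolding gammaF_def n_def ..
  \<comment> \<open>The vector U_j belongs to the coordinate u_b with j = \<open>perm b\<close>, so
    the sum is taken over coordinates.\<close>
  also have "\<dots> = (\<Sum>b\<in>{1..k}. ?t (perm b))"
    by (rule sum.reindex_bij_betw[OF perm_bij, symmetric])
  also have "\<dots> = (\<Sum>b\<in>{1..k}. (1 / (1 + deriv (f b) (x b))\<^sup>2) ^ (l - 1) * (Zc b l * Zc b 1 ^ (l - 2)))"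
  proof (intro sum.cong refl)
    fix b assume b: "b \<in> {1..k}"
    obtain m where m: "l = m + 2" using assms le_Suc_ex by (metis add.commute)
    define a \<beta> where "a = U 0 0" and "\<beta> = U (perm b) b"
    have "(1 + deriv (f b) (x b))\<^sup>2 * (a * \<beta>\<^sup>2)\<^sup>2 = 1"
      using normalization[OF b] unfolding a_def \<beta>_def by (simp add: power_mult_distrib)
    then have ab: "(a * \<beta>\<^sup>2)\<^sup>2 = 1 / (1 + deriv (f b) (x b))\<^sup>2"
      using c_nz[OF b, of "x b"] by (simp add: field_simps)
    have "teval n (nablaR n g l x) ([U 0, U (perm b), U (perm b), U 0] @ replicate l (U (perm b)))
       = a\<^sup>2 * \<beta>\<^sup>2 * \<beta> ^ l * Zc b l"
      unfolding teval_gamma[OF b] Zc_def a_def \<beta>_def ..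
    moreover have "teval n (nablaR n g 1 x) [U 0, U (perm b), U (perm b), U 0, U (perm b)]
       = a\<^sup>2 * \<beta>\<^sup>2 * \<beta> ^ 1 * Zc b 1"
      using teval_gamma[OF b, of 1] unfolding Zc_def a_def \<beta>_def
      by (simp del: teval.simps nablaR.simps)
    ultimately have "?t (perm b) = a\<^sup>2 * \<beta>\<^sup>2 * \<beta> ^ l * Zc b l * (a\<^sup>2 * \<beta>\<^sup>2 * \<beta> ^ 1 * Zc b 1) ^ (l - 2)"
      by simp
    also have "\<dots> = (a\<^sup>2 * \<beta>\<^sup>2 * \<beta> ^ l * (a\<^sup>2 * \<beta> ^ 3) ^ m) * (Zc b l * Zc b 1 ^ (l - 2))"
      unfolding m by (simp add: power_mult_distrib power2_eq_square power3_eq_cube mult_ac)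
    also have "a\<^sup>2 * \<beta>\<^sup>2 * \<beta> ^ l * (a\<^sup>2 * \<beta> ^ 3) ^ m = ((a * \<beta>\<^sup>2)\<^sup>2) ^ (l - 1)"
    proof -
      define X where "X = (a\<^sup>2 * \<beta> ^ 3) ^ m"
      have "a\<^sup>2 * \<beta>\<^sup>2 * \<beta> ^ l * X = (a\<^sup>2 * \<beta> ^ 3 * \<beta>) * (X * \<beta> ^ m)"
        unfolding m by (simp add: power_add power2_eq_square power3_eq_cube mult_ac)
      also have "\<dots> = (a\<^sup>2 * \<beta> ^ 3 * \<beta>) ^ Suc m"
        unfolding power_Suc power_mult_distrib[of "a\<^sup>2 * \<beta> ^ 3" \<beta>] X_def ..
      also have "\<dots> = ((a * \<beta>\<^sup>2)\<^sup>2) ^ (l - 1)"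
        unfolding m by (simp add: power2_eq_square power3_eq_cube mult_ac)
      finally show ?thesis unfolding X_def .
    qed
    finally show "?t (perm b) = (1 / (1 + deriv (f b) (x b))\<^sup>2) ^ (l - 1) * (Zc b l * Zc b 1 ^ (l - 2))"
      unfolding ab .
  qed
  finally show ?thesis .
qed

lemma Zc_2:
  assumes b: "b \<in> {1..k}"
  shows "Zc b 2 = eps b * (4 * (deriv (f b) (x b))\<^sup>2 + 2 * deriv (f b) (x b)
    + 6 * f b (x b) * (deriv ^^ 2) (f b) (x b)
    - (f b (x b))\<^sup>2 * (deriv ^^ 3) (f b) (x b) / (deriv (f b) (x b) + 1))"
proof -
  have 0: "deriv (Ac b 0) = (\<lambda>u. 2 * eps b * f b u * deriv (f b) u)"
    by (intro ext DERIV_imp_deriv) (auto intro!: derivative_eq_intros f_deriv1[OF b])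
  have 1: "Ac b (Suc 0) = (\<lambda>u. eps b * (4 * f b u * deriv (f b) u + 2 * f b u))"
    unfolding Ac.simps(2) 0 by (simp add: Bc_def algebra_simps)
  have 2: "deriv (Ac b (Suc 0)) = (\<lambda>u. eps b * (4 * (deriv (f b) u)\<^sup>2 + 4 * f b u * deriv (deriv (f b)) u
      + 2 * deriv (f b) u))"
    unfolding 1
    by (intro ext DERIV_imp_deriv)
      (auto intro!: derivative_eq_intros f_deriv1[OF b] f_deriv2[OF b] simp: algebra_simps power2_eq_square)
  \<comment> \<open>The coefficient 6 is 4 from differentiating the first stage plus 2 from the
    \<open>Bc\<close> term of the recursion.\<close>
  have 3: "Ac b 2 (x b) = eps b * (4 * (deriv (f b) (x b))\<^sup>2 + 2 * deriv (f b) (x b)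
    + 6 * f b (x b) * (deriv ^^ 2) (f b) (x b))"
    unfolding numeral_2_eq_2 Ac.simps(2)[of b "Suc 0"] 2 by (simp add: Bc_def algebra_simps)
  have "Bc b 2 (x b) = (deriv ^^ 3) (f b) (x b)" by (simp add: Bc_def numeral_3_eq_3 numeral_2_eq_2)
  then show ?thesis unfolding Zc_def 3 by (simp add: algebra_simps)
qed

lemma gamma_2:
  "gammaF k eps f 2 x B = (\<Sum>j=1..k. eps j / (deriv (f j) (x j) + 1)^2 *
             (4 * (deriv (f j) (x j))^2 + 2 * deriv (f j) (x j)
              + 6 * f j (x j) * (deriv ^^ 2) (f j) (x j)
              - (f j (x j))^2 * (deriv ^^ 3) (f j) (x j) / (deriv (f j) (x j) + 1)))"
  unfolding gamma_formula[OF order_refl]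
  by (intro sum.cong refl) (simp add: Zc_2 add.commute)

end

section \<open>Multilinear algebra\<close>

lemma teval_sum_T:
  "teval n (\<lambda>is. \<Sum>p\<in>I. c p * T p is) vs = (\<Sum>p\<in>I. c p * teval n (T p) vs)"
proof (induction vs arbitrary: T)
  case (Cons v vs)
  have "teval n (\<lambda>is. \<Sum>p\<in>I. c p * T p is) (v # vs) =
     (\<Sum>i<n. v i * (\<Sum>p\<in>I. c p * teval n (\<lambda>is. T p (i # is)) vs))"
    using Cons.IH[of "\<lambda>p is. T p (i # is)" for i] by simp
  also have "\<dots> = (\<Sum>i<n. \<Sum>p\<in>I. c p * (v i * teval n (\<lambda>is. T p (i # is)) vs))"
    by (simp add: sum_distrib_left mult.left_commute)
  also have "\<dots> = (\<Sum>p\<in>I. \<Sum>i<n. c p * (v i * teval n (\<lambda>is. T p (i # is)) vs))"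
    by (rule sum.swap)
  finally show ?case by (simp add: sum_distrib_left)
qed simp

lemma teval_diff_T: "teval n (\<lambda>is. T is - T' is) vs = teval n T vs - teval n T' vs"
proof (induction vs arbitrary: T T')
  case (Cons v vs)
  then show ?case by (simp add: right_diff_distrib sum_subtractf)
qed simp

text \<open>The recursion of \<open>nablaR\<close> removes the last index while \<open>teval\<close>
  consumes the first argument; this bridges the two orders.\<close>

lemma teval_snoc:
  "teval n T (vs @ [v]) = (\<Sum>p<n. v p * teval n (\<lambda>is. T (is @ [p])) vs)"
proof (induction vs arbitrary: T)
  case (Cons w vs)
  have "teval n T ((w # vs) @ [v]) =
     (\<Sum>i<n. w i * (\<Sum>p<n. v p * teval n (\<lambda>is. T (i # is @ [p])) vs))"
    using Cons.IH[of "\<lambda>is. T (i # is)" for i] by simp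
  also have "\<dots> = (\<Sum>i<n. \<Sum>p<n. v p * (w i * teval n (\<lambda>is. T (i # is @ [p])) vs))"
    by (simp add: sum_distrib_left mult.left_commute)
  also have "\<dots> = (\<Sum>p<n. \<Sum>i<n. v p * (w i * teval n (\<lambda>is. T (i # is @ [p])) vs))"
    by (rule sum.swap)
  finally show ?case by (simp add: sum_distrib_left)
qed simp

text \<open>Linearity is phrased by one coefficient family serving all \<open>w\<close>, from which
  congruence, sums and differences in a slot follow at once.\<close>

lemma teval_slot_linear:
  assumes "r < length vs"
  shows "\<exists>lam. \<forall>w. teval n T (vs[r := w]) = (\<Sum>e<n. w e * lam e)"
  using assms
proof (induction vs arbitrary: r T)
  case (Cons v vs)
  show ?case
  proof (cases r)
    case 0
    then show ?thesis by (intro exI[of _ "\<lambda>e. teval n (\<lambda>is. T (e # is)) vs"]) simp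
  next
    case (Suc q)
    have "\<forall>i. \<exists>lam. \<forall>w. teval n (\<lambda>is. T (i # is)) (vs[q := w]) = (\<Sum>e<n. w e * lam e)"
      using Cons Suc by auto
    then obtain lam where lam: "\<And>i w. teval n (\<lambda>is. T (i # is)) (vs[q := w]) = (\<Sum>e<n. w e * lam i e)"
      by metis
    have "teval n T ((v # vs)[r := w]) = (\<Sum>e<n. w e * (\<Sum>i<n. v i * lam i e))" for w
    proof -
      have "teval n T ((v # vs)[r := w]) = (\<Sum>i<n. \<Sum>e<n. w e * (v i * lam i e))"
        by (simp add: Suc lam sum_distrib_left mult.left_commute)
      also have "\<dots> = (\<Sum>e<n. \<Sum>i<n. w e * (v i * lam i e))" by (rule sum.swap)
      finally show ?thesis by (simp add: sum_distrib_left)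
    qed
    then show ?thesis by (intro exI[of _ "\<lambda>e. \<Sum>i<n. v i * lam i e"]) blast
  qed
qed simp

lemma teval_slot_cong:
  assumes "r < length vs" "\<And>e. e < n \<Longrightarrow> w e = w' e"
  shows "teval n T (vs[r := w]) = teval n T (vs[r := w'])"
proof -
  obtain lam where "\<And>w. teval n T (vs[r := w]) = (\<Sum>e<n. w e * lam e)"
    using teval_slot_linear[OF assms(1)] by metis
  then show ?thesis using assms(2) by simp
qed

lemma teval_slot_sum:
  assumes "r < length vs"
  shows "teval n T (vs[r := (\<lambda>e. \<Sum>p\<in>I. c p * w p e)]) = (\<Sum>p\<in>I. c p * teval n T (vs[r := w p]))"
proof -
  obtain lam where lam: "\<And>w. teval n T (vs[r := w]) = (\<Sum>e<n. w e * lam e)"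
    using teval_slot_linear[OF assms] by metis
  have "(\<Sum>e<n. (\<Sum>p\<in>I. c p * w p e) * lam e) = (\<Sum>e<n. \<Sum>p\<in>I. c p * (w p e * lam e))"
    by (simp add: sum_distrib_right mult.assoc)
  also have "\<dots> = (\<Sum>p\<in>I. \<Sum>e<n. c p * (w p e * lam e))" by (rule sum.swap)
  finally show ?thesis unfolding lam by (simp add: sum_distrib_left)
qed

lemma teval_slot_diff:
  assumes "r < length vs"
  shows "teval n T (vs[r := (\<lambda>e. w e - w' e)]) = teval n T (vs[r := w]) - teval n T (vs[r := w'])"
proof -
  obtain lam where lam: "\<And>w. teval n T (vs[r := w]) = (\<Sum>e<n. w e * lam e)"
    using teval_slot_linear[OF assms] by metis
  show ?thesis unfolding lam by (simp add: left_diff_distrib sum_subtractf)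
qed

text \<open>Lets a connection term act on the argument vector instead of on the tensor
  components.\<close>

lemma teval_contract_slot:
  assumes "r < length vs"
  shows "teval n (\<lambda>is. \<Sum>e<n. M e (is ! r) * T (is[r := e])) vs
    = teval n T (vs[r := (\<lambda>e. \<Sum>i<n. (vs ! r) i * M e i)])"
  using assms
proof (induction vs arbitrary: r T)
  case (Cons v vs)
  show ?case
  proof (cases r)
    case 0
    have "teval n (\<lambda>is. \<Sum>e<n. M e (is ! r) * T (is[r := e])) (v # vs) =
       (\<Sum>i<n. v i * (\<Sum>e<n. M e i * teval n (\<lambda>is. T (e # is)) vs))"
      by (simp add: 0 teval_sum_T)
    also have "\<dots> = (\<Sum>i<n. \<Sum>e<n. v i * M e i * teval n (\<lambda>is. T (e # is)) vs)"
      by (simp add: sum_distrib_left mult.assoc)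
    also have "\<dots> = (\<Sum>e<n. \<Sum>i<n. v i * M e i * teval n (\<lambda>is. T (e # is)) vs)"
      by (rule sum.swap)
    finally show ?thesis by (simp add: 0 sum_distrib_right)
  next
    case (Suc q)
    then show ?thesis using Cons.IH[of q "\<lambda>is. T (i # is)" for i] Cons.prems by simp
  qed
qed simp

text \<open>The product rule for a varying tensor on varying arguments: one term from the tensor and
  one from each slot.\<close>

lemma teval_deriv:
  fixes vs :: "(real \<Rightarrow> pt) list"
  assumes "\<And>is. length is = length vs \<Longrightarrow> set is \<subseteq> {..<n} \<Longrightarrow>
      ((\<lambda>t. T t is) has_real_derivative T' is) (at t0)"
    and "length vs' = length vs"
    and "\<And>r i. r < length vs \<Longrightarrow> i < n \<Longrightarrow> ((\<lambda>t. (vs ! r) t i) has_real_derivative (vs' ! r) i) (at t0)"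
  shows "((\<lambda>t. teval n (T t) (map (\<lambda>v. v t) vs)) has_real_derivative
     teval n T' (map (\<lambda>v. v t0) vs)
       + (\<Sum>r<length vs. teval n (T t0) ((map (\<lambda>v. v t0) vs)[r := vs' ! r]))) (at t0)"
  using assms
proof (induction vs arbitrary: vs' T T')
  case Nil
  then show ?case by simp
next
  case (Cons v vs)
  obtain v' ws where vs': "vs' = v' # ws" and ws: "length ws = length vs"
    using Cons.prems(2) by (cases vs') auto
  have dv: "((\<lambda>t. v t i) has_real_derivative v' i) (at t0)" if "i < n" for i
    using Cons.prems(3)[of 0 i] that by (simp add: vs')
  have dvs: "((\<lambda>t. (vs ! r) t i) has_real_derivative (ws ! r) i) (at t0)" if "r < length vs" "i < n" for r i
    using Cons.prems(3)[of "Suc r" i] that by (simp add: vs')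
  let ?R = "\<lambda>i. teval n (\<lambda>is. T t0 (i # is)) (map (\<lambda>v. v t0) vs)"
  let ?Q = "\<lambda>i. teval n (\<lambda>is. T' (i # is)) (map (\<lambda>v. v t0) vs)
       + (\<Sum>r<length vs. teval n (\<lambda>is. T t0 (i # is)) ((map (\<lambda>v. v t0) vs)[r := ws ! r]))"
  have IH: "((\<lambda>t. teval n (\<lambda>is. T t (i # is)) (map (\<lambda>v. v t) vs)) has_real_derivative ?Q i) (at t0)"
    if "i < n" for i
    by (rule Cons.IH) (use Cons.prems(1) ws dvs that in auto)
  have "((\<lambda>t. \<Sum>i<n. v t i * teval n (\<lambda>is. T t (i # is)) (map (\<lambda>v. v t) vs)) has_real_derivative
     (\<Sum>i<n. v' i * ?R i + ?Q i * v t0 i)) (at t0)"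
    by (intro DERIV_sum DERIV_mult) (use dv IH in auto)
  also have "(\<Sum>i<n. v' i * ?R i + ?Q i * v t0 i) =
     (\<Sum>i<n. v t0 i * teval n (\<lambda>is. T' (i # is)) (map (\<lambda>v. v t0) vs))
     + ((\<Sum>i<n. v' i * ?R i) + (\<Sum>i<n. v t0 i *
          (\<Sum>r<length vs. teval n (\<lambda>is. T t0 (i # is)) ((map (\<lambda>v. v t0) vs)[r := ws ! r]))))"
    by (simp add: sum.distrib algebra_simps)
  also have "(\<Sum>i<n. v t0 i * (\<Sum>r<length vs. teval n (\<lambda>is. T t0 (i # is)) ((map (\<lambda>v. v t0) vs)[r := ws ! r])))
    = (\<Sum>r<length vs. \<Sum>i<n. v t0 i * teval n (\<lambda>is. T t0 (i # is)) ((map (\<lambda>v. v t0) vs)[r := ws ! r]))"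
    unfolding sum_distrib_left by (rule sum.swap)
  also have "(\<Sum>i<n. v' i * ?R i) + \<dots> =
    (\<Sum>r<length (v # vs). teval n (T t0) ((map (\<lambda>v. v t0) (v # vs))[r := vs' ! r]))"
    unfolding length_Cons sum.lessThan_Suc_shift by (simp add: vs')
  finally show ?case by simp
qed

text \<open>Reduces a pullback statement for arbitrary vectors to one about the columns of
  \<open>A\<close>.\<close>

lemma teval_map_mapv:
  "teval n T (map (mapv n A) vs) = teval n (\<lambda>is. teval n T (map (\<lambda>j i. A i j) is)) vs"
proof (induction vs arbitrary: T)
  case (Cons v vs)
  let ?t = "\<lambda>i. teval n (\<lambda>is. T (i # is)) (map (mapv n A) vs)"
  have "teval n T (map (mapv n A) (v # vs)) = (\<Sum>i<n. (\<Sum>j<n. A i j * v j) * ?t i)"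
    by (simp add: mapv_def)
  also have "\<dots> = (\<Sum>i<n. \<Sum>j<n. v j * (A i j * ?t i))"
    by (simp add: sum_distrib_right mult_ac)
  also have "\<dots> = (\<Sum>j<n. \<Sum>i<n. v j * (A i j * ?t i))" by (rule sum.swap)
  also have "\<dots> = (\<Sum>j<n. v j * teval n (\<lambda>is. \<Sum>i<n. A i j * teval n (\<lambda>ks. T (i # ks)) (map (\<lambda>j i. A i j) is)) vs)"
    unfolding teval_sum_T Cons.IH by (simp add: sum_distrib_left)
  finally show ?case by simp
qed simp

section \<open>Bilinear and trilinear forms given by components\<close>

definition bilin :: "nat \<Rightarrow> (nat \<Rightarrow> nat \<Rightarrow> real) \<Rightarrow> pt \<Rightarrow> pt \<Rightarrow> real" where
  "bilin n M u v = (\<Sum>q<n. u q * (\<Sum>r<n. v r * M q r))"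

definition trilin :: "nat \<Rightarrow> (nat \<Rightarrow> nat \<Rightarrow> nat \<Rightarrow> real) \<Rightarrow> pt \<Rightarrow> pt \<Rightarrow> pt \<Rightarrow> real" where
  "trilin n N u v w = (\<Sum>s<n. u s * bilin n (N s) v w)"

lemma gv_bilin: "gv n g x v w = bilin n (g x) v w"
  by (simp add: gv_def bilin_def sum_distrib_left mult.assoc)

lemma bilin_cong:
  "(\<And>q r. q < n \<Longrightarrow> r < n \<Longrightarrow> M q r = M' q r) \<Longrightarrow> (\<And>q. q < n \<Longrightarrow> u q = u' q) \<Longrightarrow>
   (\<And>q. q < n \<Longrightarrow> v q = v' q) \<Longrightarrow> bilin n M u v = bilin n M' u' v'"
  by (simp add: bilin_def)

lemma bilin_swap: "bilin n (\<lambda>q r. M r q) v u = bilin n M u v"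
proof -
  have "bilin n M u v = (\<Sum>q<n. \<Sum>r<n. u q * (v r * M q r))" by (simp add: bilin_def sum_distrib_left)
  also have "\<dots> = (\<Sum>r<n. \<Sum>q<n. u q * (v r * M q r))" by (rule sum.swap)
  finally show ?thesis by (simp add: bilin_def sum_distrib_left mult.left_commute)
qed

lemma bilin_linear1:
  "bilin n M (\<lambda>q. u q + u' q) v = bilin n M u v + bilin n M u' v"
  "bilin n M (\<lambda>q. u q - u' q) v = bilin n M u v - bilin n M u' v"
  by (simp_all add: bilin_def distrib_right left_diff_distrib sum.distrib sum_subtractf)

lemma bilin_sum1: "bilin n M (\<lambda>q. \<Sum>m\<in>I. c m * w m q) v = (\<Sum>m\<in>I. c m * bilin n M (w m) v)"
proof -
  let ?V = "\<lambda>q. \<Sum>r<n. v r * M q r"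
  have "bilin n M (\<lambda>q. \<Sum>m\<in>I. c m * w m q) v = (\<Sum>q<n. \<Sum>m\<in>I. c m * (w m q * ?V q))"
    by (simp add: bilin_def sum_distrib_right mult.assoc)
  also have "\<dots> = (\<Sum>m\<in>I. \<Sum>q<n. c m * (w m q * ?V q))" by (rule sum.swap)
  finally show ?thesis by (simp add: bilin_def sum_distrib_left)
qed

lemma bilin_diff2: "bilin n M u (\<lambda>q. v q - v' q) = bilin n M u v - bilin n M u v'"
  by (simp add: bilin_swap[where n = n and M = M and u = u, symmetric] bilin_linear1)

lemma bilin_sum2: "bilin n M u (\<lambda>q. \<Sum>m\<in>I. c m * w m q) = (\<Sum>m\<in>I. c m * bilin n M u (w m))"
  by (simp add: bilin_swap[where n = n and M = M and u = u, symmetric] bilin_sum1)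

lemma bilin_diff_M: "bilin n (\<lambda>q r. M q r - M' q r) u v = bilin n M u v - bilin n M' u v"
  by (simp add: bilin_def right_diff_distrib sum_subtractf)

lemma bilin_sum_M: "bilin n (\<lambda>q r. \<Sum>e\<in>I. c e * M e q r) u v = (\<Sum>e\<in>I. c e * bilin n (M e) u v)"
proof -
  have "bilin n (\<lambda>q r. \<Sum>e\<in>I. c e * M e q r) u v = (\<Sum>q<n. \<Sum>r<n. \<Sum>e\<in>I. c e * (u q * (v r * M e q r)))"
    by (simp add: bilin_def sum_distrib_left mult_ac)
  also have "\<dots> = (\<Sum>q<n. \<Sum>e\<in>I. \<Sum>r<n. c e * (u q * (v r * M e q r)))"
    by (intro sum.cong refl sum.swap)
  also have "\<dots> = (\<Sum>e\<in>I. \<Sum>q<n. \<Sum>r<n. c e * (u q * (v r * M e q r)))" by (rule sum.swap)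
  finally show ?thesis by (simp add: bilin_def sum_distrib_left)
qed

lemma trilin_swap12: "trilin n (\<lambda>s q r. N q s r) u v w = trilin n N v u w"
proof -
  have "trilin n N v u w = (\<Sum>s<n. \<Sum>q<n. v s * (u q * (\<Sum>r<n. w r * N s q r)))"
    by (simp add: trilin_def bilin_def sum_distrib_left)
  also have "\<dots> = (\<Sum>q<n. \<Sum>s<n. v s * (u q * (\<Sum>r<n. w r * N s q r)))" by (rule sum.swap)
  finally show ?thesis by (simp add: trilin_def bilin_def sum_distrib_left mult.left_commute)
qed

lemma trilin_diff_N: "trilin n (\<lambda>s q r. N s q r - N' s q r) u v w = trilin n N u v w - trilin n N' u v w"
  by (simp add: trilin_def bilin_diff_M right_diff_distrib sum_subtractf)

lemma trilin_add_N: "trilin n (\<lambda>s q r. N s q r + N' s q r) u v w = trilin n N u v w + trilin n N' u v w"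
  using trilin_diff_N[of n "\<lambda>s q r. N s q r + N' s q r" N' u v w] by simp

text \<open>Turns the quadratic Christoffel term of the curvature into a nested bilinear
  expression.\<close>

lemma trilin_compose: "trilin n (\<lambda>s q r. \<Sum>e<n. P s e * E e q r) u v w = bilin n P u (\<lambda>e. bilin n (E e) v w)"
  by (simp add: trilin_def bilin_sum_M bilin_def[of n P] mult.commute)

lemma bilin_deriv:
  assumes "\<And>q. q < n \<Longrightarrow> ((\<lambda>t. u t q) has_real_derivative u' q) (at t0)"
    and "\<And>q. q < n \<Longrightarrow> ((\<lambda>t. v t q) has_real_derivative v' q) (at t0)"
    and "\<And>q r. q < n \<Longrightarrow> r < n \<Longrightarrow> ((\<lambda>t. M t q r) has_real_derivative M' q r) (at t0)"
  shows "((\<lambda>t. bilin n (M t) (u t) (v t)) has_real_derivative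
     bilin n M' (u t0) (v t0) + bilin n (M t0) u' (v t0) + bilin n (M t0) (u t0) v') (at t0)"
proof -
  have "((\<lambda>t. \<Sum>q<n. u t q * (\<Sum>r<n. v t r * M t q r)) has_real_derivative
    (\<Sum>q<n. u' q * (\<Sum>r<n. v t0 r * M t0 q r) + (\<Sum>r<n. v' r * M t0 q r + M' q r * v t0 r) * u t0 q)) (at t0)"
    by (intro DERIV_sum DERIV_mult) (use assms in auto)
  then show ?thesis
    unfolding bilin_def[abs_def]
    by (rule DERIV_cong) (simp add: sum.distrib distrib_left distrib_right mult.commute)
qed

section \<open>Symmetry of second partial derivatives\<close>

text \<open>The mean value theorem is applied in \<open>s\<close> to F(s, t0 + \<delta>) - F(s, t0),
  then in \<open>t\<close> to the partial derivative \<open>Fs\<close>.\<close>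

lemma second_difference_mvt:
  fixes F :: "real \<Rightarrow> real \<Rightarrow> real"
  assumes "\<delta> > 0"
    and "\<And>s t. s0 \<le> s \<Longrightarrow> s \<le> s0 + \<delta> \<Longrightarrow> t0 \<le> t \<Longrightarrow> t \<le> t0 + \<delta> \<Longrightarrow>
       ((\<lambda>s. F s t) has_real_derivative Fs s t) (at s)"
    and "\<And>s t. s0 \<le> s \<Longrightarrow> s \<le> s0 + \<delta> \<Longrightarrow> t0 \<le> t \<Longrightarrow> t \<le> t0 + \<delta> \<Longrightarrow>
       ((\<lambda>t. Fs s t) has_real_derivative Fst s t) (at t)"
  shows "\<exists>s t. s0 < s \<and> s < s0 + \<delta> \<and> t0 < t \<and> t < t0 + \<delta> \<and>
     F (s0 + \<delta>) (t0 + \<delta>) - F (s0 + \<delta>) t0 - F s0 (t0 + \<delta>) + F s0 t0 = \<delta> * (\<delta> * Fst s t)"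
proof -
  have "\<exists>z. s0 < z \<and> z < s0 + \<delta> \<and>
     (F (s0 + \<delta>) (t0 + \<delta>) - F (s0 + \<delta>) t0) - (F s0 (t0 + \<delta>) - F s0 t0)
       = (s0 + \<delta> - s0) * (Fs z (t0 + \<delta>) - Fs z t0)"
    by (rule MVT2[of s0 "s0 + \<delta>" "\<lambda>s. F s (t0 + \<delta>) - F s t0"])
      (use assms in \<open>auto intro!: DERIV_diff\<close>)
  then obtain s where s: "s0 < s" "s < s0 + \<delta>"
    "(F (s0 + \<delta>) (t0 + \<delta>) - F (s0 + \<delta>) t0) - (F s0 (t0 + \<delta>) - F s0 t0) = \<delta> * (Fs s (t0 + \<delta>) - Fs s t0)"
    by auto
  have "\<exists>z. t0 < z \<and> z < t0 + \<delta> \<and> Fs s (t0 + \<delta>) - Fs s t0 = (t0 + \<delta> - t0) * Fst s z"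
    by (rule MVT2) (use assms s in auto)
  then obtain t where "t0 < t" "t < t0 + \<delta>" "Fs s (t0 + \<delta>) - Fs s t0 = \<delta> * Fst s t" by auto
  then show ?thesis using s by (intro exI[of _ s] exI[of _ t]) auto
qed

lemma ipd_append: "ipd (as @ bs) h = ipd as (ipd bs h)"
  by (induction as) auto

lemma smooth_fn_pd: "smooth_fn n W h \<Longrightarrow> b < n \<Longrightarrow> smooth_fn n W (pd b h)"
proof -
  assume h: "smooth_fn n W h" and b: "b < n"
  have "ipd as (pd b h) = ipd (as @ [b]) h" for as by (simp add: ipd_append)
  then show ?thesis using h b unfolding smooth_fn_def by simp
qed

lemma smooth_fn_deriv:
  assumes "smooth_fn n W h" "z \<in> W" "a < n"
  shows "((\<lambda>t. h (z(a := t))) has_real_derivative pd a h z) (at (z a))"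
  using assms(1)[unfolded smooth_fn_def, rule_format, of "[]"] assms(2,3)
  by (simp add: pd_def DERIV_deriv_iff_real_differentiable)

lemma smooth_fn_cont: "smooth_fn n W h \<Longrightarrow> cont_on_space n W h"
  unfolding smooth_fn_def by (drule spec[of _ "[]"]) simp

text \<open>The second difference over a small square is symmetric in the two directions and equals
  \<delta>^2 times either mixed derivative at a nearby point; continuity then gives equality at
  \<open>z\<close>.\<close>

lemma clairaut:
  assumes W: "open_in_space n W" and h: "smooth_fn n W h" and z: "z \<in> W" and ab: "a < n" "b < n"
  shows "pd a (pd b h) z = pd b (pd a h) z"
proof (cases "a = b")
  case False
  define P where "P s t = z(a := s, b := t)" for s t
  have sw: "(P s t)(a := s') = P s' t" "(P s t)(b := t') = P s t'" "P s t a = s" "P s t b = t" for s t s' t'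
    using False by (auto simp: P_def)
  have zs: "z \<in> space n" using W z unfolding open_in_space_def by blast
  obtain e where e: "e > 0" "\<And>y. y \<in> space n \<Longrightarrow> (\<forall>i<n. \<bar>y i - z i\<bar> < e) \<Longrightarrow> y \<in> W"
    using W z unfolding open_in_space_def by blast
  have PW: "P s t \<in> W" if "\<bar>s - z a\<bar> < e" "\<bar>t - z b\<bar> < e" for s t
    using that ab zs e(1) by (intro e(2)) (auto simp: P_def space_def)
  define F where "F s t = h (P s t)" for s t
  have d: "((\<lambda>s. H (P s t)) has_real_derivative pd a H (P s t)) (at s)"
    "((\<lambda>t. H (P s t)) has_real_derivative pd b H (P s t)) (at t)"
    if "smooth_fn n W H" "\<bar>s - z a\<bar> < e" "\<bar>t - z b\<bar> < e" for H s t
    using smooth_fn_deriv[OF that(1) PW[OF that(2,3)] ab(1)]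
      smooth_fn_deriv[OF that(1) PW[OF that(2,3)] ab(2)] unfolding sw by auto
  have sm: "smooth_fn n W (pd a (pd b h))" "smooth_fn n W (pd b (pd a h))"
    "smooth_fn n W (pd a h)" "smooth_fn n W (pd b h)"
    using h ab by (auto intro!: smooth_fn_pd)
  show ?thesis
  proof (rule ccontr)
    assume ne: "pd a (pd b h) z \<noteq> pd b (pd a h) z"
    \<comment> \<open>Half the supposed gap; one value lying within \<open>r\<close> of both sides
      is a contradiction.\<close>
    define r where "r = \<bar>pd a (pd b h) z - pd b (pd a h) z\<bar> / 2"
    have r: "r > 0" using ne by (simp add: r_def)
    have cont: "\<exists>d>0. \<forall>s t. \<bar>s - z a\<bar> < d \<longrightarrow> \<bar>t - z b\<bar> < d \<longrightarrow> \<bar>H (P s t) - H z\<bar> < r"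
      if H: "smooth_fn n W H" for H
    proof -
      obtain d where d: "d > 0" "\<And>y. y \<in> W \<Longrightarrow> (\<forall>i<n. \<bar>y i - z i\<bar> < d) \<Longrightarrow> \<bar>H y - H z\<bar> < r"
        using smooth_fn_cont[OF H] z r unfolding cont_on_space_def by metis
      have "\<bar>H (P s t) - H z\<bar> < r" if st: "\<bar>s - z a\<bar> < min d e" "\<bar>t - z b\<bar> < min d e" for s t
        by (rule d(2)) (use st PW d(1) in \<open>auto simp: P_def\<close>)
      then show ?thesis using d(1) e(1) by (intro exI[of _ "min d e"]) auto
    qed
    obtain d1 where d1: "d1 > 0" "\<And>s t. \<bar>s - z a\<bar> < d1 \<Longrightarrow> \<bar>t - z b\<bar> < d1 \<Longrightarrow>
        \<bar>pd a (pd b h) (P s t) - pd a (pd b h) z\<bar> < r"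
      using cont[OF sm(1)] by blast
    obtain d2 where d2: "d2 > 0" "\<And>s t. \<bar>s - z a\<bar> < d2 \<Longrightarrow> \<bar>t - z b\<bar> < d2 \<Longrightarrow>
        \<bar>pd b (pd a h) (P s t) - pd b (pd a h) z\<bar> < r"
      using cont[OF sm(2)] by blast
    define \<delta> where "\<delta> = min e (min d1 d2) / 2"
    have \<delta>: "\<delta> > 0" "\<delta> < e" "\<delta> < d1" "\<delta> < d2" using e(1) d1(1) d2(1) by (auto simp: \<delta>_def min_def)
    have "\<exists>s t. z a < s \<and> s < z a + \<delta> \<and> z b < t \<and> t < z b + \<delta> \<and>
      F (z a + \<delta>) (z b + \<delta>) - F (z a + \<delta>) (z b) - F (z a) (z b + \<delta>) + F (z a) (z b)
         = \<delta> * (\<delta> * pd b (pd a h) (P s t))"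
    proof (rule second_difference_mvt[where F = F and Fs = "\<lambda>s t. pd a h (P s t)"
          and Fst = "\<lambda>s t. pd b (pd a h) (P s t)", OF \<delta>(1)])
      fix s t assume "z a \<le> s" "s \<le> z a + \<delta>" "z b \<le> t" "t \<le> z b + \<delta>"
      then have st: "\<bar>s - z a\<bar> < e" "\<bar>t - z b\<bar> < e" using \<delta>(2) by auto
      show "((\<lambda>s. F s t) has_real_derivative pd a h (P s t)) (at s)"
        unfolding F_def by (rule d(1)[OF h st])
      show "((\<lambda>t. pd a h (P s t)) has_real_derivative pd b (pd a h) (P s t)) (at t)"
        by (rule d(2)[OF sm(3) st])
    qed
    then obtain s t where st: "z a < s" "s < z a + \<delta>" "z b < t" "t < z b + \<delta>"
      "F (z a + \<delta>) (z b + \<delta>) - F (z a + \<delta>) (z b) - F (z a) (z b + \<delta>) + F (z a) (z b)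
         = \<delta> * (\<delta> * pd b (pd a h) (P s t))"
      by blast
    have "\<exists>t s. z b < t \<and> t < z b + \<delta> \<and> z a < s \<and> s < z a + \<delta> \<and>
      F (z a + \<delta>) (z b + \<delta>) - F (z a) (z b + \<delta>) - F (z a + \<delta>) (z b) + F (z a) (z b)
         = \<delta> * (\<delta> * pd a (pd b h) (P s t))"
    proof (rule second_difference_mvt[where F = "\<lambda>t s. F s t" and Fs = "\<lambda>t s. pd b h (P s t)"
          and Fst = "\<lambda>t s. pd a (pd b h) (P s t)", OF \<delta>(1)])
      fix t s assume "z b \<le> t" "t \<le> z b + \<delta>" "z a \<le> s" "s \<le> z a + \<delta>"
      then have st: "\<bar>s - z a\<bar> < e" "\<bar>t - z b\<bar> < e" using \<delta>(2) by auto
      show "((\<lambda>t. F s t) has_real_derivative pd b h (P s t)) (at t)"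
        unfolding F_def by (rule d(2)[OF h st])
      show "((\<lambda>s. pd b h (P s t)) has_real_derivative pd a (pd b h) (P s t)) (at s)"
        by (rule d(1)[OF sm(4) st])
    qed
    then obtain t' s' where st': "z b < t'" "t' < z b + \<delta>" "z a < s'" "s' < z a + \<delta>"
      "F (z a + \<delta>) (z b + \<delta>) - F (z a) (z b + \<delta>) - F (z a + \<delta>) (z b) + F (z a) (z b)
         = \<delta> * (\<delta> * pd a (pd b h) (P s' t'))"
      by blast
    \<comment> \<open>Both sides are the same second difference, computed in the two orders.\<close>
    have "\<delta> * (\<delta> * pd b (pd a h) (P s t)) = \<delta> * (\<delta> * pd a (pd b h) (P s' t'))"
      using st(5) st'(5) by linarith
    then have "pd b (pd a h) (P s t) = pd a (pd b h) (P s' t')" using \<delta>(1) by simp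
    moreover have "\<bar>pd a (pd b h) (P s' t') - pd a (pd b h) z\<bar> < r"
      using st' \<delta> by (intro d1(2)) auto
    moreover have "\<bar>pd b (pd a h) (P s t) - pd b (pd a h) z\<bar> < r"
      using st \<delta> by (intro d2(2)) auto
    ultimately have "\<bar>pd a (pd b h) (P s' t') - pd a (pd b h) z\<bar> + \<bar>pd a (pd b h) (P s' t') - pd b (pd a h) z\<bar> < 2 * r"
      by simp
    moreover have "\<bar>p - q\<bar> \<le> \<bar>o' - p\<bar> + \<bar>o' - q\<bar>" for o' p q :: real by linarith
    ultimately show False unfolding r_def
      by (metis (no_types, lifting) linorder_not_le nonzero_mult_div_cancel_left times_divide_eq_right zero_neq_numeral)
  qed
qed simp

section \<open>Local isometries\<close>

lemma trilin_rotate: "trilin n (\<lambda>s q r. N r s q) u v w = trilin n N w u v"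
proof -
  have "trilin n (\<lambda>s q r. N r s q) u v w = trilin n (\<lambda>s r q. N r s q) u w v"
    unfolding trilin_def using bilin_swap[of n "\<lambda>r q. N r s q" v w for s] by simp
  also have "\<dots> = trilin n N w u v" by (rule trilin_swap12)
  finally show ?thesis .
qed

lemma trilin_half: "trilin n (\<lambda>s q r. N s q r / 2) u v w = trilin n N u v w / 2"
  by (simp add: trilin_def bilin_def sum_divide_distrib[symmetric])

lemma trilin_cong:
  "(\<And>s q r. s < n \<Longrightarrow> q < n \<Longrightarrow> r < n \<Longrightarrow> N s q r = N' s q r) \<Longrightarrow> trilin n N u v w = trilin n N' u v w"
  by (simp add: trilin_def bilin_def)

lemma open_in_space_line:
  assumes "open_in_space n W" "z \<in> W" "a < n"
  shows "\<forall>\<^sub>F t in nhds (z a). z(a := t) \<in> W"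
proof -
  have zs: "z \<in> space n" using assms unfolding open_in_space_def by blast
  obtain e where e: "e > 0" "\<And>y. y \<in> space n \<Longrightarrow> (\<forall>i<n. \<bar>y i - z i\<bar> < e) \<Longrightarrow> y \<in> W"
    using assms unfolding open_in_space_def by blast
  have "z(a := t) \<in> W" if "dist t (z a) < e" for t
    by (rule e(2)) (use that zs assms(3) e(1) in \<open>auto simp: space_def dist_real_def\<close>)
  then show ?thesis unfolding eventually_nhds_metric using e(1) by blast
qed

text \<open>An identity on an open set holds near the base point of each coordinate line, hence may
  be differentiated.\<close>

lemma deriv_eq_on:
  assumes "open_in_space n W" "z \<in> W" "a < n" "\<And>w. w \<in> W \<Longrightarrow> h1 w = h2 w"
    and "((\<lambda>t. h1 (z(a := t))) has_real_derivative D1) (at (z a))"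
    and "((\<lambda>t. h2 (z(a := t))) has_real_derivative D2) (at (z a))"
  shows "D1 = D2"
proof -
  have ev: "\<forall>\<^sub>F t in nhds (z a). h1 (z(a := t)) = h2 (z(a := t))"
    using open_in_space_line[OF assms(1-3)] by eventually_elim (rule assms(4))
  have "((\<lambda>t. h2 (z(a := t))) has_real_derivative D1) (at (z a))"
    using assms(5) DERIV_cong_ev[OF refl ev refl] by blast
  then show ?thesis using assms(6) by (rule DERIV_unique)
qed

locale gF_local_isometry = gF_manifold +
  fixes W :: "pt set" and \<phi> :: "pt \<Rightarrow> pt"
  assumes openW: "open_in_space n W" and smooth: "smooth_map n W \<phi>"
    and isom: "\<And>z a b. z \<in> W \<Longrightarrow> a < n \<Longrightarrow> b < n \<Longrightarrow>
      (\<Sum>c<n. \<Sum>d<n. pd a (\<lambda>w. \<phi> w c) z * pd b (\<lambda>w. \<phi> w d) z * g (\<phi> z) c d) = g z a b"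
begin

text \<open>Jacobian and Hessian of \<open>\<phi>\<close>, with the component of
  \<open>\<phi>\<close> as first index. The vector \<open>col z a\<close> is the image of d_a under
  the differential, and \<open>Gam\<close> is the Christoffel bilinear map.\<close>

definition J :: "nat \<Rightarrow> nat \<Rightarrow> pt \<Rightarrow> real" where "J c a = pd a (\<lambda>w. \<phi> w c)"
definition H :: "nat \<Rightarrow> nat \<Rightarrow> nat \<Rightarrow> pt \<Rightarrow> real" where "H c a b = pd a (J c b)"
definition col :: "pt \<Rightarrow> nat \<Rightarrow> pt" where "col z a = (\<lambda>c. J c a z)"
definition Hv :: "pt \<Rightarrow> nat \<Rightarrow> nat \<Rightarrow> pt" where "Hv z a b = (\<lambda>c. H c a b z)"
definition Gam :: "pt \<Rightarrow> pt \<Rightarrow> pt \<Rightarrow> pt" where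
  "Gam y u v = (\<lambda>m. bilin n (\<lambda>p q. chr n g y m p q) u v)"

lemma smooth_phi: "c < n \<Longrightarrow> smooth_fn n W (\<lambda>w. \<phi> w c)"
  using smooth unfolding smooth_map_def by blast

lemma smooth_J: "c < n \<Longrightarrow> a < n \<Longrightarrow> smooth_fn n W (J c a)"
  unfolding J_def by (intro smooth_fn_pd smooth_phi)

lemma smooth_H: "c < n \<Longrightarrow> a < n \<Longrightarrow> b < n \<Longrightarrow> smooth_fn n W (H c a b)"
  unfolding H_def by (intro smooth_fn_pd smooth_J)

lemma phi_deriv: "z \<in> W \<Longrightarrow> c < n \<Longrightarrow> a < n \<Longrightarrow>
    ((\<lambda>t. \<phi> (z(a := t)) c) has_real_derivative J c a z) (at (z a))"
  unfolding J_def by (rule smooth_fn_deriv[OF smooth_phi])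

lemma J_deriv: "z \<in> W \<Longrightarrow> c < n \<Longrightarrow> a < n \<Longrightarrow> b < n \<Longrightarrow>
    ((\<lambda>t. J c b (z(a := t))) has_real_derivative H c a b z) (at (z a))"
  unfolding H_def by (rule smooth_fn_deriv[OF smooth_J])

lemma H_sym: "z \<in> W \<Longrightarrow> c < n \<Longrightarrow> a < n \<Longrightarrow> b < n \<Longrightarrow> H c a b z = H c b a z"
  unfolding H_def J_def by (rule clairaut[OF openW smooth_phi])

lemma Hv_sym: "z \<in> W \<Longrightarrow> a < n \<Longrightarrow> b < n \<Longrightarrow> c < n \<Longrightarrow> Hv z a b c = Hv z b a c"
  unfolding Hv_def by (rule H_sym)

lemma chain_deriv:
  assumes "has_total_deriv n h D (\<phi> z)" "z \<in> W" "a < n"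
  shows "((\<lambda>t. h (\<phi> (z(a := t)))) has_real_derivative (\<Sum>p<n. D p * J p a z)) (at (z a))"
  by (rule has_total_derivD[OF assms(1), where c = "\<lambda>t. \<phi> (z(a := t))"])
    (use assms phi_deriv in auto)

section \<open>Pullback of the metric and of the connection\<close>

lemma g_pullback: "z \<in> W \<Longrightarrow> a < n \<Longrightarrow> b < n \<Longrightarrow> g z a b = bilin n (g (\<phi> z)) (col z a) (col z b)"
  using isom[of z a b] unfolding bilin_def col_def J_def by (simp add: sum_distrib_left mult.assoc)

lemma dg_pullback:
  assumes "z \<in> W" "e < n" "a < n" "b < n"
  shows "dg z e a b = trilin n (dg (\<phi> z)) (col z e) (col z a) (col z b)
    + bilin n (g (\<phi> z)) (Hv z e a) (col z b) + bilin n (g (\<phi> z)) (col z a) (Hv z e b)"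
proof -
  let ?M' = "\<lambda>q r. \<Sum>p<n. J p e z * dg (\<phi> z) p q r"
  \<comment> \<open>Each \<open>z(e := z e)\<close> is just \<open>z\<close>, written as the base
    point of the coordinate line to fit \<open>bilin_deriv\<close>.\<close>
  have "((\<lambda>t. bilin n (g (\<phi> (z(e := t)))) (col (z(e := t)) a) (col (z(e := t)) b)) has_real_derivative
    bilin n ?M' (col (z(e := z e)) a) (col (z(e := z e)) b) + bilin n (g (\<phi> (z(e := z e)))) (Hv z e a) (col (z(e := z e)) b)
    + bilin n (g (\<phi> (z(e := z e)))) (col (z(e := z e)) a) (Hv z e b)) (at (z e))"
  proof (rule bilin_deriv)
    fix q r assume "q < n" "r < n"
    show "((\<lambda>t. g (\<phi> (z(e := t))) q r) has_real_derivative ?M' q r) (at (z e))"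
      using chain_deriv[OF has_total_deriv_g assms(1,2)] by (simp add: mult.commute)
  qed (use assms J_deriv in \<open>auto simp: col_def Hv_def\<close>)
  moreover have "bilin n ?M' (col z a) (col z b) = trilin n (dg (\<phi> z)) (col z e) (col z a) (col z b)"
    by (simp add: bilin_sum_M trilin_def col_def)
  moreover have "((\<lambda>t. g (z(e := t)) a b) has_real_derivative dg z e a b) (at (z e))"
    by (rule has_total_deriv_line[OF has_total_deriv_g assms(2)])
  ultimately show ?thesis
    using deriv_eq_on[OF openW assms(1,2), of "\<lambda>z. g z a b" "\<lambda>z. bilin n (g (\<phi> z)) (col z a) (col z b)"]
      g_pullback assms by simp
qed

lemma trilin_chr1: "trilin n (chr1 y) u v w = (trilin n (dg y) u v w + trilin n (dg y) v u w - trilin n (dg y) w u v) / 2"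
  unfolding chr1_def[abs_def] trilin_half trilin_diff_N trilin_add_N trilin_swap12[of n "dg y" u v w] trilin_rotate[of n "dg y"] ..

text \<open>In the Koszul combination of the three differentiated identities, symmetry of the
  Hessian and of the metric cancels all Hessian terms except two equal ones.\<close>

lemma chr1_pullback:
  assumes "z \<in> W" "a < n" "b < n" "e < n"
  shows "chr1 z a b e = bilin n (g (\<phi> z)) (Hv z a b) (col z e)
    + trilin n (chr1 (\<phi> z)) (col z a) (col z b) (col z e)"
proof -
  have gs: "bilin n (g (\<phi> z)) u v = bilin n (g (\<phi> z)) v u" for u v
    using bilin_swap[of n "g (\<phi> z)" v u] g_sym by simp
  have hs: "bilin n (g (\<phi> z)) (Hv z p q) u = bilin n (g (\<phi> z)) (Hv z q p) u" if "p < n" "q < n" for p q u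
    by (rule bilin_cong) (use that assms Hv_sym in auto)
  show ?thesis
    unfolding trilin_chr1 chr1_def dg_pullback[OF assms(1,2,3,4)] dg_pullback[OF assms(1,3,2,4)]
      dg_pullback[OF assms(1,4,2,3)]
    using hs[OF assms(2,3), of "col z e"] hs[OF assms(2,4), of "col z b"] hs[OF assms(3,4), of "col z a"]
      gs[of "col z a" "Hv z b e"] gs[of "col z a" "Hv z e b"] gs[of "col z b" "Hv z a e"]
    by (simp add: field_simps)
qed

lemma trilin_chr1_Gam: "trilin n (chr1 y) u v w = bilin n (g y) (Gam y u v) w"
proof -
  have "trilin n (chr1 y) u v w = trilin n (\<lambda>p q r. \<Sum>m<n. chr n g y m p q * g y m r) u v w"
    by (rule trilin_cong) (simp add: chr_lower)
  also have "\<dots> = (\<Sum>p<n. u p * (\<Sum>q<n. v q * (\<Sum>m<n. chr n g y m p q * (\<Sum>r<n. w r * g y m r))))"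
  proof -
    have "(\<Sum>r<n. w r * (\<Sum>m<n. chr n g y m p q * g y m r)) =
       (\<Sum>m<n. chr n g y m p q * (\<Sum>r<n. w r * g y m r))" for p q
      using sum_mult_swap[of w "\<lambda>r m. g y m r" "\<lambda>m. chr n g y m p q" "{..<n}" "{..<n}"]
      by (simp add: mult.commute)
    then show ?thesis by (simp add: trilin_def bilin_def)
  qed
  also have "\<dots> = (\<Sum>m<n. (\<Sum>p<n. u p * (\<Sum>q<n. v q * chr n g y m p q)) * (\<Sum>r<n. w r * g y m r))"
    unfolding sum_mult_swap ..
  finally show ?thesis by (simp add: bilin_def Gam_def)
qed

lemma nondegenerate:
  assumes "z \<in> W" "\<And>e. e < n \<Longrightarrow> bilin n (g (\<phi> z)) X (col z e) = 0" "c < n"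
  shows "X c = 0"
proof -
  \<comment> \<open>The matrix \<open>M\<close> is the inverse source metric times the transposed
    Jacobian times the target metric. By the pullback identity it is a left inverse of the Jacobian,
    hence also a right inverse.\<close>
  define G where "G m c = (\<Sum>d<n. col z m d * g (\<phi> z) c d)" for m c
  define M where "M e c = (\<Sum>m<n. gi z e m * G m c)" for e c
  have M: "(\<Sum>c<n. M e c * Y c) = (\<Sum>m<n. gi z e m * bilin n (g (\<phi> z)) Y (col z m))" for e Y
  proof -
    have "(\<Sum>c<n. M e c * Y c) = (\<Sum>c<n. \<Sum>m<n. gi z e m * (Y c * G m c))"
      by (simp add: M_def sum_distrib_right sum_distrib_left mult_ac)
    also have "\<dots> = (\<Sum>m<n. \<Sum>c<n. gi z e m * (Y c * G m c))" by (rule sum.swap)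
    finally show ?thesis by (simp add: bilin_def G_def sum_distrib_left)
  qed
  have "(\<Sum>c<n. M e c * J c a z) = (if e = a then 1 else 0)" if "e < n" "a < n" for e a
  proof -
    have "(\<Sum>c<n. M e c * J c a z) = (\<Sum>m<n. gi z e m * g z a m)"
      using M[of e "col z a"] g_pullback[OF assms(1) that(2)] by (simp add: col_def)
    then show ?thesis using gi_g[OF that, of z] g_sym[of z a] by simp
  qed
  then have inv: "(\<Sum>e<n. J c e z * M e d) = (if c = d then 1 else 0)" if "d < n" for d
    using left_inverse_imp_right_inverse[of n M "\<lambda>c a. J c a z" c d] assms(3) that by simp
  have "X c = (\<Sum>d<n. (if c = d then 1 else 0) * X d)" using assms(3) by (simp add: if_zero_mult)
  also have "\<dots> = (\<Sum>d<n. (\<Sum>e<n. J c e z * M e d) * X d)" by (simp add: inv)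
  also have "\<dots> = (\<Sum>d<n. \<Sum>e<n. J c e z * (M e d * X d))" by (simp add: sum_distrib_right mult.assoc)
  also have "\<dots> = (\<Sum>e<n. \<Sum>d<n. J c e z * (M e d * X d))" by (rule sum.swap)
  also have "\<dots> = (\<Sum>e<n. J c e z * (\<Sum>d<n. M e d * X d))" by (simp add: sum_distrib_left)
  also have "\<dots> = 0" using M[of _ X] assms(2) by simp
  finally show ?thesis .
qed

text \<open>The transformation law of the connection: the difference of the two sides is orthogonal
  to all columns of the Jacobian, which span.\<close>

lemma chr_pullback:
  assumes "z \<in> W" "a < n" "b < n" "c < n"
  shows "H c a b z = (\<Sum>m<n. chr n g z m a b * J c m z) - Gam (\<phi> z) (col z a) (col z b) c"
proof -
  let ?X = "\<lambda>c. Hv z a b c + Gam (\<phi> z) (col z a) (col z b) c - (\<Sum>m<n. chr n g z m a b * col z m c)"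
  have "bilin n (g (\<phi> z)) ?X (col z e) = 0" if e: "e < n" for e
  proof -
    have "(\<Sum>m<n. chr n g z m a b * bilin n (g (\<phi> z)) (col z m) (col z e)) = (\<Sum>m<n. chr n g z m a b * g z m e)"
      using assms e by (simp add: g_pullback)
    also have "\<dots> = chr1 z a b e" using assms e by (simp add: chr_lower)
    finally show ?thesis
      unfolding bilin_linear1 bilin_sum1 using chr1_pullback[OF assms(1-3) e] trilin_chr1_Gam by simp
  qed
  from nondegenerate[OF assms(1) this assms(4)] show ?thesis by (simp add: Hv_def col_def)
qed

section \<open>Pullback of the curvature and of its covariant derivatives\<close>

lemma chr_pullback_deriv:
  assumes "z \<in> W" "d < n" "a < n" "b < n" "p < n"
  shows "pd d (H p a b) z =
    (\<Sum>m<n. pd d (\<lambda>y. chr n g y m a b) z * J p m z) + (\<Sum>m<n. chr n g z m a b * H p d m z)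
    - (trilin n (\<lambda>s q r. pd s (\<lambda>y. chr n g y p q r) (\<phi> z)) (col z d) (col z a) (col z b)
       + bilin n (chr n g (\<phi> z) p) (Hv z d a) (col z b) + bilin n (chr n g (\<phi> z) p) (col z a) (Hv z d b))"
proof (rule deriv_eq_on[OF openW assms(1,2)])
  fix w assume "w \<in> W"
  then show "H p a b w = (\<Sum>m<n. chr n g w m a b * J p m w) - bilin n (chr n g (\<phi> w) p) (col w a) (col w b)"
    using chr_pullback[of w a b p] assms by (simp add: Gam_def)
next
  show "((\<lambda>t. H p a b (z(d := t))) has_real_derivative pd d (H p a b) z) (at (z d))"
    using smooth_fn_deriv[OF smooth_H] assms by blast
next
  let ?M' = "\<lambda>q r. \<Sum>s<n. J s d z * pd s (\<lambda>y. chr n g y p q r) (\<phi> z)"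
  have 1: "((\<lambda>t. bilin n (chr n g (\<phi> (z(d := t))) p) (col (z(d := t)) a) (col (z(d := t)) b)) has_real_derivative
    bilin n ?M' (col (z(d := z d)) a) (col (z(d := z d)) b)
    + bilin n (chr n g (\<phi> (z(d := z d))) p) (Hv z d a) (col (z(d := z d)) b)
    + bilin n (chr n g (\<phi> (z(d := z d))) p) (col (z(d := z d)) a) (Hv z d b)) (at (z d))"
  proof (rule bilin_deriv)
    fix q r assume "q < n" "r < n"
    then show "((\<lambda>t. chr n g (\<phi> (z(d := t))) p q r) has_real_derivative ?M' q r) (at (z d))"
      using chain_deriv[OF has_total_deriv_chr assms(1,2), of p q r] assms by (simp add: mult.commute)
  qed (use assms J_deriv in \<open>auto simp: col_def Hv_def\<close>)
  have 2: "bilin n ?M' (col z a) (col z b) =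
     trilin n (\<lambda>s q r. pd s (\<lambda>y. chr n g y p q r) (\<phi> z)) (col z d) (col z a) (col z b)"
    by (simp add: bilin_sum_M trilin_def col_def)
  have 3: "((\<lambda>t. \<Sum>m<n. chr n g (z(d := t)) m a b * J p m (z(d := t))) has_real_derivative
     (\<Sum>m<n. pd d (\<lambda>y. chr n g y m a b) z * J p m (z(d := z d)) + H p d m z * chr n g (z(d := z d)) m a b)) (at (z d))"
    by (intro DERIV_sum DERIV_mult has_total_deriv_line[OF has_total_deriv_chr] J_deriv) (use assms in auto)
  show "((\<lambda>t. (\<Sum>m<n. chr n g (z(d := t)) m a b * J p m (z(d := t)))
      - bilin n (chr n g (\<phi> (z(d := t))) p) (col (z(d := t)) a) (col (z(d := t)) b)) has_real_derivative
    (\<Sum>m<n. pd d (\<lambda>y. chr n g y m a b) z * J p m z) + (\<Sum>m<n. chr n g z m a b * H p d m z)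
    - (trilin n (\<lambda>s q r. pd s (\<lambda>y. chr n g y p q r) (\<phi> z)) (col z d) (col z a) (col z b)
       + bilin n (chr n g (\<phi> z) p) (Hv z d a) (col z b) + bilin n (chr n g (\<phi> z) p) (col z a) (Hv z d b))) (at (z d))"
    using DERIV_diff[OF 3 1] by (simp add: 2 sum.distrib mult.commute)
qed

text \<open>Differentiating the transformation law expresses the third derivatives of
  \<open>\<phi>\<close>. Their symmetry in \<open>d\<close> and \<open>a\<close> removes them, and
  reusing the law for the second derivatives leaves the curvature on both sides.\<close>

lemma Rup_pullback:
  assumes "z \<in> W" "d < n" "a < n" "b < n" "p < n"
  shows "(\<Sum>m<n. Rup z m d a b * J p m z) = trilin n (Rup (\<phi> z) p) (col z d) (col z a) (col z b)"
proof -
  let ?G = "\<lambda>u v. bilin n (chr n g (\<phi> z) p) u v"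
  let ?t = "\<lambda>s q r. pd s (\<lambda>y. chr n g y p q r) (\<phi> z)"
  have e1: "(\<Sum>m<n. chr n g z m a b * H p d m z) =
     (\<Sum>m<n. (\<Sum>e<n. chr n g z e a b * chr n g z m d e) * J p m z)
     - (\<Sum>m<n. chr n g z m a b * ?G (col z d) (col z m))" if "a < n" "d < n" for a d
  proof -
    have "(\<Sum>m<n. chr n g z m a b * H p d m z) =
       (\<Sum>m<n. chr n g z m a b * (\<Sum>e<n. chr n g z e d m * J p e z))
       - (\<Sum>m<n. chr n g z m a b * ?G (col z d) (col z m))"
      using that assms(1,5) by (simp add: chr_pullback Gam_def right_diff_distrib sum_subtractf)
    then show ?thesis unfolding sum_mult_swap .
  qed
  have e2: "?G (col z a) (Hv z d b) = (\<Sum>m<n. chr n g z m d b * ?G (col z a) (col z m))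
     - ?G (col z a) (Gam (\<phi> z) (col z d) (col z b))" if "a < n" "d < n" for a d
  proof -
    have "?G (col z a) (Hv z d b) = ?G (col z a) (\<lambda>q. (\<Sum>m<n. chr n g z m d b * col z m q)
        - Gam (\<phi> z) (col z d) (col z b) q)"
      using that assms by (intro bilin_cong) (auto simp: Hv_def col_def chr_pullback)
    then show ?thesis unfolding bilin_diff2 bilin_sum2 .
  qed
  \<comment> \<open>This term is symmetric in \<open>d\<close> and \<open>a\<close>, so it cancels
    between the two expansions.\<close>
  have e3: "?G (Hv z d a) (col z b) = ?G (Hv z a d) (col z b)"
    using assms Hv_sym by (intro bilin_cong) auto
  have "pd d (H p a b) z = pd a (H p d b) z"
    unfolding H_def using assms by (intro clairaut[OF openW smooth_J]) auto
  then have sym: "(\<Sum>m<n. pd d (\<lambda>y. chr n g y m a b) z * J p m z)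
     + (\<Sum>m<n. (\<Sum>e<n. chr n g z e a b * chr n g z m d e) * J p m z)
     - trilin n ?t (col z d) (col z a) (col z b) + ?G (col z a) (Gam (\<phi> z) (col z d) (col z b))
    = (\<Sum>m<n. pd a (\<lambda>y. chr n g y m d b) z * J p m z)
     + (\<Sum>m<n. (\<Sum>e<n. chr n g z e d b * chr n g z m a e) * J p m z)
     - trilin n ?t (col z a) (col z d) (col z b) + ?G (col z d) (Gam (\<phi> z) (col z a) (col z b))"
    unfolding chr_pullback_deriv[OF assms] chr_pullback_deriv[OF assms(1,3,2,4,5)]
      e1[OF assms(3,2)] e1[OF assms(2,3)] e2[OF assms(3,2)] e2[OF assms(2,3)] e3
    by linarith
  have L: "(\<Sum>m<n. Rup z m d a b * J p m z) = (\<Sum>m<n. pd d (\<lambda>y. chr n g y m a b) z * J p m z)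
     - (\<Sum>m<n. pd a (\<lambda>y. chr n g y m d b) z * J p m z)
     + (\<Sum>m<n. (\<Sum>e<n. chr n g z e a b * chr n g z m d e) * J p m z)
     - (\<Sum>m<n. (\<Sum>e<n. chr n g z e d b * chr n g z m a e) * J p m z)"
    unfolding Rup_def by (simp add: sum_subtractf sum.distrib distrib_right left_diff_distrib)
  have "Rup (\<phi> z) p = (\<lambda>s q r. ?t s q r - ?t q s r
     + ((\<Sum>e<n. chr n g (\<phi> z) p s e * chr n g (\<phi> z) e q r)
       - (\<Sum>e<n. chr n g (\<phi> z) p q e * chr n g (\<phi> z) e s r)))"
    by (intro ext) (simp add: Rup_def sum_subtractf mult.commute)
  then have "trilin n (Rup (\<phi> z) p) (col z d) (col z a) (col z b) =
     trilin n ?t (col z d) (col z a) (col z b) - trilin n (\<lambda>s q r. ?t q s r) (col z d) (col z a) (col z b)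
     + (trilin n (\<lambda>s q r. \<Sum>e<n. chr n g (\<phi> z) p s e * chr n g (\<phi> z) e q r) (col z d) (col z a) (col z b)
      - trilin n (\<lambda>s q r. \<Sum>e<n. chr n g (\<phi> z) p q e * chr n g (\<phi> z) e s r) (col z d) (col z a) (col z b))"
    by (simp only: trilin_add_N trilin_diff_N)
  also have "trilin n (\<lambda>s q r. ?t q s r) (col z d) (col z a) (col z b) = trilin n ?t (col z a) (col z d) (col z b)"
    by (rule trilin_swap12)
  also have "trilin n (\<lambda>s q r. \<Sum>e<n. chr n g (\<phi> z) p q e * chr n g (\<phi> z) e s r) (col z d) (col z a) (col z b)
     = trilin n (\<lambda>s q r. \<Sum>e<n. chr n g (\<phi> z) p s e * chr n g (\<phi> z) e q r) (col z a) (col z d) (col z b)"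
    by (rule trilin_swap12)
  finally show ?thesis
    using sym unfolding L trilin_compose Gam_def by linarith
qed

lemma Riem_pullback:
  assumes "z \<in> W" "a < n" "b < n" "c < n" "d < n"
  shows "Riem n g z a b c d = teval n (nablaR n g 0 (\<phi> z)) [col z a, col z b, col z c, col z d]"
proof -
  let ?w = "\<lambda>p. \<Sum>t<n. col z d t * g (\<phi> z) p t"
  have "Riem n g z a b c d = (\<Sum>m<n. Rup z m a b c * (\<Sum>p<n. J p m z * ?w p))"
    unfolding Riem_Rup using assms by (simp add: g_pullback bilin_def col_def)
  also have "\<dots> = (\<Sum>p<n. (\<Sum>m<n. Rup z m a b c * J p m z) * ?w p)"
    by (rule sum_mult_swap)
  also have "\<dots> = (\<Sum>p<n. trilin n (Rup (\<phi> z) p) (col z a) (col z b) (col z c) * ?w p)"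
    using assms by (simp add: Rup_pullback)
  also have "\<dots> = (\<Sum>i<n. col z a i * (\<Sum>j<n. col z b j * (\<Sum>l<n. col z c l * (\<Sum>p<n. Rup (\<phi> z) p i j l * ?w p))))"
    unfolding trilin_def bilin_def sum_mult_swap[symmetric] ..
  also have "\<dots> = (\<Sum>i<n. col z a i * (\<Sum>j<n. col z b j * (\<Sum>l<n. col z c l * (\<Sum>t<n. col z d t *
      Riem n g (\<phi> z) i j l t))))"
  proof -
    have "(\<Sum>p<n. Rup (\<phi> z) p i j l * ?w p) = (\<Sum>t<n. col z d t * Riem n g (\<phi> z) i j l t)" for i j l
    proof -
      have "(\<Sum>t<n. col z d t * Riem n g (\<phi> z) i j l t) =
         (\<Sum>t<n. col z d t * (\<Sum>p<n. g (\<phi> z) p t * Rup (\<phi> z) p i j l))"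
        by (simp add: Riem_Rup mult.commute)
      also have "\<dots> = (\<Sum>p<n. ?w p * Rup (\<phi> z) p i j l)" by (rule sum_mult_swap)
      finally show ?thesis by (simp add: mult.commute)
    qed
    then show ?thesis by simp
  qed
  finally show ?thesis by simp
qed

text \<open>By the closed form, each component is a finite sum of functions of single coordinates,
  to which the chain rule applies.\<close>

lemma has_total_deriv_nablaR:
  assumes "length is = 4 + l" "set is \<subseteq> {..<n}"
  shows "has_total_deriv n (\<lambda>y. nablaR n g l y is) (\<lambda>i. pd i (\<lambda>y. nablaR n g l y is) x) x"
proof -
  obtain a b c d js where dec: "is = [a, b, c, d] @ js" "length js = l"
    using assms(1) by (auto simp: numeral_eq_Suc length_Suc_conv)
  have eq: "(\<lambda>y. nablaR n g l y is) =
    (\<lambda>y. \<Sum>i\<in>{1..k}. Fc i l (y i) a b c d * (if \<forall>j\<in>set js. j = i then 1 else 0))"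
    unfolding dec(1) using dec assms(2) by (intro ext nablaR_eq) auto
  have "has_total_deriv n (\<lambda>y. \<Sum>i\<in>{1..k}. Fc i l (y i) a b c d * (if \<forall>j\<in>set js. j = i then 1 else 0))
     (\<lambda>m. \<Sum>i\<in>{1..k}. (if m = i then
     Bc i (Suc l) (x i) * (om i a b * ta i c d + ta i a b * om i c d)
     - deriv (Ac i l) (x i) * (om i a b * om i c d) else 0) * (if \<forall>j\<in>set js. j = i then 1 else 0)) x"
    by (intro has_total_deriv_sum has_total_deriv_cong[OF has_total_deriv_mult[OF has_total_deriv_Fc has_total_deriv_const]]) auto
  then show ?thesis unfolding eq by (rule has_total_deriv_pd_self)
qed

text \<open>Induction on the order, differentiating the identity for \<open>l\<close> along
  coordinate \<open>m\<close>. Each slot contributes a Hessian, which the transformation law splits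
  into a source and a target connection term; these complete the covariant derivatives on the two
  sides.\<close>

lemma nablaR_pullback:
  assumes "z \<in> W" "length is = 4 + l" "set is \<subseteq> {..<n}"
  shows "nablaR n g l z is = teval n (nablaR n g l (\<phi> z)) (map (col z) is)"
  using assms
proof (induction l arbitrary: z "is")
  case 0
  then obtain a b c d where dec: "is = [a, b, c, d]" by (auto simp: numeral_eq_Suc length_Suc_conv)
  have "nablaR n g 0 z is = Riem n g z a b c d" by (simp add: dec)
  also have "\<dots> = teval n (nablaR n g 0 (\<phi> z)) (map (col z) is)"
    using Riem_pullback[OF 0(1), of a b c d] 0(3)
    by (simp add: dec del: teval.simps nablaR.simps)
  finally show ?case .
next
  case (Suc l)
  obtain js m where js: "is = js @ [m]" using Suc.prems(2) by (cases "is" rule: rev_cases) auto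
  have l: "length js = 4 + l" and sub: "set js \<subseteq> {..<n}" and m: "m < n" using Suc.prems js by auto
  have jsr: "js ! r < n" if "r < length js" for r using that sub nth_mem by blast
  note z = Suc.prems(1)
  let ?T = "nablaR n g l (\<phi> z)" and ?vs = "map (col z) js"
  let ?D = "\<lambda>p is. pd p (\<lambda>y. nablaR n g l y is) (\<phi> z)"
  let ?Gr = "\<lambda>r. teval n ?T (?vs[r := Gam (\<phi> z) (col z m) (col z (js ! r))])"
  let ?Sr = "\<lambda>r. \<Sum>e<n. chr n g z e m (js ! r) * nablaR n g l z (js[r := e])"
  have slot: "teval n ?T (?vs[r := Hv z m (js ! r)]) = ?Sr r - ?Gr r" if r: "r < length js" for r
  proof -
    have "teval n ?T (?vs[r := Hv z m (js ! r)]) = teval n ?T (?vs[r := (\<lambda>c.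
       (\<Sum>e<n. chr n g z e m (js ! r) * col z e c) - Gam (\<phi> z) (col z m) (col z (js ! r)) c)])"
      using r z m jsr by (intro teval_slot_cong) (auto simp: Hv_def col_def chr_pullback)
    also have "\<dots> = (\<Sum>e<n. chr n g z e m (js ! r) * teval n ?T (?vs[r := col z e])) - ?Gr r"
      using r by (simp add: teval_slot_diff teval_slot_sum)
    \<comment> \<open>The induction hypothesis is used backwards, for the index list with slot
      \<open>r\<close> replaced by \<open>e\<close>.\<close>
    also have "(\<Sum>e<n. chr n g z e m (js ! r) * teval n ?T (?vs[r := col z e])) = ?Sr r"
    proof (intro sum.cong refl arg_cong2[where f = "(*)"])
      fix e assume "e \<in> {..<n}"
      then have "set (js[r := e]) \<subseteq> {..<n}" using sub set_update_subset_insert[of js r e] by auto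
      then show "teval n ?T (?vs[r := col z e]) = nablaR n g l z (js[r := e])"
        using Suc.IH[of z "js[r := e]"] z l by (simp add: map_update)
    qed
    finally show ?thesis .
  qed
  have lhs: "pd m (\<lambda>y. nablaR n g l y js) z =
     teval n (\<lambda>is. \<Sum>p<n. J p m z * ?D p is) ?vs + (\<Sum>r<length js. ?Sr r - ?Gr r)"
  proof (rule deriv_eq_on[OF openW z m])
    show "nablaR n g l w js = teval n (nablaR n g l (\<phi> w)) (map (col w) js)" if "w \<in> W" for w
      by (rule Suc.IH[OF that l sub])
    show "((\<lambda>t. nablaR n g l (z(m := t)) js) has_real_derivative pd m (\<lambda>y. nablaR n g l y js) z) (at (z m))"
      by (rule has_total_deriv_line[OF has_total_deriv_nablaR[OF l sub] m])
    let ?us = "map (\<lambda>j t. col (z(m := t)) j) js"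
    have "((\<lambda>t. teval n (nablaR n g l (\<phi> (z(m := t)))) (map (\<lambda>v. v t) ?us)) has_real_derivative
      teval n (\<lambda>is. \<Sum>p<n. J p m z * ?D p is) (map (\<lambda>v. v (z m)) ?us)
      + (\<Sum>r<length ?us. teval n (nablaR n g l (\<phi> (z(m := z m))))
           ((map (\<lambda>v. v (z m)) ?us)[r := map (Hv z m) js ! r]))) (at (z m))"
    proof (rule teval_deriv)
      fix "is" :: "nat list" assume "length is = length ?us" "set is \<subseteq> {..<n}"
      then show "((\<lambda>t. nablaR n g l (\<phi> (z(m := t))) is) has_real_derivative (\<Sum>p<n. J p m z * ?D p is)) (at (z m))"
        using chain_deriv[OF has_total_deriv_nablaR z m, of "is" l] l by (simp add: mult.commute del: nablaR.simps)
    next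
      fix r i assume "r < length ?us" "i < n"
      then show "((\<lambda>t. (?us ! r) t i) has_real_derivative (map (Hv z m) js ! r) i) (at (z m))"
        using J_deriv[OF z _ m, of i "js ! r"] jsr by (simp add: col_def Hv_def)
    qed simp
    moreover have "map (\<lambda>v. v t) ?us = map (col (z(m := t))) js" for t by simp
    ultimately show "((\<lambda>t. teval n (nablaR n g l (\<phi> (z(m := t)))) (map (col (z(m := t))) js)) has_real_derivative
      teval n (\<lambda>is. \<Sum>p<n. J p m z * ?D p is) ?vs + (\<Sum>r<length js. ?Sr r - ?Gr r)) (at (z m))"
      using slot by (simp add: o_def)
  qed
  have "nablaR n g (Suc l) z is = pd m (\<lambda>y. nablaR n g l y js) z - (\<Sum>r<length js. ?Sr r)"
    by (simp add: js Let_def)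
  \<comment> \<open>The source terms cancel those of the covariant derivative; the target terms
    remain.\<close>
  also have "\<dots> = teval n (\<lambda>is. \<Sum>p<n. J p m z * ?D p is) ?vs - (\<Sum>r<length js. ?Gr r)"
    unfolding lhs by (simp add: sum_subtractf)
  also have "\<dots> = (\<Sum>p<n. J p m z * teval n (?D p) ?vs) - (\<Sum>r<length js. ?Gr r)"
    by (simp only: teval_sum_T)
  also have "(\<Sum>r<length js. ?Gr r) = (\<Sum>p<n. J p m z * (\<Sum>r<length js.
      teval n (\<lambda>is. \<Sum>e<n. chr n g (\<phi> z) e p (is ! r) * ?T (is[r := e])) ?vs))"
  proof -
    have "?Gr r = (\<Sum>p<n. J p m z *
        teval n (\<lambda>is. \<Sum>e<n. chr n g (\<phi> z) e p (is ! r) * ?T (is[r := e])) ?vs)" if r: "r < length js" for r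
    proof -
      have "?Gr r = teval n ?T (?vs[r := (\<lambda>e. \<Sum>p<n. J p m z * (\<Sum>i<n. (?vs ! r) i * chr n g (\<phi> z) e p i))])"
        using r by (simp add: Gam_def bilin_def col_def)
      also have "\<dots> = (\<Sum>p<n. J p m z * teval n ?T (?vs[r := (\<lambda>e. \<Sum>i<n. (?vs ! r) i * chr n g (\<phi> z) e p i)]))"
        using r by (intro teval_slot_sum) simp
      also have "\<dots> = (\<Sum>p<n. J p m z * teval n (\<lambda>is. \<Sum>e<n. chr n g (\<phi> z) e p (is ! r) * ?T (is[r := e])) ?vs)"
        using r by (intro sum.cong refl arg_cong2[where f = "(*)"] teval_contract_slot[symmetric]) simp
      finally show ?thesis .
    qed
    then have "(\<Sum>r<length js. ?Gr r) = (\<Sum>r<length js. \<Sum>p<n. J p m z *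
        teval n (\<lambda>is. \<Sum>e<n. chr n g (\<phi> z) e p (is ! r) * ?T (is[r := e])) ?vs)"
      by (intro sum.cong) auto
    also have "\<dots> = (\<Sum>p<n. \<Sum>r<length js. J p m z *
        teval n (\<lambda>is. \<Sum>e<n. chr n g (\<phi> z) e p (is ! r) * ?T (is[r := e])) ?vs)"
      by (rule sum.swap)
    finally show ?thesis by (simp only: sum_distrib_left)
  qed
  also have "(\<Sum>p<n. J p m z * teval n (?D p) ?vs) - \<dots> = (\<Sum>p<n. J p m z * (teval n (?D p) ?vs
      - (\<Sum>r<length js. teval n (\<lambda>is. \<Sum>e<n. chr n g (\<phi> z) e p (is ! r) * ?T (is[r := e])) ?vs)))"
    by (simp only: right_diff_distrib sum_subtractf)
  also have "\<dots> = (\<Sum>p<n. J p m z * teval n (\<lambda>is. nablaR n g (Suc l) (\<phi> z) (is @ [p])) ?vs)"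
  proof (intro sum.cong refl arg_cong2[where f = "(*)"])
    fix p
    have "teval n (\<lambda>is. nablaR n g (Suc l) (\<phi> z) (is @ [p])) ?vs =
       teval n (\<lambda>is. ?D p is - (\<Sum>r<length js. 1 * (\<Sum>e<n. chr n g (\<phi> z) e p (is ! r) * ?T (is[r := e])))) ?vs"
      by (rule teval_cong) (simp add: Let_def)
    then show "teval n (?D p) ?vs
      - (\<Sum>r<length js. teval n (\<lambda>is. \<Sum>e<n. chr n g (\<phi> z) e p (is ! r) * ?T (is[r := e])) ?vs)
      = teval n (\<lambda>is. nablaR n g (Suc l) (\<phi> z) (is @ [p])) ?vs"
      unfolding teval_diff_T teval_sum_T by simp
  qed
  also have "\<dots> = teval n (nablaR n g (Suc l) (\<phi> z)) (?vs @ [col z m])"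
    unfolding teval_snoc col_def ..
  finally show ?case by (simp add: js del: nablaR.simps)
qed

text \<open>By multilinearity it suffices to test on coordinate vectors, where the pullback
  identities apply.\<close>

lemma model_iso_differential:
  assumes "x \<in> W"
  shows "model_iso n g x g (\<phi> x) l (\<lambda>c a. J c a x)"
  unfolding model_iso_def
proof (intro conjI ballI allI impI)
  have col: "(\<lambda>j i. J i j x) = col x" by (simp add: col_def fun_eq_iff)
  fix v w
  have mv: "bilin n (g (\<phi> x)) (mapv n (\<lambda>c a. J c a x) v) (mapv n (\<lambda>c a. J c a x) w) =
     bilin n (g (\<phi> x)) (\<lambda>q. \<Sum>m<n. v m * col x m q) (\<lambda>q. \<Sum>m<n. w m * col x m q)"
    by (rule bilin_cong) (auto simp: mapv_def col_def mult.commute)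
  show "gv n g (\<phi> x) (mapv n (\<lambda>c a. J c a x) v) (mapv n (\<lambda>c a. J c a x) w) = gv n g x v w"
    unfolding gv_bilin mv bilin_sum1 bilin_sum2 using assms by (simp add: bilin_def[of n "g x"] g_pullback)
next
  fix i vs assume vs: "set vs \<subseteq> space n \<and> length vs = 4 + i"
  have col: "(\<lambda>j i. J i j x) = col x" by (simp add: col_def fun_eq_iff)
  show "teval n (nablaR n g i (\<phi> x)) (map (mapv n (\<lambda>c a. J c a x)) vs) = teval n (nablaR n g i x) vs"
    unfolding teval_map_mapv col using vs assms nablaR_pullback by (intro teval_cong) auto
qed

end

section \<open>Model invariance\<close>

lemma gv_sum_left:
  "gv n g y (\<lambda>i. \<Sum>l\<in>L. c l * X l i) w = (\<Sum>l\<in>L. c l * gv n g y (X l) w)"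
  unfolding gv_bilin by (rule bilin_sum1)

context gF_manifold begin

text \<open>The isometry transports the Gram matrix and order 0 transports the curvature values.
  Linear independence follows from nondegeneracy of the Gram matrix.\<close>

lemma model_iso_normalized_basis:
  assumes iso: "model_iso n g x (gF k eps f') y l A"
    and nb: "normalized_basis k eps f x B"
  shows "normalized_basis k eps f' y (\<lambda>a. mapv n A (B a))"
proof -
  let ?B = "\<lambda>a. mapv n A (B a)"
  have sp: "B a \<in> space n" if "a \<in> lbls k" for a using nb that unfolding normalized_basis_def n_def[symmetric] by blast
  have gB: "gv n (gF k eps f') y (?B a) (?B b) = g_norm eps a b" if "a \<in> lbls k" "b \<in> lbls k" for a b
  proof -
    have "gv n (gF k eps f') y (?B a) (?B b) = gv n g x (B a) (B b)"
      using iso sp[OF that(1)] sp[OF that(2)] unfolding model_iso_def by blast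
    also have "\<dots> = g_norm eps a b" using nb that unfolding normalized_basis_def n_def[symmetric] by blast
    finally show ?thesis .
  qed
  have "teval n (nablaR n (gF k eps f') 0 y) [?B a, ?B b, ?B c, ?B d] = R_norm a b c d"
    if "a \<in> lbls k" "b \<in> lbls k" "c \<in> lbls k" "d \<in> lbls k" for a b c d
  proof -
    have "teval n (nablaR n (gF k eps f') 0 y) (map (mapv n A) [B a, B b, B c, B d])
        = teval n (nablaR n g 0 x) [B a, B b, B c, B d]"
      using iso[unfolded model_iso_def, THEN conjunct2, rule_format, of 0 "[B a, B b, B c, B d]"]
        sp that by (simp del: teval.simps nablaR.simps)
    also have "\<dots> = R_norm a b c d" using nb that unfolding normalized_basis_def n_def[symmetric] by blast
    finally show ?thesis by (simp only: list.map)
  qed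
  moreover have "c a = 0" if c: "\<forall>i. (\<Sum>l\<in>lbls k. c l * ?B l i) = 0" and a: "a \<in> lbls k" for c a
  proof -
    have fin: "finite (lbls k)" by (simp add: lbls_def)
    have z: "(\<Sum>l\<in>lbls k. c l * g_norm eps l b) = 0" if "b \<in> lbls k" for b
    proof -
      have "(\<Sum>l\<in>lbls k. c l * g_norm eps l b) = gv n (gF k eps f') y (\<lambda>i. \<Sum>l\<in>lbls k. c l * ?B l i) (?B b)"
        unfolding gv_sum_left using gB that by simp
      then show ?thesis using c by (simp add: gv_def)
    qed
    \<comment> \<open>The label paired with \<open>a\<close>: no other label has a nonzero product
      with it, so pairing isolates the coefficient of \<open>a\<close>.\<close>
    define b where "b = (case a of LU i \<Rightarrow> LV i | LV i \<Rightarrow> LU i | LS i \<Rightarrow> LS i)"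
    have b: "b \<in> lbls k" using a by (auto simp: b_def lbls_def)
    have ne: "g_norm eps a b \<noteq> 0"
    proof -
      have "eps i \<noteq> 0" if "i \<in> {1..k}" for i using eps_sq[OF that] by (metis mult_zero_left zero_neq_one)
      then show ?thesis using a by (auto simp: b_def g_norm_def lbls_def)
    qed
    have "c l * g_norm eps l b = (if l = a then c a * g_norm eps a b else 0)" for l
      by (auto simp: b_def g_norm_def split: lbl.splits)
    then have "(\<Sum>l\<in>lbls k. c l * g_norm eps l b) = (\<Sum>l\<in>lbls k. if l = a then c a * g_norm eps a b else 0)"
      by (intro sum.cong refl)
    also have "\<dots> = c a * g_norm eps a b" using a fin by simp
    finally have "(\<Sum>l\<in>lbls k. c l * g_norm eps l b) = c a * g_norm eps a b" .
    then show ?thesis using z[OF b] ne by simp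
  qed
  moreover have "?B a \<in> space n" for a by (simp add: space_def mapv_def)
  ultimately show ?thesis using gB unfolding normalized_basis_def n_def[symmetric] by blast
qed

text \<open>The isomorphism must cover order 1 as well as order \<open>p\<close>, because the second
  factor of each summand contains the first covariant derivative.\<close>

lemma model_iso_gamma:
  assumes iso: "model_iso n g x (gF k eps f') y l A"
    and nb: "normalized_basis k eps f x B" and p: "1 \<le> p" "p \<le> l"
  shows "gammaF k eps f' p y (\<lambda>a. mapv n A (B a)) = gammaF k eps f p x B"
proof -
  have sp: "B a \<in> space n" if "a \<in> lbls k" for a using nb that unfolding normalized_basis_def n_def[symmetric] by blast
  have T: "teval n (nablaR n (gF k eps f') i y) (map (mapv n A) vs) = teval n (nablaR n g i x) vs"
    if "i \<le> l" "set vs \<subseteq> space n" "length vs = 4 + i" for i vs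
    using iso that unfolding model_iso_def by blast
  show ?thesis
    unfolding gammaF_def n_def[symmetric]
  proof (intro sum.cong refl arg_cong2[where f = "(*)"] arg_cong2[where f = "(^)"])
    fix j assume "j \<in> {1..k}"
    then have s: "B (LU 0) \<in> space n" "B (LU j) \<in> space n" by (auto intro!: sp simp: lbls_def)
    show "teval n (nablaR n (gF k eps f') p y)
      ([mapv n A (B (LU 0)), mapv n A (B (LU j)), mapv n A (B (LU j)), mapv n A (B (LU 0))]
        @ replicate p (mapv n A (B (LU j)))) =
      teval n (nablaR n g p x) ([B (LU 0), B (LU j), B (LU j), B (LU 0)] @ replicate p (B (LU j)))"
      using T[of p "[B (LU 0), B (LU j), B (LU j), B (LU 0)] @ replicate p (B (LU j))"] p s
      by (simp del: teval.simps nablaR.simps)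
    show "teval n (nablaR n (gF k eps f') 1 y)
      [mapv n A (B (LU 0)), mapv n A (B (LU j)), mapv n A (B (LU j)), mapv n A (B (LU 0)), mapv n A (B (LU j))] =
      teval n (nablaR n g 1 x) [B (LU 0), B (LU j), B (LU j), B (LU 0), B (LU j)]"
      using T[of 1 "[B (LU 0), B (LU j), B (LU j), B (LU 0), B (LU j)]"] p s
      by (simp del: teval.simps nablaR.simps)
  qed
qed

end

section \<open>Independence of the basis, invariance and homogeneity\<close>

lemma gamma_basis_independent:
  assumes "gF_manifold k eps f" "p \<ge> 2" "normalized_basis k eps f x B" "normalized_basis k eps f x B'"
  shows "gammaF k eps f p x B = gammaF k eps f p x B'"
proof -
  interpret gF_manifold k eps f by fact
  interpret b: gF_normalized_basis k eps f x B by unfold_locales fact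
  interpret b': gF_normalized_basis k eps f x B' by unfold_locales fact
  \<comment> \<open>Neither the closed formula nor \<open>Zc\<close> mentions the basis.\<close>
  show ?thesis unfolding b.gamma_formula[OF assms(2)] b'.gamma_formula[OF assms(2)]
    b.Zc_def b'.Zc_def ..
qed

text \<open>Transport the basis to the target, where independence of the basis replaces it by
  \<open>B'\<close>.\<close>

lemma gamma_model_invariant:
  assumes "gF_manifold k eps f" "gF_manifold k eps f'" "2 \<le> p" "p \<le> l"
    and "model_iso (3*k+2) (gF k eps f) x (gF k eps f') y l A"
    and "normalized_basis k eps f x B" "normalized_basis k eps f' y B'"
  shows "gammaF k eps f p x B = gammaF k eps f' p y B'"
proof -
  interpret gF_manifold k eps f by fact
  note iso = assms(5)[folded n_def]
  have "gammaF k eps f p x B = gammaF k eps f' p y (\<lambda>a. mapv n A (B a))"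
    using model_iso_gamma[OF iso assms(6), of p] assms(3,4) by simp
  also have "\<dots> = gammaF k eps f' p y B'"
    by (rule gamma_basis_independent[OF assms(2,3) model_iso_normalized_basis[OF iso assms(6)] assms(7)])
  finally show ?thesis .
qed

text \<open>The differential at \<open>x\<close> of a local isometry taking \<open>x\<close> to
  \<open>y\<close> is a suitable linear map for every order.\<close>

lemma loc_hom_imp_curv_hom:
  assumes "gF_manifold k eps f" "loc_hom (3*k+2) (gF k eps f)"
  shows "curv_hom (3*k+2) (gF k eps f) l"
  unfolding curv_hom_def
proof (intro ballI)
  interpret gF_manifold k eps f by fact
  fix x y assume "x \<in> space (3*k+2)" "y \<in> space (3*k+2)"
  then have "local_isometry_at n g x y" using assms(2) unfolding loc_hom_def n_def by blast
  then obtain W1 W2 \<phi> \<psi> where W: "open_in_space n W1" "x \<in> W1" "\<phi> x = y" "smooth_map n W1 \<phi>"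
    and iso: "\<forall>z\<in>W1. \<forall>a<n. \<forall>b<n.
        (\<Sum>c<n. \<Sum>d<n. pd a (\<lambda>w. \<phi> w c) z * pd b (\<lambda>w. \<phi> w d) z * g (\<phi> z) c d) = g z a b"
    unfolding local_isometry_at_def by blast
  interpret gF_local_isometry k eps f W1 \<phi> by unfold_locales (use W iso in auto)
  show "\<exists>A. model_iso (3*k+2) g x g y l A"
    using model_iso_differential[OF W(2), of l] W(3) unfolding n_def by auto
qed

theorem theorem5p5:
  fixes k :: nat and eps :: "nat \<Rightarrow> real" and f :: "nat \<Rightarrow> real \<Rightarrow> real"
  assumes "k \<ge> 1" and "admissible k eps f"
  shows
    "(\<forall>l\<ge>2. \<forall>x\<in>space (3*k+2). \<forall>B B'.
        normalized_basis k eps f x B \<and> normalized_basis k eps f x B'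
        \<longrightarrow> gammaF k eps f l x B = gammaF k eps f l x B')
   \<and> (\<forall>f' l. l \<ge> 2 \<and> admissible k eps f' \<longrightarrow>
        (\<forall>x\<in>space (3*k+2). \<forall>y\<in>space (3*k+2). \<forall>A B B'.
           model_iso (3*k+2) (gF k eps f) x (gF k eps f') y l A
           \<and> normalized_basis k eps f x B \<and> normalized_basis k eps f' y B'
           \<longrightarrow> gammaF k eps f l x B = gammaF k eps f' l y B'))
   \<and> (\<forall>x\<in>space (3*k+2). \<forall>B. normalized_basis k eps f x B \<longrightarrow>
        gammaF k eps f 2 x B =
          (\<Sum>j=1..k. eps j / (deriv (f j) (x j) + 1)^2 *
             (4 * (deriv (f j) (x j))^2 + 2 * deriv (f j) (x j)
              + 6 * f j (x j) * (deriv ^^ 2) (f j) (x j)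
              - (f j (x j))^2 * (deriv ^^ 3) (f j) (x j) / (deriv (f j) (x j) + 1))))
   \<and> (\<forall>l\<ge>2. curv_hom (3*k+2) (gF k eps f) l \<longrightarrow>
        (\<forall>p. 2 \<le> p \<and> p \<le> l \<longrightarrow> (\<forall>x\<in>space (3*k+2). \<forall>y\<in>space (3*k+2). \<forall>B B'.
           normalized_basis k eps f x B \<and> normalized_basis k eps f y B'
           \<longrightarrow> gammaF k eps f p x B = gammaF k eps f p y B')))
   \<and> (loc_hom (3*k+2) (gF k eps f) \<longrightarrow>
        (\<forall>p\<ge>2. \<forall>x\<in>space (3*k+2). \<forall>y\<in>space (3*k+2). \<forall>B B'.
           normalized_basis k eps f x B \<and> normalized_basis k eps f y B'
           \<longrightarrow> gammaF k eps f p x B = gammaF k eps f p y B'))"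
proof -
  have gF_manifold: "gF_manifold k eps h" if "admissible k eps h" for h
    using assms(1) that by unfold_locales
  note f = gF_manifold[OF assms(2)]
  have inv: "gammaF k eps f p x B = gammaF k eps f p y B'"
    if asm: "curv_hom (3*k+2) (gF k eps f) l" "2 \<le> p" "p \<le> l" "x \<in> space (3*k+2)" "y \<in> space (3*k+2)"
      "normalized_basis k eps f x B" "normalized_basis k eps f y B'" for l p x y B B'
  proof -
    obtain A where "model_iso (3*k+2) (gF k eps f) x (gF k eps f) y l A"
      using asm(1,4,5) unfolding curv_hom_def by blast
    then show ?thesis using gamma_model_invariant[OF f f asm(2,3) _ asm(6,7)] by blast
  qed
  have gamma2: "gammaF k eps f 2 x B = (\<Sum>j=1..k. eps j / (deriv (f j) (x j) + 1)^2 *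
             (4 * (deriv (f j) (x j))^2 + 2 * deriv (f j) (x j)
              + 6 * f j (x j) * (deriv ^^ 2) (f j) (x j)
              - (f j (x j))^2 * (deriv ^^ 3) (f j) (x j) / (deriv (f j) (x j) + 1)))"
    if "normalized_basis k eps f x B" for x B
  proof -
    interpret gF_manifold k eps f by (rule f)
    interpret gF_normalized_basis k eps f x B by unfold_locales (rule that)
    show ?thesis by (rule gamma_2)
  qed
  show ?thesis
  proof (intro conjI)
    show "\<forall>l\<ge>2. \<forall>x\<in>space (3*k+2). \<forall>B B'.
        normalized_basis k eps f x B \<and> normalized_basis k eps f x B'
        \<longrightarrow> gammaF k eps f l x B = gammaF k eps f l x B'"
      by (intro allI impI ballI, elim conjE) (rule gamma_basis_independent[OF f])
    show "\<forall>f' l. l \<ge> 2 \<and> admissible k eps f' \<longrightarrow>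
        (\<forall>x\<in>space (3*k+2). \<forall>y\<in>space (3*k+2). \<forall>A B B'.
           model_iso (3*k+2) (gF k eps f) x (gF k eps f') y l A
           \<and> normalized_basis k eps f x B \<and> normalized_basis k eps f' y B'
           \<longrightarrow> gammaF k eps f l x B = gammaF k eps f' l y B')"
      by (intro allI impI ballI, elim conjE) (rule gamma_model_invariant[OF f gF_manifold _ order_refl])
  next
    show "\<forall>l\<ge>2. curv_hom (3*k+2) (gF k eps f) l \<longrightarrow>
        (\<forall>p. 2 \<le> p \<and> p \<le> l \<longrightarrow> (\<forall>x\<in>space (3*k+2). \<forall>y\<in>space (3*k+2). \<forall>B B'.
           normalized_basis k eps f x B \<and> normalized_basis k eps f y B'
           \<longrightarrow> gammaF k eps f p x B = gammaF k eps f p y B'))"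
      by (intro allI impI ballI, elim conjE) (rule inv)
    show "loc_hom (3*k+2) (gF k eps f) \<longrightarrow>
        (\<forall>p\<ge>2. \<forall>x\<in>space (3*k+2). \<forall>y\<in>space (3*k+2). \<forall>B B'.
           normalized_basis k eps f x B \<and> normalized_basis k eps f y B'
           \<longrightarrow> gammaF k eps f p x B = gammaF k eps f p y B')"
      \<comment> \<open>For each \<open>p\<close> the curvature homogeneity of order
        \<open>p\<close> itself is used.\<close>
      by (intro allI impI ballI, elim conjE) (rule inv[OF loc_hom_imp_curv_hom[OF f] _ order_refl])
  qed (use gamma2 in blast)
qed

end
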